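(* Let $\Theta\subset\mathbb R^p$ be compact with $\|\theta\|\le D_\Theta$ for all $\theta\in\Theta$, let $\sigma:\mathbb R\to\mathbb R$ be $L_\sigma$-Lipschitz and $W_1,W_2,b_1,b_2$ have norms bounded by $D_\Theta$. Fix $T>0$, $\rho\in\mathcal P(\Theta)$ and a compactly supported $\mu_0\in\mathcal P_2(\mathbb R^d)$. Let $\mu\in C([0,T];\mathcal P_2(\mathbb R^d))$ be the unique weak solution of $\partial_t\mu_t+\nabla_x\cdot(\mu_t(V_{\rho,\mu_t}+F))=0$ with initial datum $\mu_0$. For $N\ge2$, let $(x_1^N(t),\dots,x_N^N(t))$ solve the $N$-particle system $$\dot x_i^N(t)=V_{\rho,\mu_t^N}(x_i^N(t))+F(x_i^N(t)),\qquad \mu_t^N=\frac1N\sum_{i=1}^N\delta_{x_i^N(t)},$$ started from i.i.d. initial data $x_i^N(0)\sim\mu_0$. Then there are a constant $C(T)$ (independent of $N$) and a coupling of $(x_i^N)_{i\le N}$ to i.i.d. copies $(\bar x_i)_{i\le N}$ of the solution of the McKean--Vlasov equation $\dot{\bar x}=V_{\rho,\mu_t}(\bar x)+F(\bar x)$, $\bar x(0)\sim\mu_0$, $\mu_t=\mathrm{Law}(\bar x(t))$, such that $$\sup_{t\le T}\ \mathbb E\Big[\max_{i\le N}|x_i^N(t)-\bar x_i(t)|^2\Big]^{1/2}\le C(T)\,\epsilon_N,$$ and $$\mathbb E\big[\mathcal W_2(\mu_t^N,\mu_t)\big]\le C(T)\,\epsilon_N,\qquad t\in[0,T],$$ where $\epsilon_N=N^{-1/4}$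 if $d<4$, $\epsilon_N=N^{-1/4}\sqrt{\log N}$ if $d=4$, and $\epsilon_N=N^{-1/d}$ if $d>4$.
   Context: $\mathcal P_2$: probability measures with finite second moment, with the $2$-Wasserstein distance $\mathcal W_2$. A parameter $\theta=(Q,K,V)$ is a triple of matrices identified with a point of $\mathbb R^p$, with $Qx,Ky$ in a common Euclidean space and $V$ of size $d\times d$. For a probability measure $\mu$ on $\mathbb R^d$, $$K^\theta_\mu(x,y)=\frac{\exp(\frac1{\sqrt d}\langle Qx,Ky\rangle)}{\int\exp(\frac1{\sqrt d}\langle Qx,Ky'\rangle)\,d\mu(y')},\quad A(x,\mu,\theta)=\int K^\theta_\mu(x,y)\,Vy\,d\mu(y),\quad V_{\rho,\mu}(x)=\int_\Theta A(x,\mu,\theta)\,\rho(d\theta).$$ $F(x)=W_2\,\sigma(W_1x+b_1)+b_2$ with $\sigma$ applied entrywise. *)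

theory Defs
  imports "HOL-Probability.Probability"
begin

definition P2 :: "'a::euclidean_space measure set" where
  "P2 = {\<mu>. prob_space \<mu> \<and> sets \<mu> = sets borel \<and> integrable \<mu> (\<lambda>x. (norm x)\<^sup>2)}"

definition couplings ::
    "'a::euclidean_space measure \<Rightarrow> 'a measure \<Rightarrow> ('a \<times> 'a) measure set" where
  "couplings \<mu> \<nu> = {\<gamma>. sets \<gamma> = sets (borel \<Otimes>\<^sub>M borel) \<and>
     distr \<gamma> borel fst = \<mu> \<and> distr \<gamma> borel snd = \<nu>}"

text \<open>Only meaningful on \<^const>\<open>P2\<close>, where the set of couplings is nonempty and
  every coupling has finite cost.\<close>

definition wasserstein2 :: "'a::euclidean_space measure \<Rightarrow> 'a measure \<Rightarrow> real" where
  "wasserstein2 \<mu> \<nu> =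
     sqrt (INF \<gamma>\<in>couplings \<mu> \<nu>. \<integral>z. (dist (fst z) (snd z))\<^sup>2 \<partial>\<gamma>)"

definition continuous_P2_curve :: "real \<Rightarrow> (real \<Rightarrow> 'a::euclidean_space measure) \<Rightarrow> bool" where
  "continuous_P2_curve T \<mu> \<longleftrightarrow>
     (\<forall>t\<in>{0..T}. \<mu> t \<in> P2 \<and>
        ((\<lambda>s. wasserstein2 (\<mu> s) (\<mu> t)) \<longlongrightarrow> 0) (at t within {0..T}))"

definition compactly_supported :: "'a::topological_space measure \<Rightarrow> bool" where
  "compactly_supported \<mu> \<longleftrightarrow> (\<exists>S. compact S \<and> (AE x in \<mu>. x \<in> S))"

definition prob_measures_on :: "'a::topological_space set \<Rightarrow> 'a measure set" where
  "prob_measures_on S = {\<rho>. prob_space \<rho> \<and> sets \<rho> = sets (restrict_space borel S)}"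

text \<open>The push-forward of the uniform distribution on the indices, i.e.
  $\frac1N\sum_{i<N}\delta_{x_i}$.\<close>

definition empirical_measure :: "nat \<Rightarrow> (nat \<Rightarrow> 'a::topological_space) \<Rightarrow> 'a measure" where
  "empirical_measure N x = distr (uniform_count_measure {..<N}) borel x"

text \<open>A parameter is a triple $(Q,K,V)$. The norm of this type is the Euclidean norm of
  the tuple of all matrix entries.\<close>

type_synonym ('d, 'k) param = "(real^'d^'k) \<times> (real^'d^'k) \<times> (real^'d^'d)"

definition attn_weight ::
    "('d::finite, 'k::finite) param \<Rightarrow> real^'d \<Rightarrow> real^'d \<Rightarrow> real" where
  "attn_weight \<theta> x y =
     (case \<theta> of (Q, K, V) \<Rightarrow> exp (1 / sqrt (real CARD('d)) * ((Q *v x) \<bullet> (K *v y))))"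

definition attn_kernel ::
    "('d::finite, 'k::finite) param \<Rightarrow> (real^'d) measure \<Rightarrow> real^'d \<Rightarrow> real^'d \<Rightarrow> real" where
  "attn_kernel \<theta> \<mu> x y = attn_weight \<theta> x y / (\<integral>y'. attn_weight \<theta> x y' \<partial>\<mu>)"

definition attention ::
    "real^'d \<Rightarrow> (real^'d) measure \<Rightarrow> ('d::finite, 'k::finite) param \<Rightarrow> real^'d" where
  "attention x \<mu> \<theta> =
     (case \<theta> of (Q, K, V) \<Rightarrow> \<integral>y. attn_kernel \<theta> \<mu> x y *\<^sub>R (V *v y) \<partial>\<mu>)"

definition attention_field ::
    "('d::finite, 'k::finite) param measure \<Rightarrow> (real^'d) measure \<Rightarrow> real^'d \<Rightarrow> real^'d" where
  "attention_field \<rho> \<mu> x = (\<integral>\<theta>. attention x \<mu> \<theta> \<partial>\<rho>)"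

text \<open>A measure in \<^const>\<open>P2\<close> need not have exponential moments; this says that all
  integrals occurring in \<^const>\<open>attention_field\<close> exist.\<close>

definition attention_field_defined ::
    "('d::finite, 'k::finite) param measure \<Rightarrow> (real^'d) measure \<Rightarrow> bool" where
  "attention_field_defined \<rho> \<mu> \<longleftrightarrow>
     (\<forall>x. (\<forall>(Q, K, V)\<in>space \<rho>.
              integrable \<mu> (attn_weight (Q, K, V) x) \<and>
              integrable \<mu> (\<lambda>y. attn_weight (Q, K, V) x y *\<^sub>R (V *v y))) \<and>
          integrable \<rho> (attention x \<mu>))"

definition mlp ::
    "(real \<Rightarrow> real) \<Rightarrow> real^'d^'m \<Rightarrow> real^'m \<Rightarrow> real^'m^'d \<Rightarrow> real^'d \<Rightarrow>
     real^'d::finite \<Rightarrow> real^'d" where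
  "mlp \<sigma> W\<^sub>1 b\<^sub>1 W\<^sub>2 b\<^sub>2 x = W\<^sub>2 *v (\<chi> j. \<sigma> ((W\<^sub>1 *v x + b\<^sub>1) $ j)) + b\<^sub>2"

text \<open>\<open>\<phi>\<close> is a compactly supported $C^1$ function with gradient \<open>g\<close>.\<close>

definition test_function ::
    "('a::euclidean_space \<Rightarrow> real) \<Rightarrow> ('a \<Rightarrow> 'a) \<Rightarrow> bool" where
  "test_function \<phi> g \<longleftrightarrow>
     (\<forall>x. (\<phi> has_derivative (\<lambda>h. g x \<bullet> h)) (at x)) \<and> continuous_on UNIV g \<and>
     (\<exists>S. compact S \<and> (\<forall>x. x \<notin> S \<longrightarrow> \<phi> x = 0))"

definition weak_solution ::
    "real \<Rightarrow> ('d::finite, 'k::finite) param measure \<Rightarrow> (real^'d \<Rightarrow> real^'d) \<Rightarrow>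
     (real^'d) measure \<Rightarrow> (real \<Rightarrow> (real^'d) measure) \<Rightarrow> bool" where
  "weak_solution T \<rho> F \<mu>0 \<mu> \<longleftrightarrow>
     continuous_P2_curve T \<mu> \<and> \<mu> 0 = \<mu>0 \<and>
     (\<forall>t\<in>{0..T}. attention_field_defined \<rho> (\<mu> t)) \<and>
     (\<forall>\<phi> g. test_function \<phi> g \<longrightarrow>
        (\<forall>t\<in>{0..T}. integrable (\<mu> t) (\<lambda>x. g x \<bullet> (attention_field \<rho> (\<mu> t) x + F x))) \<and>
        set_integrable lborel {0..T}
          (\<lambda>s. \<integral>x. g x \<bullet> (attention_field \<rho> (\<mu> s) x + F x) \<partial>\<mu> s) \<and>
        (\<forall>t\<in>{0..T}. (\<integral>x. \<phi> x \<partial>\<mu> t) - (\<integral>x. \<phi> x \<partial>\<mu>0) =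
          (LBINT s:{0..t}. (\<integral>x. g x \<bullet> (attention_field \<rho> (\<mu> s) x + F x) \<partial>\<mu> s))))"

definition particle_system ::
    "real \<Rightarrow> ('d::finite, 'k::finite) param measure \<Rightarrow> (real^'d \<Rightarrow> real^'d) \<Rightarrow>
     (real^'d) measure \<Rightarrow> nat \<Rightarrow> 'w measure \<Rightarrow> (nat \<Rightarrow> real \<Rightarrow> 'w \<Rightarrow> real^'d) \<Rightarrow> bool" where
  "particle_system T \<rho> F \<mu>0 N M x \<longleftrightarrow>
     prob_space M \<and>
     (\<forall>i<N. \<forall>t\<in>{0..T}. x i t \<in> borel_measurable M) \<and>
     prob_space.indep_vars M (\<lambda>_. borel) (\<lambda>i. x i 0) {..<N} \<and>
     (\<forall>i<N. distr M borel (x i 0) = \<mu>0) \<and>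
     (AE \<omega> in M. \<forall>i<N. \<forall>t\<in>{0..T}.
        ((\<lambda>s. x i s \<omega>) has_vector_derivative
           (attention_field \<rho> (empirical_measure N (\<lambda>j. x j t \<omega>)) (x i t \<omega>) + F (x i t \<omega>)))
        (at t within {0..T}))"

definition mckean_vlasov_solution ::
    "real \<Rightarrow> ('d::finite, 'k::finite) param measure \<Rightarrow> (real^'d \<Rightarrow> real^'d) \<Rightarrow>
     (real^'d) measure \<Rightarrow> (real \<Rightarrow> (real^'d) measure) \<Rightarrow> 'w measure \<Rightarrow>
     (real \<Rightarrow> 'w \<Rightarrow> real^'d) \<Rightarrow> bool" where
  "mckean_vlasov_solution T \<rho> F \<mu>0 \<mu> P z \<longleftrightarrow>
     prob_space P \<and>
     (\<forall>t\<in>{0..T}. z t \<in> borel_measurable P \<and> distr P borel (z t) = \<mu> t) \<and>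
     distr P borel (z 0) = \<mu>0 \<and>
     (AE \<omega> in P. \<forall>t\<in>{0..T}.
        ((\<lambda>s. z s \<omega>) has_vector_derivative
           (attention_field \<rho> (\<mu> t) (z t \<omega>) + F (z t \<omega>))) (at t within {0..T}))"

definition path_space :: "real \<Rightarrow> (real \<Rightarrow> 'a::topological_space) measure" where
  "path_space T = (\<Pi>\<^sub>M t\<in>{0..T}. borel)"

definition path :: "real \<Rightarrow> (real \<Rightarrow> 'w \<Rightarrow> 'a) \<Rightarrow> 'w \<Rightarrow> real \<Rightarrow> 'a" where
  "path T z \<omega> = (\<lambda>t\<in>{0..T}. z t \<omega>)"

definition iid_mckean_vlasov_copies ::
    "real \<Rightarrow> ('d::finite, 'k::finite) param measure \<Rightarrow> (real^'d \<Rightarrow> real^'d) \<Rightarrow>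
     (real^'d) measure \<Rightarrow> (real \<Rightarrow> (real^'d) measure) \<Rightarrow> nat \<Rightarrow> 'w measure \<Rightarrow>
     (nat \<Rightarrow> real \<Rightarrow> 'w \<Rightarrow> real^'d) \<Rightarrow> bool" where
  "iid_mckean_vlasov_copies T \<rho> F \<mu>0 \<mu> N P z \<longleftrightarrow>
     (\<forall>i<N. mckean_vlasov_solution T \<rho> F \<mu>0 \<mu> P (z i)) \<and>
     prob_space.indep_vars P (\<lambda>_. path_space T) (\<lambda>i. path T (z i)) {..<N} \<and>
     (\<forall>i<N. \<forall>j<N. distr P (path_space T) (path T (z i)) = distr P (path_space T) (path T (z j)))"

definition same_joint_path_law ::
    "real \<Rightarrow> nat \<Rightarrow> 'w measure \<Rightarrow> (nat \<Rightarrow> real \<Rightarrow> 'w \<Rightarrow> 'a::topological_space) \<Rightarrow>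
     'v measure \<Rightarrow> (nat \<Rightarrow> real \<Rightarrow> 'v \<Rightarrow> 'a) \<Rightarrow> bool" where
  "same_joint_path_law T N M x P y \<longleftrightarrow>
     distr M (\<Pi>\<^sub>M i\<in>{..<N}. path_space T) (\<lambda>\<omega>. \<lambda>i\<in>{..<N}. path T (x i) \<omega>) =
     distr P (\<Pi>\<^sub>M i\<in>{..<N}. path_space T) (\<lambda>\<omega>. \<lambda>i\<in>{..<N}. path T (y i) \<omega>)"

text \<open>A coupling of the particle system \<open>x\<close> on \<open>M\<close> to i.i.d. McKean--Vlasov copies: a
  probability space \<open>P\<close> carrying a copy \<open>y\<close> of \<open>x\<close> (same joint law) together with the
  i.i.d. processes \<open>z\<close>.\<close>

definition mckean_vlasov_coupling ::
    "real \<Rightarrow> ('d::finite, 'k::finite) param measure \<Rightarrow> (real^'d \<Rightarrow> real^'d) \<Rightarrow>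
     (real^'d) measure \<Rightarrow> (real \<Rightarrow> (real^'d) measure) \<Rightarrow> nat \<Rightarrow>
     'w measure \<Rightarrow> (nat \<Rightarrow> real \<Rightarrow> 'w \<Rightarrow> real^'d) \<Rightarrow>
     'v measure \<Rightarrow> (nat \<Rightarrow> real \<Rightarrow> 'v \<Rightarrow> real^'d) \<Rightarrow>
     (nat \<Rightarrow> real \<Rightarrow> 'v \<Rightarrow> real^'d) \<Rightarrow> bool" where
  "mckean_vlasov_coupling T \<rho> F \<mu>0 \<mu> N M x P y z \<longleftrightarrow>
     particle_system T \<rho> F \<mu>0 N P y \<and>
     same_joint_path_law T N M x P y \<and>
     iid_mckean_vlasov_copies T \<rho> F \<mu>0 \<mu> N P z"

definition chaos_rate :: "nat \<Rightarrow> nat \<Rightarrow> real" where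
  "chaos_rate d N =
     (if d < 4 then real N powr (- 1 / 4)
      else if d = 4 then real N powr (- 1 / 4) * sqrt (ln (real N))
      else real N powr (- 1 / real d))"

end

theory Submission
  imports Defs
begin

text \<open>Synchronous coupling. The field \<open>V\<^sub>\<rho>\<^sub>,\<^sub>\<mu> + F\<close> grows linearly and, for measures and points in a
  fixed ball, is Lipschitz in the point and in the measure, where measures are compared by
  the mean displacement in an arbitrary coupling. A Picard iteration therefore yields a flow \<open>X\<close>
  whose field is generated by the image of \<open>\<mu>0\<close> under the flow itself. These images form a weak
  solution, so by uniqueness they are the given curve \<open>\<mu>\<close>. The i.i.d.\ copies are \<open>X t (x i 0)\<close>,
  on the probability space of the particle system itself.

  By Gronwall's inequality, both the distance of the particles to these copies and the Wasserstein
  distance at time \<open>t\<close> are bounded by a constant times the square root of the cost of any coupling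
  of the initial empirical measure with \<open>\<mu>0\<close>. Such a coupling is built
  along dyadic partitions: matching mass greedily from the finest level upwards leaves at level \<open>n\<close>
  only the discrepancy of the cell masses, whose expectation is at most the square root of
  (number of cells) / \<open>N\<close>. Summing over the levels with weights \<open>4\<^sup>-\<^sup>n\<close> and stopping at the
  best level gives the squared rate in each dimension.\<close>

text \<open>The attention weights are exponentials, so the field is not globally Lipschitz and
  everything must happen in a ball known in advance. The ball comes from attention being an average
  of the values \<open>V y\<close> with weights of total mass one: the exponentials cancel in the
  growth bound, so particles and flow alike stay within radius \<open>(1 + r) * exp (A * T)\<close>,
  and only then does an exponential Lipschitz constant enter. Measures are written as images of maps
  on a common space \<open>\<kappa>\<close>, so choosing a coupling means choosing two maps, and no
  optimal plan is needed. For the particles, \<open>\<kappa>\<close> lives on pairs of an index and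
  a starting point: the index, unlike a position, can be followed in time, so one plan for the
  initial data serves all times. A particle and its copy differ only through the two measures that
  drive them; hence the maximum over all particles obeys the same rate as the Wasserstein distance.
  The cost is a squared distance, so its expectation has the squared rate, and Jensen's inequality
  returns to the rate itself. A separate obstacle is measurability: the Wasserstein distance of a
  random sample is an infimum over uncountably many couplings.\<close>

section \<open>Gronwall's inequality and pointwise bounds for the perceptron and the attention
  weights\<close>

lemma gronwall:
  fixes u :: "real \<Rightarrow> real"
  assumes cont: "continuous_on {0..T} u" and "0 \<le> b"
    and le: "\<And>t. t \<in> {0..T} \<Longrightarrow> u t \<le> a + b * integral {0..t} u"
    and t: "t \<in> {0..T}"
  shows "u t \<le> a * exp (b * t)"
proof -
  \<comment> \<open>The right-hand side of \<open>le\<close>, damped by its own growth factor: the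
    hypothesis makes its derivative nonpositive, so \<open>h t \<le> h 0 = a\<close>.\<close>
  define h where "h s = exp (- b * s) * (a + b * integral {0..s} u)" for s
  have der: "(h has_vector_derivative exp (- b * s) * (b * u s) - b * exp (- b * s) * (a + b * integral {0..s} u))
      (at s within {0..T})" if "s \<in> {0..T}" for s
    unfolding h_def
    by (rule derivative_eq_intros integral_has_vector_derivative[OF cont that]
          has_vector_derivative_mult | simp add: has_real_derivative_iff_has_vector_derivative[symmetric])+
  have "h t \<le> h 0"
  proof -
    have "((\<lambda>s. exp (- b * s) * (b * u s) - b * exp (- b * s) * (a + b * integral {0..s} u))
        has_integral (h t - h 0)) {0..t}"
    proof (rule fundamental_theorem_of_calculus)
      fix s assume "s \<in> {0..t}"
      with t have "s \<in> {0..T}" "{0..t} \<subseteq> {0..T}" by auto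
      then show "(h has_vector_derivative exp (- b * s) * (b * u s) - b * exp (- b * s) * (a + b * integral {0..s} u))
          (at s within {0..t})"
        using has_vector_derivative_within_subset[OF der] by blast
    qed (use t in auto)
    then have "h t - h 0 \<le> 0"
    proof (rule has_integral_le[OF _ has_integral_0])
      fix s assume "s \<in> {0..t}"
      then have "b * u s \<le> b * (a + b * integral {0..s} u)"
        using le[of s] t \<open>0 \<le> b\<close> by (intro mult_left_mono) auto
      then show "exp (- b * s) * (b * u s) - b * exp (- b * s) * (a + b * integral {0..s} u) \<le> 0"
        using mult_left_mono[of "b * u s" "b * (a + b * integral {0..s} u)" "exp (- b * s)"]
        by (simp add: algebra_simps)
    qed
    then show ?thesis by simp
  qed
  then have "exp (- b * t) * (a + b * integral {0..t} u) \<le> a"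
    by (simp add: h_def)
  then have "exp (b * t) * (exp (- b * t) * (a + b * integral {0..t} u)) \<le> exp (b * t) * a"
    by (intro mult_left_mono) auto
  also have "exp (b * t) * (exp (- b * t) * (a + b * integral {0..t} u)) = a + b * integral {0..t} u"
    by (simp add: exp_minus)
  finally show ?thesis
    using le[OF t] by (simp add: mult.commute)
qed

text \<open>The norm of the nested vector type is the Frobenius norm, so Cauchy-Schwarz in each row
  is enough.\<close>

lemma norm_matrix_vector_mult_le: "norm (A *v x) \<le> norm A * norm x"
  for A :: "real^'n^'m"
proof -
  have "norm (A *v x) = L2_set (\<lambda>i. norm ((A *v x) $ i)) UNIV"
    by (simp add: norm_vec_def)
  also have "\<dots> \<le> L2_set (\<lambda>i. norm (A $ i) * norm x) UNIV"
    by (intro L2_set_mono) (auto simp: matrix_vector_mul_component Cauchy_Schwarz_ineq2)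
  also have "\<dots> = norm A * norm x"
    by (simp add: norm_vec_def L2_set_left_distrib)
  finally show ?thesis .
qed

lemma mlp_lipschitz:
  assumes "L-lipschitz_on UNIV \<sigma>"
  shows "norm (mlp \<sigma> W\<^sub>1 b\<^sub>1 W\<^sub>2 b\<^sub>2 x - mlp \<sigma> W\<^sub>1 b\<^sub>1 W\<^sub>2 b\<^sub>2 y) \<le> norm W\<^sub>2 * (L * norm W\<^sub>1) * norm (x - y)"
proof -
  define s where "s x = (\<chi> j. \<sigma> ((W\<^sub>1 *v x + b\<^sub>1) $ j))" for x
  have L: "0 \<le> L" using assms by (rule lipschitz_on_nonneg)
  have "norm (s x - s y) = L2_set (\<lambda>j. norm (s x $ j - s y $ j)) UNIV"
    by (simp add: norm_vec_def)
  also have "\<dots> \<le> L2_set (\<lambda>j. L * norm ((W\<^sub>1 *v (x - y)) $ j)) UNIV"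
  proof (intro L2_set_mono)
    fix j
    have "norm (s x $ j - s y $ j) \<le> L * norm ((W\<^sub>1 *v x + b\<^sub>1) $ j - (W\<^sub>1 *v y + b\<^sub>1) $ j)"
      using lipschitz_onD[OF assms, of "(W\<^sub>1 *v x + b\<^sub>1) $ j" "(W\<^sub>1 *v y + b\<^sub>1) $ j"]
      by (simp add: s_def dist_norm)
    also have "(W\<^sub>1 *v x + b\<^sub>1) $ j - (W\<^sub>1 *v y + b\<^sub>1) $ j = (W\<^sub>1 *v (x - y)) $ j"
      by (simp add: matrix_vector_mult_diff_distrib)
    finally show "norm (s x $ j - s y $ j) \<le> L * norm ((W\<^sub>1 *v (x - y)) $ j)" .
  qed auto
  also have "\<dots> = L * norm (W\<^sub>1 *v (x - y))"
    using L by (subst L2_set_right_distrib[symmetric]) (auto simp: norm_vec_def)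
  also have "\<dots> \<le> L * (norm W\<^sub>1 * norm (x - y))"
    using L by (intro mult_left_mono norm_matrix_vector_mult_le)
  finally have s: "norm (s x - s y) \<le> L * (norm W\<^sub>1 * norm (x - y))" .
  have "norm (mlp \<sigma> W\<^sub>1 b\<^sub>1 W\<^sub>2 b\<^sub>2 x - mlp \<sigma> W\<^sub>1 b\<^sub>1 W\<^sub>2 b\<^sub>2 y) = norm (W\<^sub>2 *v (s x - s y))"
    by (simp add: mlp_def s_def matrix_vector_mult_diff_distrib)
  also have "\<dots> \<le> norm W\<^sub>2 * norm (s x - s y)"
    by (rule norm_matrix_vector_mult_le)
  also have "\<dots> \<le> norm W\<^sub>2 * (L * (norm W\<^sub>1 * norm (x - y)))"
    by (intro mult_left_mono s) auto
  finally show ?thesis by (simp add: mult.assoc)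
qed

text \<open>Convexity instead of the mean value theorem: the tangent bound
  \<open>1 + z \<le> exp z\<close> at \<open>z = v - u\<close> controls the signed difference, and
  exchanging the roles of the two points gives the absolute value.\<close>

lemma abs_exp_diff_le:
  fixes a b c :: real
  assumes "a \<le> c" "b \<le> c"
  shows "\<bar>exp a - exp b\<bar> \<le> exp c * \<bar>a - b\<bar>"
proof -
  have *: "exp u - exp v \<le> exp c * \<bar>u - v\<bar>" if "u \<le> c" for u v :: real
  proof -
    have "1 + (v - u) \<le> exp (v - u)" by (rule exp_ge_add_one_self)
    then have "exp u * (1 + (v - u)) \<le> exp u * exp (v - u)" by (intro mult_left_mono) auto
    then have "exp u - exp v \<le> exp u * (u - v)" by (simp add: exp_diff algebra_simps)
    also have "\<dots> \<le> exp u * \<bar>u - v\<bar>" by (intro mult_left_mono) auto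
    also have "\<dots> \<le> exp c * \<bar>u - v\<bar>" using that by (intro mult_right_mono) auto
    finally show ?thesis .
  qed
  from *[of a b] *[of b a] assms show ?thesis by (auto simp: abs_le_iff abs_minus_commute)
qed

lemma norm_param_le:
  assumes "norm ((Q, K, V) :: ('d::finite, 'k::finite) param) \<le> D"
  shows "norm Q \<le> D" "norm K \<le> D" "norm V \<le> D"
  using assms norm_fst_le[of Q "(K, V)"] norm_snd_le[of "(K, V)" Q] norm_fst_le[of K V] norm_snd_le[of V K]
  by linarith+

text \<open>Bilinearity splits the difference so that only \<open>x'\<close> and \<open>y\<close>
  need a bound. Owing to this asymmetry the same estimate, with \<open>y\<close> set to 0, also
  bounds a single logit. The factor \<open>1 / sqrt d\<close> is at most one and is dropped.\<close>

lemma attn_logit_diff_le: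
  fixes Q K :: "real^'d::finite^'k::finite"
  assumes "norm Q \<le> D" "norm K \<le> D"
    and "norm x' \<le> R" "norm y \<le> R"
  shows "\<bar>1 / sqrt (real CARD('d)) * ((Q *v x) \<bullet> (K *v y)) - 1 / sqrt (real CARD('d)) * ((Q *v x') \<bullet> (K *v y'))\<bar>
    \<le> D\<^sup>2 * R * (norm (x - x') + norm (y - y'))"
proof -
  have D: "0 \<le> D" using assms(1) norm_ge_zero order_trans by blast
  have R: "0 \<le> R" using assms(3) norm_ge_zero order_trans by blast
  have mono: "norm (Q *v u) \<le> D * norm u" "norm (K *v u) \<le> D * norm u" for u
    using norm_matrix_vector_mult_le[of Q u] norm_matrix_vector_mult_le[of K u] assms
      mult_right_mono[of "norm Q" D "norm u"] mult_right_mono[of "norm K" D "norm u"]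
    by fastforce+
  have 1: "1 / sqrt (real CARD('d)) \<le> 1" by simp
  have "\<bar>1 / sqrt (real CARD('d)) * ((Q *v x) \<bullet> (K *v y)) - 1 / sqrt (real CARD('d)) * ((Q *v x') \<bullet> (K *v y'))\<bar>
    = 1 / sqrt (real CARD('d)) * \<bar>(Q *v x) \<bullet> (K *v y) - (Q *v x') \<bullet> (K *v y')\<bar>"
    unfolding right_diff_distrib[symmetric] abs_mult by simp
  also have "\<dots> \<le> 1 * \<bar>(Q *v x) \<bullet> (K *v y) - (Q *v x') \<bullet> (K *v y')\<bar>"
    by (intro mult_right_mono 1) auto
  also have "(Q *v x) \<bullet> (K *v y) - (Q *v x') \<bullet> (K *v y')
      = (Q *v (x - x')) \<bullet> (K *v y) + (Q *v x') \<bullet> (K *v (y - y'))"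
    by (simp add: matrix_vector_mult_diff_distrib inner_diff_left inner_diff_right)
  also have "1 * \<bar>(Q *v (x - x')) \<bullet> (K *v y) + (Q *v x') \<bullet> (K *v (y - y'))\<bar> \<le> norm (Q *v (x - x')) * norm (K *v y) + norm (Q *v x') * norm (K *v (y - y'))"
    using Cauchy_Schwarz_ineq2[of "Q *v (x - x')" "K *v y"] Cauchy_Schwarz_ineq2[of "Q *v x'" "K *v (y - y')"]
    unfolding mult_1 by (smt (verit))
  also have "\<dots> \<le> (D * norm (x - x')) * (D * R) + (D * R) * (D * norm (y - y'))"
    using mono D R assms(3,4)
    by (intro add_mono mult_mono) (auto intro: order_trans[OF mono(1)] order_trans[OF mono(2)] mult_left_mono)
  also have "\<dots> = D\<^sup>2 * R * (norm (x - x') + norm (y - y'))"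
    by (simp add: algebra_simps power2_eq_square)
  finally show ?thesis .
qed

lemma attn_weight_estimates:
  fixes Q K :: "real^'d::finite^'k::finite"
  assumes \<theta>: "norm (Q, K, V) \<le> D" and "norm x \<le> R" "norm x' \<le> R" "norm y \<le> R" "norm y' \<le> R"
  shows "attn_weight (Q, K, V) x y \<le> exp (D\<^sup>2 * R\<^sup>2)"
    and "exp (- (D\<^sup>2 * R\<^sup>2)) \<le> attn_weight (Q, K, V) x y"
    and "\<bar>attn_weight (Q, K, V) x y - attn_weight (Q, K, V) x' y'\<bar>
      \<le> exp (D\<^sup>2 * R\<^sup>2) * (D\<^sup>2 * R) * (norm (x - x') + norm (y - y'))"
proof -
  note QK = norm_param_le(1,2)[OF \<theta>]
  have R: "0 \<le> R" using assms(3) norm_ge_zero order_trans by blast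
  define l where "l x y = 1 / sqrt (real CARD('d)) * ((Q *v x) \<bullet> (K *v y))" for x y
  have diff: "\<bar>l x y - l x' y'\<bar> \<le> D\<^sup>2 * R * (norm (x - x') + norm (y - y'))"
    if "norm x' \<le> R" "norm y \<le> R" for x y x' y'
    unfolding l_def by (rule attn_logit_diff_le[OF QK that])
  have bd: "\<bar>l x y\<bar> \<le> D\<^sup>2 * R\<^sup>2" if "norm x \<le> R" "norm y \<le> R" for x y
  proof -
    have "\<bar>l x y\<bar> \<le> D\<^sup>2 * R * norm y"
      using diff[of x 0 x y] that R by (simp add: l_def norm_minus_commute)
    also have "\<dots> \<le> D\<^sup>2 * R * R" using R that by (intro mult_left_mono) auto
    finally show ?thesis by (simp add: power2_eq_square mult.assoc)
  qed
  have w: "attn_weight (Q, K, V) x y = exp (l x y)" for x y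
    by (simp add: attn_weight_def l_def)
  show "attn_weight (Q, K, V) x y \<le> exp (D\<^sup>2 * R\<^sup>2)" "exp (- (D\<^sup>2 * R\<^sup>2)) \<le> attn_weight (Q, K, V) x y"
    using bd[of x y] assms by (auto simp: w abs_le_iff)
  have "\<bar>exp (l x y) - exp (l x' y')\<bar> \<le> exp (D\<^sup>2 * R\<^sup>2) * \<bar>l x y - l x' y'\<bar>"
    using bd[of x y] bd[of x' y'] assms by (intro abs_exp_diff_le) (auto simp: abs_le_iff)
  also have "\<dots> \<le> exp (D\<^sup>2 * R\<^sup>2) * (D\<^sup>2 * R * (norm (x - x') + norm (y - y')))"
    using diff assms by (intro mult_left_mono) auto
  finally show "\<bar>attn_weight (Q, K, V) x y - attn_weight (Q, K, V) x' y'\<bar>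
      \<le> exp (D\<^sup>2 * R\<^sup>2) * (D\<^sup>2 * R) * (norm (x - x') + norm (y - y'))"
    by (simp add: w mult.assoc)
qed

section \<open>Lipschitz estimates for the attention field\<close>

lemma norm_integral_le:
  fixes f :: "'a \<Rightarrow> 'b::{banach, second_countable_topology}"
  assumes "integrable M g" "f \<in> borel_measurable M" "\<And>x. x \<in> space M \<Longrightarrow> norm (f x) \<le> g x"
  shows "norm (\<integral>x. f x \<partial>M) \<le> (\<integral>x. g x \<partial>M)"
proof -
  have "norm (\<integral>x. f x \<partial>M) \<le> (\<integral>x. norm (f x) \<partial>M)" by (rule integral_norm_bound)
  also have "\<dots> \<le> (\<integral>x. g x \<partial>M)"
    using assms by (intro integral_mono Bochner_Integration.integrable_bound[OF assms(1)])
      (auto intro: order_trans abs_ge_self)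
  finally show ?thesis .
qed

lemma (in finite_measure) integrable_bounded:
  fixes f :: "'a \<Rightarrow> 'b::{banach, second_countable_topology}"
  assumes "f \<in> borel_measurable M" "\<And>x. x \<in> space M \<Longrightarrow> norm (f x) \<le> B"
  shows "integrable M f"
  using assms by (intro integrable_const_bound[where B = B]) auto

lemma continuous_on_matrix_vector_mult[continuous_intros]:
  fixes A :: "'a::topological_space \<Rightarrow> real^'n^'m"
  assumes "continuous_on S A" "continuous_on S x"
  shows "continuous_on S (\<lambda>a. A a *v x a)"
  unfolding matrix_vector_mult_def
  by (intro continuous_intros assms)

lemma continuous_attn_weight:
  "continuous_on UNIV (\<lambda>(\<theta> :: ('d::finite, 'k::finite) param, x, y). attn_weight \<theta> x y)"
  unfolding attn_weight_def split_beta by (intro continuous_intros)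

lemma borel_measurable_attn_weight[measurable]:
  fixes \<theta> :: "'a \<Rightarrow> ('d::finite, 'k::finite) param"
  assumes [measurable]: "\<theta> \<in> borel_measurable M" "x \<in> borel_measurable M" "y \<in> borel_measurable M"
  shows "(\<lambda>a. attn_weight (\<theta> a) (x a) (y a)) \<in> borel_measurable M"
proof -
  have [measurable]: "(\<lambda>(\<theta> :: ('d, 'k) param, x, y). attn_weight \<theta> x y) \<in> borel_measurable borel"
    by (rule borel_measurable_continuous_onI[OF continuous_attn_weight])
  have "(\<lambda>a. (\<lambda>(\<theta> :: ('d, 'k) param, x, y). attn_weight \<theta> x y) (\<theta> a, x a, y a)) \<in> borel_measurable M"
    by measurable
  then show ?thesis by simp
qed

lemma borel_measurable_matrix_vector_mult[measurable]:
  fixes A :: "'a \<Rightarrow> real^'n^'m"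
  assumes [measurable]: "A \<in> borel_measurable M" "x \<in> borel_measurable M"
  shows "(\<lambda>a. A a *v x a) \<in> borel_measurable M"
proof -
  have [measurable]: "(\<lambda>z :: (real^'n^'m) \<times> (real^'n). fst z *v snd z) \<in> borel_measurable borel"
    by (intro borel_measurable_continuous_onI continuous_intros)
  have "(\<lambda>a. (\<lambda>z :: (real^'n^'m) \<times> (real^'n). fst z *v snd z) (A a, x a)) \<in> borel_measurable M"
    by measurable
  then show ?thesis by simp
qed

lemma attention_eq:
  "attention x \<mu> \<theta> = (1 / (\<integral>y. attn_weight \<theta> x y \<partial>\<mu>)) *\<^sub>R (\<integral>y. attn_weight \<theta> x y *\<^sub>R (snd (snd \<theta>) *v y) \<partial>\<mu>)"
proof (cases \<theta>)
  case (fields Q K V)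
  have "attention x \<mu> \<theta> = (\<integral>y. (1 / (\<integral>y. attn_weight \<theta> x y \<partial>\<mu>)) *\<^sub>R (attn_weight \<theta> x y *\<^sub>R (V *v y)) \<partial>\<mu>)"
    by (simp add: attention_def fields attn_kernel_def)
  then show ?thesis by (simp add: fields del: scaleR_scaleR)
qed

text \<open>Representing a measure as an image under \<open>Y\<close> on an auxiliary space
  \<open>\<kappa>\<close> puts the coupling of two measures into the pair of maps \<open>Y\<close>,
  \<open>Y'\<close> on the same \<open>\<kappa>\<close>. All estimates of the field are stated in
  this form.\<close>

lemma attention_distr:
  fixes Y :: "'a \<Rightarrow> real^'d::finite" and \<theta> :: "('d, 'k::finite) param"
  assumes [measurable]: "Y \<in> borel_measurable \<kappa>"
  shows "attention x (distr \<kappa> borel Y) \<theta> = (1 / (\<integral>a. attn_weight \<theta> x (Y a) \<partial>\<kappa>)) *\<^sub>R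
    (\<integral>a. attn_weight \<theta> x (Y a) *\<^sub>R (snd (snd \<theta>) *v Y a) \<partial>\<kappa>)"
  unfolding attention_eq by (simp add: integral_distr)

text \<open>Needed for the outer integral over \<open>\<rho>\<close>. Numerator and denominator are
  integrals depending on the parameter \<open>\<theta>\<close>, so joint measurability of the
  integrands suffices.\<close>

lemma borel_measurable_attention[measurable]:
  fixes \<mu> :: "(real^'d::finite) measure"
  assumes "prob_space \<mu>" and [measurable_cong]: "sets \<mu> = sets borel"
  shows "(attention x \<mu> :: ('d, 'k::finite) param \<Rightarrow> _) \<in> borel_measurable borel"
proof -
  interpret prob_space \<mu> by fact
  have meas_V: "(\<lambda>\<theta> :: ('d, 'k) param. snd (snd \<theta>)) \<in> borel_measurable borel"
    by (intro borel_measurable_continuous_onI continuous_intros)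
  have [measurable]: "(\<lambda>z :: ('d, 'k) param \<times> (real^'d). snd z) \<in> borel_measurable (borel \<Otimes>\<^sub>M \<mu>)"
    "(\<lambda>z :: ('d, 'k) param \<times> (real^'d). fst z) \<in> borel_measurable (borel \<Otimes>\<^sub>M \<mu>)"
    using measurable_snd[of borel \<mu>] by (auto simp: measurable_cong_sets[OF refl assms(2)])
  note [measurable] = measurable_compose[OF measurable_fst meas_V]
  have "(\<lambda>z :: ('d, 'k) param \<times> (real^'d). attn_weight (fst z) x (snd z) *\<^sub>R (snd (snd (fst z)) *v snd z))
      \<in> borel_measurable (borel \<Otimes>\<^sub>M \<mu>)"
    "(\<lambda>z :: ('d, 'k) param \<times> (real^'d). attn_weight (fst z) x (snd z)) \<in> borel_measurable (borel \<Otimes>\<^sub>M \<mu>)"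
    by (intro borel_measurable_scaleR borel_measurable_attn_weight borel_measurable_matrix_vector_mult; measurable)+
  then have "(\<lambda>\<theta> :: ('d, 'k) param. (1 / (\<integral>y. attn_weight \<theta> x y \<partial>\<mu>)) *\<^sub>R
      (\<integral>y. attn_weight \<theta> x y *\<^sub>R (snd (snd \<theta>) *v y) \<partial>\<mu>)) \<in> borel_measurable borel"
    by (intro borel_measurable_scaleR borel_measurable_divide borel_measurable_const borel_measurable_lebesgue_integral)
      (auto simp: split_beta)
  then show ?thesis by (simp add: attention_eq[abs_def])
qed

text \<open>One factor \<open>exp (D\<^sup>2 * R\<^sup>2)\<close> bounds the weights, another the
  inverse of the partition integral. The term \<open>D ^ 3 * R\<^sup>2\<close> arises twice, from
  varying the weights in the numerator and in the denominator; \<open>D\<close> comes from varying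
  the value \<open>V y\<close>.\<close>

definition attn_lip :: "real \<Rightarrow> real \<Rightarrow> real" where
  "attn_lip D R = exp (2 * (D\<^sup>2 * R\<^sup>2)) * (2 * D ^ 3 * R\<^sup>2 + D)"

context
  fixes \<kappa> :: "'a measure" and \<theta> :: "('d::finite, 'k::finite) param" and D :: real
  assumes prob: "prob_space \<kappa>" and \<theta>: "norm \<theta> \<le> D"
begin

interpretation prob_space \<kappa> by (rule prob)

lemma norm_value_le: "norm (snd (snd \<theta>) *v y) \<le> D * norm y"
proof -
  have "norm (snd (snd \<theta>)) \<le> D"
    using norm_param_le(3)[of "fst \<theta>" "fst (snd \<theta>)" "snd (snd \<theta>)" D] \<theta> by simp
  then show ?thesis
    by (rule order_trans[OF norm_matrix_vector_mult_le mult_right_mono]) auto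
qed

lemma param_bound_nonneg: "0 \<le> D"
  using \<theta> norm_ge_zero order_trans by blast

lemma attn_weight_estimates':
  assumes "norm x \<le> R" "norm x' \<le> R" "norm y \<le> R" "norm y' \<le> R"
  shows "attn_weight \<theta> x y \<le> exp (D\<^sup>2 * R\<^sup>2)"
    and "exp (- (D\<^sup>2 * R\<^sup>2)) \<le> attn_weight \<theta> x y"
    and "\<bar>attn_weight \<theta> x y - attn_weight \<theta> x' y'\<bar>
      \<le> exp (D\<^sup>2 * R\<^sup>2) * (D\<^sup>2 * R) * (norm (x - x') + norm (y - y'))"
  using attn_weight_estimates[of "fst \<theta>" "fst (snd \<theta>)" "snd (snd \<theta>)" D x R x' y y'] \<theta> assms
  by auto

lemma attn_weight_pos: "0 < attn_weight \<theta> x y"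
  by (simp add: attn_weight_def split_beta)

lemma attn_integrable:
  assumes [measurable]: "Y \<in> borel_measurable \<kappa>" and Y: "\<And>a. a \<in> space \<kappa> \<Longrightarrow> norm (Y a) \<le> R"
  shows "integrable \<kappa> (\<lambda>a. attn_weight \<theta> x (Y a))"
    and "integrable \<kappa> (\<lambda>a. attn_weight \<theta> x (Y a) *\<^sub>R (snd (snd \<theta>) *v Y a))"
proof -
  \<comment> \<open>The point \<open>x\<close> is arbitrary and may lie outside the ball that
    contains the values of \<open>Y\<close>.\<close>
  define R' where "R' = max R (norm x)"
  have w: "attn_weight \<theta> x (Y a) \<le> exp (D\<^sup>2 * R'\<^sup>2)" if "a \<in> space \<kappa>" for a
    using Y[OF that] by (intro attn_weight_estimates'[where x' = x and y' = "Y a"]) (auto simp: R'_def)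
  have v: "norm (snd (snd \<theta>) *v Y a) \<le> D * R'" if "a \<in> space \<kappa>" for a
    using Y[OF that] param_bound_nonneg
    by (intro order_trans[OF norm_value_le] mult_left_mono) (auto simp: R'_def)
  show "integrable \<kappa> (\<lambda>a. attn_weight \<theta> x (Y a))"
    using w attn_weight_pos by (intro integrable_bounded[where B = "exp (D\<^sup>2 * R'\<^sup>2)"]) (auto simp: abs_of_pos)
  show "integrable \<kappa> (\<lambda>a. attn_weight \<theta> x (Y a) *\<^sub>R (snd (snd \<theta>) *v Y a))"
    using w v attn_weight_pos
    by (intro integrable_bounded[where B = "exp (D\<^sup>2 * R'\<^sup>2) * (D * R')"])
      (auto simp: abs_of_pos intro!: mult_mono)
qed

lemma attn_partition_pos:
  assumes "Y \<in> borel_measurable \<kappa>" and "\<And>a. a \<in> space \<kappa> \<Longrightarrow> norm (Y a) \<le> R"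
  shows "0 < (\<integral>a. attn_weight \<theta> x (Y a) \<partial>\<kappa>)"
  using integral_less_AE_space[of "\<lambda>_. 0" "\<lambda>a. attn_weight \<theta> x (Y a)"] attn_integrable(1)[OF assms]
  by (simp add: attn_weight_pos emeasure_space_1)

lemma norm_attention_numerator_le:
  assumes "Y \<in> borel_measurable \<kappa>" and Y: "\<And>a. a \<in> space \<kappa> \<Longrightarrow> norm (Y a) \<le> R"
  shows "norm (\<integral>a. attn_weight \<theta> x (Y a) *\<^sub>R (snd (snd \<theta>) *v Y a) \<partial>\<kappa>)
      \<le> D * R * (\<integral>a. attn_weight \<theta> x (Y a) \<partial>\<kappa>)"
proof -
  have "norm (\<integral>a. attn_weight \<theta> x (Y a) *\<^sub>R (snd (snd \<theta>) *v Y a) \<partial>\<kappa>)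
      \<le> (\<integral>a. attn_weight \<theta> x (Y a) * (D * R) \<partial>\<kappa>)"
  proof (rule norm_integral_le)
    fix a assume "a \<in> space \<kappa>"
    then have "norm (snd (snd \<theta>) *v Y a) \<le> D * R"
      using Y param_bound_nonneg by (intro order_trans[OF norm_value_le] mult_left_mono)
    then show "norm (attn_weight \<theta> x (Y a) *\<^sub>R (snd (snd \<theta>) *v Y a)) \<le> attn_weight \<theta> x (Y a) * (D * R)"
      using attn_weight_pos[of x "Y a"] by (simp add: abs_of_pos)
  qed (use attn_integrable[OF assms] in auto)
  then show ?thesis using attn_integrable[OF assms] by (simp add: mult.commute)
qed

text \<open>An average of vectors of norm at most \<open>D * R\<close>: the weights cancel against
  the partition integral, so no exponential appears and \<open>x\<close> does not matter. This is
  the source of the linear growth of the field.\<close>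

lemma norm_attention_le:
  assumes "Y \<in> borel_measurable \<kappa>" and "\<And>a. a \<in> space \<kappa> \<Longrightarrow> norm (Y a) \<le> R"
  shows "norm (attention x (distr \<kappa> borel Y) \<theta>) \<le> D * R"
  using norm_attention_numerator_le[OF assms, of x] attn_partition_pos[OF assms, of x]
  by (simp add: attention_distr[OF assms(1)] field_simps)

text \<open>The measures enter only through the mean displacement of \<open>Y\<close> and
  \<open>Y'\<close>, so any coupling may be inserted; first moments are all that the dynamics sees,
  although the final cost is quadratic.\<close>

lemma attention_lipschitz:
  assumes [measurable]: "Y \<in> borel_measurable \<kappa>" and Y: "\<And>a. a \<in> space \<kappa> \<Longrightarrow> norm (Y a) \<le> R"
    and [measurable]: "Y' \<in> borel_measurable \<kappa>" and Y': "\<And>a. a \<in> space \<kappa> \<Longrightarrow> norm (Y' a) \<le> R"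
    and x: "norm x \<le> R" and x': "norm x' \<le> R"
  shows "norm (attention x (distr \<kappa> borel Y) \<theta> - attention x' (distr \<kappa> borel Y') \<theta>)
    \<le> attn_lip D R * (norm (x - x') + (\<integral>a. norm (Y a - Y' a) \<partial>\<kappa>))"
proof -
  define V where "V = snd (snd \<theta>)"
  define E where "E = exp (D\<^sup>2 * R\<^sup>2)"
  define m where "m = (\<integral>a. attn_weight \<theta> x (Y a) \<partial>\<kappa>)"
  define m' where "m' = (\<integral>a. attn_weight \<theta> x' (Y' a) \<partial>\<kappa>)"
  define n where "n = (\<integral>a. attn_weight \<theta> x (Y a) *\<^sub>R (V *v Y a) \<partial>\<kappa>)"
  define n' where "n' = (\<integral>a. attn_weight \<theta> x' (Y' a) *\<^sub>R (V *v Y' a) \<partial>\<kappa>)"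
  define \<Delta> where "\<Delta> = norm (x - x') + (\<integral>a. norm (Y a - Y' a) \<partial>\<kappa>)"
  have D: "0 \<le> D" by (rule param_bound_nonneg)
  have R: "0 \<le> R" using x norm_ge_zero order_trans by blast
  have E: "1 \<le> E" by (simp add: E_def)
  note int = attn_integrable[OF assms(1) Y] attn_integrable[OF assms(3) Y']
  have intd: "integrable \<kappa> (\<lambda>a. norm (Y a - Y' a))"
    using Y Y' by (intro integrable_bounded[where B = "2 * R"])
      (auto intro!: order_trans[OF norm_triangle_ineq4] add_mono[of _ R _ R, simplified mult_2[symmetric]])
  have \<Delta>: "0 \<le> \<Delta>" by (simp add: \<Delta>_def)
  have m_ge: "1 / E \<le> m"
  proof -
    have "(\<integral>a. 1 / E \<partial>\<kappa>) \<le> m"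
      unfolding m_def
      using int Y x x' by (intro integral_mono)
        (auto simp: E_def exp_minus[symmetric] inverse_eq_divide[symmetric] intro: attn_weight_estimates'(2))
    then show ?thesis by (simp add: prob_space)
  qed
  have m: "0 < m" "0 < m'"
    using attn_partition_pos[OF assms(1) Y] attn_partition_pos[OF assms(3) Y'] by (auto simp: m_def m'_def)
  have lip: "\<bar>attn_weight \<theta> x (Y a) - attn_weight \<theta> x' (Y' a)\<bar>
      \<le> E * (D\<^sup>2 * R) * (norm (x - x') + norm (Y a - Y' a))" if "a \<in> space \<kappa>" for a
    unfolding E_def using Y[OF that] Y'[OF that] x x' by (intro attn_weight_estimates')
  have mm: "\<bar>m - m'\<bar> \<le> E * (D\<^sup>2 * R) * \<Delta>"
  proof -
    have "norm (\<integral>a. attn_weight \<theta> x (Y a) - attn_weight \<theta> x' (Y' a) \<partial>\<kappa>)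
        \<le> (\<integral>a. E * (D\<^sup>2 * R) * (norm (x - x') + norm (Y a - Y' a)) \<partial>\<kappa>)"
      using lip intd by (intro norm_integral_le) auto
    then show ?thesis
      using int intd by (simp add: m_def m'_def \<Delta>_def prob_space)
  qed
  have nn: "norm (n - n') \<le> (E * (D\<^sup>2 * R) * (D * R) + E * D) * \<Delta>"
  proof -
    have "norm (\<integral>a. attn_weight \<theta> x (Y a) *\<^sub>R (V *v Y a) - attn_weight \<theta> x' (Y' a) *\<^sub>R (V *v Y' a) \<partial>\<kappa>)
        \<le> (\<integral>a. E * (D\<^sup>2 * R) * (norm (x - x') + norm (Y a - Y' a)) * (D * R) + E * D * norm (Y a - Y' a) \<partial>\<kappa>)"
    proof (rule norm_integral_le)
      fix a assume a: "a \<in> space \<kappa>"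
      have "attn_weight \<theta> x (Y a) *\<^sub>R (V *v Y a) - attn_weight \<theta> x' (Y' a) *\<^sub>R (V *v Y' a)
        = (attn_weight \<theta> x (Y a) - attn_weight \<theta> x' (Y' a)) *\<^sub>R (V *v Y a) + attn_weight \<theta> x' (Y' a) *\<^sub>R (V *v (Y a - Y' a))"
        by (simp add: matrix_vector_mult_diff_distrib algebra_simps)
      also have "norm \<dots> \<le> \<bar>attn_weight \<theta> x (Y a) - attn_weight \<theta> x' (Y' a)\<bar> * norm (V *v Y a)
          + attn_weight \<theta> x' (Y' a) * norm (V *v (Y a - Y' a))"
        using attn_weight_pos by (intro order_trans[OF norm_triangle_ineq]) (simp add: abs_of_pos)
      also have "\<dots> \<le> E * (D\<^sup>2 * R) * (norm (x - x') + norm (Y a - Y' a)) * (D * R)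
          + E * (D * norm (Y a - Y' a))"
      proof (intro add_mono mult_mono lip a)
        show "norm (V *v Y a) \<le> D * R"
          unfolding V_def using Y[OF a] D by (intro order_trans[OF norm_value_le] mult_left_mono)
        show "attn_weight \<theta> x' (Y' a) \<le> E"
          unfolding E_def using Y'[OF a] Y[OF a] x x' by (intro attn_weight_estimates')
      qed (use D R E norm_value_le in \<open>auto simp: V_def\<close>)
      finally show "norm (attn_weight \<theta> x (Y a) *\<^sub>R (V *v Y a) - attn_weight \<theta> x' (Y' a) *\<^sub>R (V *v Y' a))
        \<le> E * (D\<^sup>2 * R) * (norm (x - x') + norm (Y a - Y' a)) * (D * R) + E * D * norm (Y a - Y' a)"
        by (simp add: mult.assoc)
    qed (use intd in \<open>auto simp: V_def\<close>)
    also have "\<dots> = E * (D\<^sup>2 * R) * \<Delta> * (D * R) + E * D * (\<integral>a. norm (Y a - Y' a) \<partial>\<kappa>)"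
      using intd by (simp add: \<Delta>_def prob_space)
    also have "\<dots> \<le> E * (D\<^sup>2 * R) * \<Delta> * (D * R) + E * D * \<Delta>"
      using E D by (intro add_left_mono mult_left_mono) (auto simp: \<Delta>_def)
    finally show ?thesis
      using int by (simp add: n_def n'_def V_def algebra_simps)
  qed
  have n': "norm n' \<le> D * R * m'"
    unfolding n'_def m'_def V_def by (rule norm_attention_numerator_le[OF assms(3) Y'])
  have "attention x (distr \<kappa> borel Y) \<theta> - attention x' (distr \<kappa> borel Y') \<theta> = (1 / m) *\<^sub>R n - (1 / m') *\<^sub>R n'"
    by (simp add: attention_distr n_def m_def n'_def m'_def V_def)
  \<comment> \<open>In this form of the quotient difference \<open>n'\<close> is divided by
    \<open>m'\<close>, and \<open>norm n' \<le> D * R * m'\<close> cancels that division. The lower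
    bound on the partition integral is thus used only once.\<close>
  also have "\<dots> = (1 / m) *\<^sub>R ((n - n') + ((m' - m) / m') *\<^sub>R n')"
    using m by (simp add: algebra_simps diff_divide_distrib)
  also have "norm \<dots> \<le> (1 / m) * (norm (n - n') + (\<bar>m' - m\<bar> / m') * norm n')"
  proof -
    have "norm ((n - n') + ((m' - m) / m') *\<^sub>R n') \<le> norm (n - n') + (\<bar>m' - m\<bar> / m') * norm n'"
      using norm_triangle_ineq[of "n - n'" "((m' - m) / m') *\<^sub>R n'"] m by (simp add: abs_of_pos)
    then show ?thesis using m by (simp add: divide_right_mono)
  qed
  also have "\<dots> \<le> (1 / m) * (norm (n - n') + (\<bar>m' - m\<bar> / m') * (D * R * m'))"
    using m n' by (intro mult_left_mono add_left_mono) auto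
  also have "\<dots> = (1 / m) * (norm (n - n') + D * R * \<bar>m - m'\<bar>)"
    using m by (simp add: abs_minus_commute)
  also have "\<dots> \<le> E * ((E * (D\<^sup>2 * R) * (D * R) + E * D) * \<Delta> + D * R * (E * (D\<^sup>2 * R) * \<Delta>))"
    using m m_ge nn mm D R E \<Delta> by (intro mult_mono add_mono mult_left_mono) (auto simp: field_simps)
  also have "\<dots> = (E * E) * (2 * D ^ 3 * R\<^sup>2 + D) * \<Delta>"
    by (simp add: power2_eq_square power3_eq_cube algebra_simps)
  also have "E * E = exp (2 * (D\<^sup>2 * R\<^sup>2))"
    by (simp add: E_def exp_add[symmetric])
  finally show ?thesis by (simp add: \<Delta>_def attn_lip_def)
qed

end

locale attention_params = prob_space \<rho> for \<rho> :: "('d::finite, 'k::finite) param measure" +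
  fixes \<Theta> :: "('d, 'k) param set" and D :: real
  assumes sets_eq: "sets \<rho> = sets (restrict_space borel \<Theta>)"
    and norm_le: "\<And>\<theta>. \<theta> \<in> \<Theta> \<Longrightarrow> norm \<theta> \<le> D"
begin

lemma space_eq: "space \<rho> = \<Theta>"
  using sets_eq_imp_space_eq[OF sets_eq] by (simp add: space_restrict_space)

lemma D_nonneg: "0 \<le> D"
  using not_empty norm_le norm_ge_zero order_trans unfolding space_eq by blast

context
  fixes \<kappa> :: "'a measure"
  assumes prob: "prob_space \<kappa>"
begin

lemma integrable_attention:
  assumes [measurable]: "Y \<in> borel_measurable \<kappa>" and "\<And>a. a \<in> space \<kappa> \<Longrightarrow> norm (Y a) \<le> R"
  shows "integrable \<rho> (attention x (distr \<kappa> borel Y))"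
proof (rule integrable_bounded)
  have "attention x (distr \<kappa> borel Y) \<in> borel_measurable borel"
    using prob by (intro borel_measurable_attention prob_space.prob_space_distr) auto
  then have "attention x (distr \<kappa> borel Y) \<in> borel_measurable (restrict_space borel \<Theta>)"
    by (rule measurable_restrict_space1)
  then show "attention x (distr \<kappa> borel Y) \<in> borel_measurable \<rho>"
    by (simp add: measurable_cong_sets[OF sets_eq refl])
  show "norm (attention x (distr \<kappa> borel Y) \<theta>) \<le> D * R" if "\<theta> \<in> space \<rho>" for \<theta>
    using that norm_le assms by (intro norm_attention_le[OF prob]) (auto simp: space_eq)
qed

lemma norm_attention_field_le:
  assumes "Y \<in> borel_measurable \<kappa>" and "\<And>a. a \<in> space \<kappa> \<Longrightarrow> norm (Y a) \<le> R"
  shows "norm (attention_field \<rho> (distr \<kappa> borel Y) x) \<le> D * R"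
proof -
  have "norm (attention_field \<rho> (distr \<kappa> borel Y) x) \<le> (\<integral>\<theta>. D * R \<partial>\<rho>)"
    unfolding attention_field_def
    using integrable_attention[OF assms, of x] norm_le assms
    by (intro norm_integral_le norm_attention_le[OF prob]) (auto simp: space_eq)
  then show ?thesis by (simp add: prob_space)
qed

lemma attention_field_lipschitz:
  assumes "Y \<in> borel_measurable \<kappa>" and "\<And>a. a \<in> space \<kappa> \<Longrightarrow> norm (Y a) \<le> R"
    and "Y' \<in> borel_measurable \<kappa>" and "\<And>a. a \<in> space \<kappa> \<Longrightarrow> norm (Y' a) \<le> R"
    and "norm x \<le> R" and "norm x' \<le> R"
  shows "norm (attention_field \<rho> (distr \<kappa> borel Y) x - attention_field \<rho> (distr \<kappa> borel Y') x')
    \<le> attn_lip D R * (norm (x - x') + (\<integral>a. norm (Y a - Y' a) \<partial>\<kappa>))"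
proof -
  have int: "integrable \<rho> (attention x (distr \<kappa> borel Y))" "integrable \<rho> (attention x' (distr \<kappa> borel Y'))"
    using assms by (auto intro!: integrable_attention)
  have "norm (\<integral>\<theta>. attention x (distr \<kappa> borel Y) \<theta> - attention x' (distr \<kappa> borel Y') \<theta> \<partial>\<rho>)
    \<le> (\<integral>\<theta>. attn_lip D R * (norm (x - x') + (\<integral>a. norm (Y a - Y' a) \<partial>\<kappa>)) \<partial>\<rho>)"
    using int norm_le assms
    by (intro norm_integral_le attention_lipschitz[OF prob]) (auto simp: space_eq)
  then show ?thesis
    using int by (simp add: attention_field_def prob_space)
qed

end

lemma attention_field_defined_distr:
  assumes "prob_space \<kappa>" and [measurable]: "Y \<in> borel_measurable \<kappa>" and "\<And>a. a \<in> space \<kappa> \<Longrightarrow> norm (Y a) \<le> R"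
  shows "attention_field_defined \<rho> (distr \<kappa> borel Y)"
  unfolding attention_field_defined_def
proof (intro allI conjI ballI)
  fix x show "integrable \<rho> (attention x (distr \<kappa> borel Y))"
    using assms by (rule integrable_attention)
  fix \<theta> assume "\<theta> \<in> space \<rho>"
  then show "case \<theta> of (Q, K, V) \<Rightarrow> integrable (distr \<kappa> borel Y) (attn_weight (Q, K, V) x) \<and>
      integrable (distr \<kappa> borel Y) (\<lambda>y. attn_weight (Q, K, V) x y *\<^sub>R (V *v y))"
    using attn_integrable[OF assms(1) norm_le assms(2,3), of \<theta>]
    by (auto simp: space_eq integrable_distr_eq split: prod.splits)
qed

end

section \<open>Mean-field ordinary differential equations\<close>

lemma exp_has_integral:
  fixes c :: real
  assumes "0 \<le> t"
  shows "((\<lambda>s. c * exp (c * s)) has_integral exp (c * t) - 1) {0..t}"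
proof -
  have "((\<lambda>s. c * exp (c * s)) has_integral exp (c * t) - exp (c * 0)) {0..t}"
    using assms by (intro fundamental_theorem_of_calculus)
      (auto intro!: derivative_eq_intros simp: has_real_derivative_iff_has_vector_derivative[symmetric])
  then show ?thesis by simp
qed

text \<open>The factor \<open>c\<close> in the integrand is matched to its exponent, so integration
  reproduces the same exponential. This lets exponential bounds pass through the Picard operator
  with unchanged constants.\<close>

lemma norm_integral_exp_le:
  fixes f :: "real \<Rightarrow> 'a::banach"
  assumes "0 \<le> t" "f integrable_on {0..t}" "\<And>s. s \<in> {0..t} \<Longrightarrow> norm (f s) \<le> B * (c * exp (c * s))"
  shows "norm (integral {0..t} f) \<le> B * (exp (c * t) - 1)"
proof -
  have "((\<lambda>s. B * (c * exp (c * s))) has_integral B * (exp (c * t) - 1)) {0..t}"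
    using exp_has_integral[OF assms(1)] by (rule has_integral_mult_right)
  then show ?thesis
    using assms integral_norm_bound_integral[of f "{0..t}" "\<lambda>s. B * (c * exp (c * s))"]
    by (metis has_integral_integrable integral_unique)
qed

lemma continuous_on_two_lipschitz:
  fixes f :: "'a::metric_space \<times> 'b::metric_space \<Rightarrow> 'c::metric_space"
  assumes "0 \<le> a" "0 \<le> b"
    and le: "\<And>z z'. z \<in> S \<Longrightarrow> z' \<in> S \<Longrightarrow> dist (f z) (f z') \<le> a * dist (fst z) (fst z') + b * dist (snd z) (snd z')"
  shows "continuous_on S f"
proof (rule lipschitz_on_continuous_on)
  show "(a + b)-lipschitz_on S f"
  proof (rule lipschitz_onI)
    fix z z' assume "z \<in> S" "z' \<in> S"
    then have "dist (f z) (f z') \<le> a * dist (fst z) (fst z') + b * dist (snd z) (snd z')" by (rule le)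
    also have "\<dots> \<le> a * dist z z' + b * dist z z'"
      using assms(1,2) by (intro add_mono mult_left_mono dist_fst_le dist_snd_le)
    finally show "dist (f z) (f z') \<le> (a + b) * dist z z'" by (simp add: algebra_simps)
  qed (use assms in auto)
qed

text \<open>The scalars are the time weights \<open>exp (picard_rate * t)\<close> at two possibly
  different times; the second form therefore covers both Lipschitz conditions of
  \<open>invariant_flow\<close>.\<close>

lemma closed_bcontfun_norm_le:
  fixes u v :: real
  shows "closed {U :: 'a::topological_space \<Rightarrow>\<^sub>C 'b::real_normed_vector. norm (u *\<^sub>R apply_bcontfun U z) \<le> c}"
    and "closed {U :: 'a \<Rightarrow>\<^sub>C 'b. norm (u *\<^sub>R apply_bcontfun U z - v *\<^sub>R apply_bcontfun U w) \<le> c}"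
proof -
  have [continuous_intros]: "continuous_on UNIV (\<lambda>U :: 'a \<Rightarrow>\<^sub>C 'b. apply_bcontfun U z)" for z
    by (rule lipschitz_on_continuous_on[of 1]) (auto intro!: lipschitz_onI dist_bounded)
  show "closed {U :: 'a \<Rightarrow>\<^sub>C 'b. norm (u *\<^sub>R apply_bcontfun U z) \<le> c}"
    by (intro closed_Collect_le continuous_intros)
  show "closed {U :: 'a \<Rightarrow>\<^sub>C 'b. norm (u *\<^sub>R apply_bcontfun U z - v *\<^sub>R apply_bcontfun U w) \<le> c}"
    by (intro closed_Collect_le continuous_intros)
qed

section \<open>Picard iteration for an equation whose field \<open>b Y\<close> depends on the whole
  map \<open>Y\<close>\<close>

context
  fixes b :: "('a \<Rightarrow> 'a) \<Rightarrow> 'a \<Rightarrow> 'a::euclidean_space" and \<mu>0 :: "'a measure" and T A L r R :: real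
  assumes prob: "prob_space \<mu>0" and sets: "sets \<mu>0 = sets borel"
    and nonneg: "0 < T" "0 \<le> A" "0 \<le> L" "0 \<le> r"
    and R: "R = (1 + r) * exp (A * T)"
    and growth: "\<And>Y x s. Y \<in> borel_measurable borel \<Longrightarrow> 1 \<le> s \<Longrightarrow> (\<And>y. norm (Y y) \<le> s) \<Longrightarrow> norm x \<le> s \<Longrightarrow>
      norm (b Y x) \<le> A * s"
    and lip: "\<And>Y Y' x x'. Y \<in> borel_measurable borel \<Longrightarrow> Y' \<in> borel_measurable borel \<Longrightarrow>
      (\<And>y. norm (Y y) \<le> R) \<Longrightarrow> (\<And>y. norm (Y' y) \<le> R) \<Longrightarrow> norm x \<le> R \<Longrightarrow> norm x' \<le> R \<Longrightarrow>
      norm (b Y x - b Y' x') \<le> L * (norm (x - x') + (\<integral>y. norm (Y y - Y' y) \<partial>\<mu>0))"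
begin

interpretation prob_space \<mu>0 by (rule prob)

text \<open>Projection onto the ball that carries \<open>\<mu>0\<close>. It is the identity there
  and nonexpansive everywhere, and it makes the flow bounded over all starting points, as the space
  of bounded continuous functions demands.\<close>

definition start :: "'a \<Rightarrow> 'a" where
  "start = closest_point (cball 0 r)"

text \<open>Each of the three bounds is closed under uniform convergence and reproduced by
  \<open>picard\<close> with the same constants. The first keeps the flow in the ball where
  \<open>lip\<close> applies, the second gives continuity in time of the field, the third gives
  measurability of \<open>X t\<close>.\<close>

definition invariant_flow :: "(real \<Rightarrow> 'a \<Rightarrow> 'a) \<Rightarrow> bool" where
  "invariant_flow X \<longleftrightarrow>
     (\<forall>t\<in>{0..T}. \<forall>y. norm (X t y) \<le> (1 + r) * exp (A * t)) \<and>
     (\<forall>t\<in>{0..T}. \<forall>s\<in>{0..T}. \<forall>y. norm (X t y - X s y) \<le> A * R * \<bar>t - s\<bar>) \<and>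
     (\<forall>t\<in>{0..T}. \<forall>y y'. norm (X t y - X t y') \<le> exp (L * t) * norm (y - y'))"

definition picard :: "(real \<Rightarrow> 'a \<Rightarrow> 'a) \<Rightarrow> real \<Rightarrow> 'a \<Rightarrow> 'a" where
  "picard X t y = start y + integral {0..t} (\<lambda>s. b (X s) (X s y))"

lemma invariant_flowD:
  assumes "invariant_flow X" "t \<in> {0..T}"
  shows "norm (X t y) \<le> (1 + r) * exp (A * t)" "norm (X t y) \<le> R"
    and "s \<in> {0..T} \<Longrightarrow> norm (X t y - X s y) \<le> A * R * \<bar>t - s\<bar>"
    and "norm (X t y - X t y') \<le> exp (L * t) * norm (y - y')"
    and "X t \<in> borel_measurable borel"
proof -
  show 1: "norm (X t y) \<le> (1 + r) * exp (A * t)"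
    and "s \<in> {0..T} \<Longrightarrow> norm (X t y - X s y) \<le> A * R * \<bar>t - s\<bar>"
    and lip: "norm (X t y - X t y') \<le> exp (L * t) * norm (y - y')" for y y'
    using assms by (auto simp: invariant_flow_def)
  have "(1 + r) * exp (A * t) \<le> R"
    using assms nonneg by (auto simp: R intro!: mult_left_mono)
  then show "norm (X t y) \<le> R" using 1[of y] by simp
  have "continuous_on UNIV (X t)"
    using lip by (intro lipschitz_on_continuous_on[of "exp (L * t)"] lipschitz_onI) (auto simp: dist_norm)
  then show "X t \<in> borel_measurable borel" by (rule borel_measurable_continuous_onI)
qed

lemma R_pos: "0 < R"
  using nonneg by (simp add: R)

lemma expectation_le:
  fixes f :: "'a \<Rightarrow> real"
  assumes "f \<in> borel_measurable borel" "\<And>y. \<bar>f y\<bar> \<le> c"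
  shows "integral\<^sup>L \<mu>0 f \<le> c"
proof -
  have "f \<in> borel_measurable \<mu>0"
    using assms(1) by (simp add: measurable_cong_sets[OF sets refl])
  then have "integrable \<mu>0 f"
    using assms(2) by (intro integrable_bounded[where B = c]) auto
  then have "integral\<^sup>L \<mu>0 f \<le> (\<integral>x. c \<partial>\<mu>0)"
    using assms(2) by (intro integral_mono) (auto simp: abs_le_iff)
  then show ?thesis by (simp add: prob_space)
qed

text \<open>When only \<open>y\<close> varies, the generating map is the same on both sides and the
  measure term vanishes. When time varies, the displacement of the point and its mean both
  contribute \<open>A * R * \<bar>t - s\<bar>\<close>, hence the factor 2.\<close>

lemma field_along_flow:
  assumes X: "invariant_flow X" and t: "t \<in> {0..T}"
  shows "norm (b (X t) (X t y)) \<le> A * ((1 + r) * exp (A * t))"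
    and "norm (b (X t) (X t y)) \<le> A * R"
    and "norm (b (X t) (X t y) - b (X t) (X t y')) \<le> L * (exp (L * t) * norm (y - y'))"
    and "s \<in> {0..T} \<Longrightarrow> norm (b (X t) (X t y) - b (X s) (X s y)) \<le> L * (2 * (A * R)) * \<bar>t - s\<bar>"
proof -
  note D = invariant_flowD[OF X]
  have "1 * 1 \<le> (1 + r) * exp (A * t)" using nonneg t by (intro mult_mono) auto
  then show 1: "norm (b (X t) (X t y)) \<le> A * ((1 + r) * exp (A * t))"
    using D(1,5)[OF t] by (intro growth) auto
  also have "\<dots> \<le> A * R" using t nonneg by (auto simp: R intro!: mult_left_mono)
  finally show "norm (b (X t) (X t y)) \<le> A * R" .
  have "norm (b (X t) (X t y) - b (X t) (X t y')) \<le> L * (norm (X t y - X t y') + (\<integral>z. norm (X t z - X t z) \<partial>\<mu>0))"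
    using D[OF t] by (intro lip) auto
  also have "\<dots> \<le> L * (exp (L * t) * norm (y - y'))"
    using D(4)[OF t] nonneg by (auto intro!: mult_left_mono)
  finally show "norm (b (X t) (X t y) - b (X t) (X t y')) \<le> L * (exp (L * t) * norm (y - y'))" .
  assume s: "s \<in> {0..T}"
  have "norm (b (X t) (X t y) - b (X s) (X s y)) \<le> L * (norm (X t y - X s y) + (\<integral>z. norm (X t z - X s z) \<partial>\<mu>0))"
    using D[OF t] D[OF s] by (intro lip) auto
  also have "\<dots> \<le> L * (A * R * \<bar>t - s\<bar> + A * R * \<bar>t - s\<bar>)"
    using D(5)[OF t] D(5)[OF s] D(3)[OF t s] nonneg
    by (intro mult_left_mono add_mono expectation_le) auto
  finally show "norm (b (X t) (X t y) - b (X s) (X s y)) \<le> L * (2 * (A * R)) * \<bar>t - s\<bar>"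
    by (simp add: algebra_simps)
qed

lemma continuous_on_field_along_flow:
  assumes X: "invariant_flow X"
  shows "continuous_on ({0..T} \<times> UNIV) (\<lambda>(t, y). b (X t) (X t y))"
proof (rule continuous_on_two_lipschitz[where a = "L * (2 * (A * R))" and b = "L * exp (L * T)"])
  fix z z' :: "real \<times> 'a" assume z: "z \<in> {0..T} \<times> UNIV" "z' \<in> {0..T} \<times> UNIV"
  obtain t y t' y' where [simp]: "z = (t, y)" "z' = (t', y')" by force
  have "norm (b (X t) (X t y) - b (X t') (X t' y')) \<le> norm (b (X t) (X t y) - b (X t') (X t' y))
      + norm (b (X t') (X t' y) - b (X t') (X t' y'))"
    by (rule norm_diff_triangle_ineq[of _ "b (X t') (X t' y)" "b (X t') (X t' y)", simplified,
          THEN order_trans[rotated]]) (simp add: algebra_simps)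
  also have "\<dots> \<le> L * (2 * (A * R)) * \<bar>t - t'\<bar> + L * (exp (L * t') * norm (y - y'))"
    using z by (intro add_mono field_along_flow[OF X]) auto
  also have "\<dots> \<le> L * (2 * (A * R)) * \<bar>t - t'\<bar> + L * (exp (L * T) * norm (y - y'))"
    using z nonneg by (intro add_left_mono mult_left_mono mult_right_mono) (auto intro!: mult_left_mono)
  finally show "dist (case z of (t, y) \<Rightarrow> b (X t) (X t y)) (case z' of (t, y) \<Rightarrow> b (X t) (X t y))
      \<le> L * (2 * (A * R)) * dist (fst z) (fst z') + L * exp (L * T) * dist (snd z) (snd z')"
    by (simp add: dist_norm mult.assoc)
qed (use nonneg R_pos in auto)

lemma continuous_on_field_time:
  assumes X: "invariant_flow X"
  shows "continuous_on {0..T} (\<lambda>t. b (X t) (X t y))"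
proof -
  have "continuous_on {0..T} (\<lambda>t. (t, y))" by (intro continuous_intros)
  from continuous_on_compose2[OF continuous_on_field_along_flow[OF X] this] show ?thesis
    by (simp add: image_subset_iff)
qed

lemma field_time_integrable:
  assumes "invariant_flow X" "{s..t} \<subseteq> {0..T}"
  shows "(\<lambda>t. b (X t) (X t y)) integrable_on {s..t}"
  by (intro integrable_continuous_real continuous_on_subset[OF continuous_on_field_time[OF assms(1)] assms(2)])

lemma norm_start_le: "norm (start y) \<le> r"
  using closest_point_in_set[of "cball 0 r" y] nonneg by (simp add: start_def)

lemma start_lipschitz: "norm (start y - start y') \<le> norm (y - y')"
  using closest_point_lipschitz[of "cball 0 r" y y'] nonneg by (simp add: start_def dist_norm)

text \<open>The constants are fixed points of the estimates:
  \<open>r + (1 + r) * (exp (A * t) - 1)\<close> is at most \<open>(1 + r) * exp (A * t)\<close>,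
  and \<open>1 + (exp (L * t) - 1)\<close> is \<open>exp (L * t)\<close>.\<close>

lemma picard_invariant:
  assumes X: "invariant_flow X"
  shows "invariant_flow (picard X)"
  unfolding invariant_flow_def
proof (intro conjI ballI allI)
  note D = invariant_flowD[OF X] and h = field_along_flow[OF X]
  fix t y assume t: "t \<in> {0..T}"
  have int: "(\<lambda>t. b (X t) (X t y)) integrable_on {0..t}" for y
    using t by (intro field_time_integrable X) auto
  have "norm (picard X t y) \<le> norm (start y) + norm (integral {0..t} (\<lambda>s. b (X s) (X s y)))"
    unfolding picard_def by (rule norm_triangle_ineq)
  also have "\<dots> \<le> r + (1 + r) * (exp (A * t) - 1)"
    using t h(1) by (intro add_mono norm_start_le norm_integral_exp_le int) (auto simp: algebra_simps)
  also have "\<dots> \<le> (1 + r) * exp (A * t)" by (simp add: algebra_simps)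
  finally show "norm (picard X t y) \<le> (1 + r) * exp (A * t)" .
  fix y'
  have "picard X t y - picard X t y' = (start y - start y') + integral {0..t} (\<lambda>s. b (X s) (X s y) - b (X s) (X s y'))"
    using int by (simp add: picard_def Henstock_Kurzweil_Integration.integral_diff)
  also have "norm \<dots> \<le> norm (y - y') + norm (y - y') * (exp (L * t) - 1)"
    using t h(3) start_lipschitz int
    by (intro norm_triangle_le add_mono norm_integral_exp_le Henstock_Kurzweil_Integration.integrable_diff) (auto simp: algebra_simps)
  finally show "norm (picard X t y - picard X t y') \<le> exp (L * t) * norm (y - y')"
    by (simp add: algebra_simps)
next
  note h = field_along_flow[OF X]
  fix t s y assume t: "t \<in> {0..T}" and s: "s \<in> {0..T}"
  have le: "norm (picard X v y - picard X u y) \<le> A * R * (v - u)" if "u \<le> v" "u \<in> {0..T}" "v \<in> {0..T}" for u v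
  proof -
    have "integral {0..u} (\<lambda>s. b (X s) (X s y)) + integral {u..v} (\<lambda>s. b (X s) (X s y))
        = integral {0..v} (\<lambda>s. b (X s) (X s y))"
      using that by (intro Henstock_Kurzweil_Integration.integral_combine field_time_integrable X) auto
    then have "picard X v y - picard X u y = integral {u..v} (\<lambda>s. b (X s) (X s y))"
      by (simp add: picard_def algebra_simps)
    also have "norm \<dots> \<le> A * R * (v - u)"
      using that h(2) by (intro integral_bound continuous_on_subset[OF continuous_on_field_time[OF X]]) auto
    finally show ?thesis .
  qed
  show "norm (picard X t y - picard X s y) \<le> A * R * \<bar>t - s\<bar>"
    using le[of s t] le[of t s] s t by (cases "s \<le> t") (auto simp: norm_minus_commute)
qed

text \<open>The displacement and its mean over \<open>\<mu>0\<close> each contribute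
  \<open>L * d * exp (c * s)\<close>; integrating the exponential gains \<open>1 / c\<close>. A
  large \<open>c\<close> therefore gives a contraction on all of \<open>{0..T}\<close>, without
  splitting the interval.\<close>

lemma picard_diff:
  assumes X: "invariant_flow X" and X': "invariant_flow X'" and t: "t \<in> {0..T}"
    and d: "\<And>s y. s \<in> {0..T} \<Longrightarrow> norm (X s y - X' s y) \<le> d * exp (c * s)" and "0 < c"
  shows "norm (picard X t y - picard X' t y) \<le> (2 * L / c) * d * exp (c * t)"
proof -
  have int: "(\<lambda>t. b (X t) (X t y)) integrable_on {0..t}" "(\<lambda>t. b (X' t) (X' t y)) integrable_on {0..t}"
    using t by (auto intro!: field_time_integrable X X')
  have d0: "0 \<le> d" using order_trans[OF norm_ge_zero d[of 0 0]] t by simp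
  have "picard X t y - picard X' t y = integral {0..t} (\<lambda>s. b (X s) (X s y) - b (X' s) (X' s y))"
    using int by (simp add: picard_def Henstock_Kurzweil_Integration.integral_diff)
  also have "norm \<dots> \<le> (2 * L / c * d) * (exp (c * t) - 1)"
  proof (rule norm_integral_exp_le)
    fix s assume "s \<in> {0..t}"
    then have s: "s \<in> {0..T}" using t by auto
    note D = invariant_flowD[OF X s] invariant_flowD[OF X' s]
    have "norm (b (X s) (X s y) - b (X' s) (X' s y)) \<le> L * (norm (X s y - X' s y) + (\<integral>z. norm (X s z - X' s z) \<partial>\<mu>0))"
      using D by (intro lip) auto
    also have "\<dots> \<le> L * (d * exp (c * s) + d * exp (c * s))"
      using nonneg D(5,10) by (intro mult_left_mono add_mono expectation_le d s) (auto simp: d[OF s])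
    finally show "norm (b (X s) (X s y) - b (X' s) (X' s y)) \<le> (2 * L / c * d) * (c * exp (c * s))"
      using \<open>0 < c\<close> by (simp add: algebra_simps)
  qed (use t int in \<open>auto intro: Henstock_Kurzweil_Integration.integrable_diff\<close>)
  also have "\<dots> \<le> (2 * L / c * d) * exp (c * t)"
    using nonneg d0 \<open>0 < c\<close> by (intro mult_left_mono) auto
  finally show ?thesis by simp
qed

text \<open>Chosen so that \<open>2 * L / picard_rate \<le> 1 / 2\<close>; the summand 1 keeps it
  positive when \<open>L = 0\<close>.\<close>

definition picard_rate :: real where "picard_rate = 4 * L + 1"

text \<open>Flows are stored after multiplication by \<open>exp (- picard_rate * t)\<close>, so that
  the ordinary supremum distance becomes the exponentially weighted (Bielecki) distance in which
  \<open>picard\<close> contracts.\<close>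

definition unweight :: "((real \<times> 'a) \<Rightarrow>\<^sub>C 'a) \<Rightarrow> real \<Rightarrow> 'a \<Rightarrow> 'a" where
  "unweight U t y = exp (picard_rate * t) *\<^sub>R apply_bcontfun U (t, y)"

text \<open>Bounded continuous functions are total in time; a flow on \<open>{0..T}\<close> is
  extended by freezing it at the end points.\<close>

definition clamp_time :: "real \<Rightarrow> real" where
  "clamp_time t = max 0 (min T t)"

lemma clamp_time: "clamp_time t \<in> {0..T}" "t \<in> {0..T} \<Longrightarrow> clamp_time t = t"
    "\<bar>clamp_time t - clamp_time s\<bar> \<le> \<bar>t - s\<bar>"
  using nonneg by (auto simp: clamp_time_def)

lemma clamped_bcontfun:
  assumes X: "invariant_flow X"
  shows "(\<lambda>(t, y). exp (- picard_rate * clamp_time t) *\<^sub>R X (clamp_time t) y) \<in> bcontfun"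
proof (rule bcontfun_normI)
  have "continuous_on UNIV (\<lambda>z. X (clamp_time (fst z)) (snd z))"
  proof (rule continuous_on_two_lipschitz[where a = "A * R" and b = "exp (L * T)"])
    fix z z' :: "real \<times> 'a"
    obtain t y t' y' where [simp]: "z = (t, y)" "z' = (t', y')" by force
    have "norm (X (clamp_time t) y - X (clamp_time t') y') \<le> norm (X (clamp_time t) y - X (clamp_time t') y)
        + norm (X (clamp_time t') y - X (clamp_time t') y')"
      using norm_triangle_ineq[of "X (clamp_time t) y - X (clamp_time t') y" "X (clamp_time t') y - X (clamp_time t') y'"]
      by simp
    also have "\<dots> \<le> A * R * \<bar>clamp_time t - clamp_time t'\<bar> + exp (L * clamp_time t') * norm (y - y')"
      by (intro add_mono invariant_flowD[OF X] clamp_time)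
    also have "\<dots> \<le> A * R * \<bar>t - t'\<bar> + exp (L * T) * norm (y - y')"
      using nonneg R_pos clamp_time(1)[of t'] clamp_time(3)[of t t']
      by (intro add_mono mult_left_mono mult_right_mono) (auto intro!: mult_left_mono)
    finally show "dist (X (clamp_time (fst z)) (snd z)) (X (clamp_time (fst z')) (snd z'))
        \<le> A * R * dist (fst z) (fst z') + exp (L * T) * dist (snd z) (snd z')"
      by (simp add: dist_norm)
  qed (use nonneg R_pos in auto)
  then show "continuous_on UNIV (\<lambda>(t, y). exp (- picard_rate * clamp_time t) *\<^sub>R X (clamp_time t) y)"
    unfolding split_beta clamp_time_def by (intro continuous_intros) auto
  fix z :: "real \<times> 'a"
  obtain t y where [simp]: "z = (t, y)" by force
  have "0 \<le> picard_rate * clamp_time t"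
    using clamp_time(1)[of t] nonneg by (simp add: picard_rate_def)
  then have "exp (- picard_rate * clamp_time t) * norm (X (clamp_time t) y) \<le> 1 * R"
    using R_pos by (intro mult_mono invariant_flowD[OF X] clamp_time) auto
  then show "norm (case z of (t, y) \<Rightarrow> exp (- picard_rate * clamp_time t) *\<^sub>R X (clamp_time t) y) \<le> R"
    by simp
qed

text \<open>Banach's theorem on the closed set \<open>S\<close> of representatives of invariant
  flows. Working inside \<open>S\<close> is necessary because the field is Lipschitz only in the
  ball of radius \<open>R\<close>.\<close>

lemma flow_fixed_point: "\<exists>X. invariant_flow X \<and> (\<forall>t\<in>{0..T}. \<forall>y. X t y = picard X t y)"
proof -
  define S where "S = {U. invariant_flow (unweight U)}"
  define weight where "weight X = Bcontfun (\<lambda>(t, y). exp (- picard_rate * clamp_time t) *\<^sub>R X (clamp_time t) y)"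
    for X :: "real \<Rightarrow> 'a \<Rightarrow> 'a"
  have weight: "unweight (weight X) t y = X t y" if "invariant_flow X" "t \<in> {0..T}" for X t y
    unfolding unweight_def weight_def Bcontfun_inverse[OF clamped_bcontfun[OF that(1)]]
    using that(2) by (simp add: clamp_time exp_minus)
  have weight_S: "weight X \<in> S" if "invariant_flow X" for X
    using that unfolding S_def mem_Collect_eq invariant_flow_def
    by (simp add: weight[OF that])
  have closed: "closed S"
  proof -
    have "S = (\<Inter>t\<in>{0..T}. \<Inter>y. {U. norm (unweight U t y) \<le> (1 + r) * exp (A * t)}) \<inter>
       (\<Inter>t\<in>{0..T}. \<Inter>s\<in>{0..T}. \<Inter>y. {U. norm (unweight U t y - unweight U s y) \<le> A * R * \<bar>t - s\<bar>}) \<inter>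
       (\<Inter>t\<in>{0..T}. \<Inter>y. \<Inter>y'. {U. norm (unweight U t y - unweight U t y') \<le> exp (L * t) * norm (y - y')})"
      by (auto simp: S_def invariant_flow_def)
    moreover have "closed \<dots>"
      unfolding unweight_def by (intro closed_Int closed_INT ballI closed_bcontfun_norm_le)
    ultimately show ?thesis by simp
  qed
  have "invariant_flow (\<lambda>_. start)"
    unfolding invariant_flow_def
  proof (intro conjI ballI allI)
    fix t y y' assume t: "t \<in> {0..T}"
    have 1: "1 \<le> exp (A * t)" "1 \<le> exp (L * t)" using t nonneg by auto
    have "r * 1 \<le> (1 + r) * exp (A * t)" using nonneg 1 by (intro mult_mono) auto
    then show "norm (start y) \<le> (1 + r) * exp (A * t)" using norm_start_le[of y] by simp
    show "norm (start y - start y') \<le> exp (L * t) * norm (y - y')"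
      using start_lipschitz[of y y'] mult_right_mono[OF 1(2), of "norm (y - y')"] by simp
  qed (use nonneg R_pos in auto)
  from weight_S[OF this] have "S \<noteq> {}" by auto
  have "\<exists>!U\<in>S. weight (picard (unweight U)) = U"
  \<comment> \<open>Members of \<open>S\<close> are unconstrained outside \<open>{0..T}\<close>, but
    \<open>weight\<close> overwrites them there by clamping, so the distance of two images over all
    times is already attained on \<open>{0..T}\<close>.\<close>
  proof (rule Banach_fix[OF complete_eq_closed[THEN iffD2, OF closed] \<open>S \<noteq> {}\<close>, of "1/2"])
    show "(\<lambda>U. weight (picard (unweight U))) ` S \<subseteq> S"
      by (auto simp: S_def intro!: weight_S[unfolded S_def mem_Collect_eq] picard_invariant)
    fix U U' assume "U \<in> S" "U' \<in> S"
    then have inv: "invariant_flow (unweight U)" "invariant_flow (unweight U')" by (auto simp: S_def)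
    note pinv = picard_invariant[OF inv(1)] picard_invariant[OF inv(2)]
    have picard_rate: "0 < picard_rate" "2 * L / picard_rate \<le> 1 / 2" using nonneg by (auto simp: picard_rate_def field_simps)
    show "dist (weight (picard (unweight U))) (weight (picard (unweight U'))) \<le> 1 / 2 * dist U U'"
    proof (rule dist_bound)
      fix z :: "real \<times> 'a"
      obtain t y where z: "z = (t, y)" by force
      let ?t = "clamp_time t"
      have "norm (picard (unweight U) ?t y - picard (unweight U') ?t y) \<le> (2 * L / picard_rate) * dist U U' * exp (picard_rate * ?t)"
      proof (rule picard_diff[OF inv clamp_time(1) _ picard_rate(1)])
        fix s y
        have "norm (unweight U s y - unweight U' s y) = exp (picard_rate * s) * dist (apply_bcontfun U (s, y)) (apply_bcontfun U' (s, y))"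
          by (simp add: unweight_def scaleR_diff_right[symmetric] dist_norm)
        also have "\<dots> \<le> exp (picard_rate * s) * dist U U'" by (intro mult_left_mono dist_bounded) auto
        finally show "norm (unweight U s y - unweight U' s y) \<le> dist U U' * exp (picard_rate * s)"
          by (simp add: mult.commute)
      qed
      also have "\<dots> \<le> 1 / 2 * dist U U' * exp (picard_rate * ?t)"
        using picard_rate by (intro mult_right_mono) auto
      finally have "exp (- picard_rate * ?t) * norm (picard (unweight U) ?t y - picard (unweight U') ?t y)
          \<le> exp (- picard_rate * ?t) * (1 / 2 * dist U U' * exp (picard_rate * ?t))"
        by (intro mult_left_mono) auto
      also have "\<dots> = 1 / 2 * dist U U'" by (simp add: exp_minus)
      finally show "dist (apply_bcontfun (weight (picard (unweight U))) z)
          (apply_bcontfun (weight (picard (unweight U'))) z) \<le> 1 / 2 * dist U U'"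
        unfolding z weight_def Bcontfun_inverse[OF clamped_bcontfun[OF pinv(1)]]
          Bcontfun_inverse[OF clamped_bcontfun[OF pinv(2)]]
        by (simp add: dist_norm scaleR_diff_right[symmetric])
    qed
  qed auto
  then obtain U where "U \<in> S" and U: "weight (picard (unweight U)) = U" by blast
  then have inv: "invariant_flow (unweight U)" by (simp add: S_def)
  have "unweight U t y = picard (unweight U) t y" if "t \<in> {0..T}" for t y
    using weight[OF picard_invariant[OF inv] that] by (simp add: U)
  with inv show ?thesis by blast
qed

text \<open>The integral equation differentiated. The initial condition is restricted to the ball of
  radius \<open>r\<close>, where \<open>start\<close> is the identity.\<close>

lemma mean_field_ode_solution:
  obtains X where
    "\<And>t y. t \<in> {0..T} \<Longrightarrow> norm (X t y) \<le> R"
    "\<And>t y. t \<in> {0..T} \<Longrightarrow> X t \<in> borel_measurable borel"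
    "\<And>t s y. t \<in> {0..T} \<Longrightarrow> s \<in> {0..T} \<Longrightarrow> norm (X t y - X s y) \<le> A * R * \<bar>t - s\<bar>"
    "\<And>t y y'. t \<in> {0..T} \<Longrightarrow> norm (X t y - X t y') \<le> exp (L * T) * norm (y - y')"
    "\<And>y. norm y \<le> r \<Longrightarrow> X 0 y = y"
    "\<And>t y. t \<in> {0..T} \<Longrightarrow> ((\<lambda>s. X s y) has_vector_derivative b (X t) (X t y)) (at t within {0..T})"
    "continuous_on ({0..T} \<times> UNIV) (\<lambda>(t, y). b (X t) (X t y))"
proof -
  obtain X where X: "invariant_flow X" and fixp: "\<And>t y. t \<in> {0..T} \<Longrightarrow> X t y = picard X t y"
    using flow_fixed_point by blast
  note D = invariant_flowD[OF X]
  show ?thesis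
  proof
    fix t y y' assume t: "t \<in> {0..T}"
    show "norm (X t y - X t y') \<le> exp (L * T) * norm (y - y')"
      using t nonneg by (intro order_trans[OF D(4)[OF t]] mult_right_mono) (auto intro!: mult_left_mono)
    have "((\<lambda>u. start y + integral {0..u} (\<lambda>s. b (X s) (X s y))) has_vector_derivative 0 + b (X t) (X t y)) (at t within {0..T})"
      by (intro derivative_intros integral_has_vector_derivative continuous_on_field_time X t)
    then show "((\<lambda>s. X s y) has_vector_derivative b (X t) (X t y)) (at t within {0..T})"
      unfolding add_0_left
      by (rule has_vector_derivative_transform[OF t fixp[unfolded picard_def, of _ y], rotated])
  next
    fix y :: 'a assume "norm y \<le> r"
    then show "X 0 y = y"
      using fixp[of 0 y] nonneg unfolding picard_def by (simp add: start_def closest_point_self)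
  qed (use D(2,3,5) continuous_on_field_along_flow[OF X] in auto)
qed

end

section \<open>Couplings and the Wasserstein distance to an empirical measure\<close>

lemma distr_coupling:
  assumes [measurable]: "Y \<in> borel_measurable \<kappa>" "Z \<in> borel_measurable \<kappa>"
  shows "distr \<kappa> (borel \<Otimes>\<^sub>M borel) (\<lambda>a. (Y a, Z a)) \<in> couplings (distr \<kappa> borel Y) (distr \<kappa> borel Z)"
  by (simp add: couplings_def distr_distr comp_def)

lemma couplings_cost_bdd_below:
  "bdd_below ((\<lambda>\<gamma>. \<integral>z. (dist (fst z) (snd z))\<^sup>2 \<partial>\<gamma>) ` couplings \<mu> \<nu>)"
  by (intro bdd_belowI2[where m = 0]) auto

lemma wasserstein2_le_sqrt_cost:
  assumes "\<gamma> \<in> couplings \<mu> \<nu>"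
  shows "wasserstein2 \<mu> \<nu> \<le> sqrt (\<integral>z. (dist (fst z) (snd z))\<^sup>2 \<partial>\<gamma>)"
  unfolding wasserstein2_def
  by (intro real_sqrt_le_mono cINF_lower couplings_cost_bdd_below assms)

text \<open>Over an empty set of couplings the infimum would be an unspecified real, so nonemptiness
  has to be shown wherever a sign is needed.\<close>

lemma wasserstein2_nonneg:
  assumes "couplings \<mu> \<nu> \<noteq> {}"
  shows "0 \<le> wasserstein2 \<mu> \<nu>"
  unfolding wasserstein2_def using assms by (auto intro!: cINF_greatest)

lemma wasserstein2_distr_le:
  fixes Y Z :: "'b \<Rightarrow> 'a::euclidean_space"
  assumes [measurable]: "Y \<in> borel_measurable \<kappa>" "Z \<in> borel_measurable \<kappa>"
  shows "wasserstein2 (distr \<kappa> borel Y) (distr \<kappa> borel Z) \<le> sqrt (\<integral>a. (norm (Y a - Z a))\<^sup>2 \<partial>\<kappa>)"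
  using wasserstein2_le_sqrt_cost[OF distr_coupling[OF assms]]
  by (subst (asm) integral_distr) (auto simp: dist_norm)

lemma wasserstein2_distr_nonneg:
  fixes Y Z :: "'b \<Rightarrow> 'a::euclidean_space"
  assumes "Y \<in> borel_measurable \<kappa>" "Z \<in> borel_measurable \<kappa>"
  shows "0 \<le> wasserstein2 (distr \<kappa> borel Y) (distr \<kappa> borel Z)"
  using distr_coupling[OF assms] by (intro wasserstein2_nonneg) auto

text \<open>The common device behind the couplings built below: a density on a product whose partial
  integrals are both one leaves both marginals unchanged. Almost everywhere is enough, which allows
  null cells and points off the sample to be ignored.\<close>

lemma reweighted_product:
  fixes g :: "'a \<times> 'b \<Rightarrow> real"
  assumes "prob_space M1" "prob_space M2" and [measurable]: "g \<in> borel_measurable (M1 \<Otimes>\<^sub>M M2)"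
    and 1: "AE x in M1. (\<integral>\<^sup>+y. g (x, y) \<partial>M2) = 1" and 2: "AE y in M2. (\<integral>\<^sup>+x. g (x, y) \<partial>M1) = 1"
  shows "distr (density (M1 \<Otimes>\<^sub>M M2) g) M1 fst = M1" and "distr (density (M1 \<Otimes>\<^sub>M M2) g) M2 snd = M2"
    and "prob_space (density (M1 \<Otimes>\<^sub>M M2) g)"
proof -
  interpret M1: prob_space M1 by fact
  interpret M2: prob_space M2 by fact
  interpret pair_prob_space M1 M2 ..
  show fst: "distr (density (M1 \<Otimes>\<^sub>M M2) g) M1 fst = M1"
  proof (rule measure_eqI)
    fix A assume "A \<in> sets (distr (density (M1 \<Otimes>\<^sub>M M2) g) M1 fst)"
    then have [measurable]: "A \<in> sets M1" by simp
    have "emeasure (distr (density (M1 \<Otimes>\<^sub>M M2) g) M1 fst) A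
        = (\<integral>\<^sup>+z. ennreal (g z) * indicator (fst -` A \<inter> space (M1 \<Otimes>\<^sub>M M2)) z \<partial>(M1 \<Otimes>\<^sub>M M2))"
      by (subst emeasure_distr) (auto simp: emeasure_density)
    also have "\<dots> = (\<integral>\<^sup>+z. ennreal (g z) * indicator A (fst z) \<partial>(M1 \<Otimes>\<^sub>M M2))"
      by (intro nn_integral_cong) (auto simp: indicator_def)
    also have "\<dots> = (\<integral>\<^sup>+x. \<integral>\<^sup>+y. ennreal (g (x, y)) * indicator A x \<partial>M2 \<partial>M1)"
      by (subst M2.nn_integral_fst[symmetric]) auto
    also have "\<dots> = (\<integral>\<^sup>+x. indicator A x \<partial>M1)"
      using 1 by (intro nn_integral_cong_AE) (auto simp: nn_integral_multc)
    finally show "emeasure (distr (density (M1 \<Otimes>\<^sub>M M2) g) M1 fst) A = emeasure M1 A"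
      by simp
  qed simp
  show "distr (density (M1 \<Otimes>\<^sub>M M2) g) M2 snd = M2"
  proof (rule measure_eqI)
    fix A assume "A \<in> sets (distr (density (M1 \<Otimes>\<^sub>M M2) g) M2 snd)"
    then have [measurable]: "A \<in> sets M2" by simp
    have "emeasure (distr (density (M1 \<Otimes>\<^sub>M M2) g) M2 snd) A
        = (\<integral>\<^sup>+z. ennreal (g z) * indicator (snd -` A \<inter> space (M1 \<Otimes>\<^sub>M M2)) z \<partial>(M1 \<Otimes>\<^sub>M M2))"
      by (subst emeasure_distr) (auto simp: emeasure_density)
    also have "\<dots> = (\<integral>\<^sup>+z. ennreal (g z) * indicator A (snd z) \<partial>(M1 \<Otimes>\<^sub>M M2))"
      by (intro nn_integral_cong) (auto simp: indicator_def)
    also have "\<dots> = (\<integral>\<^sup>+y. \<integral>\<^sup>+x. ennreal (g (x, y)) * indicator A y \<partial>M1 \<partial>M2)"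
      by (subst nn_integral_snd[symmetric]) auto
    also have "\<dots> = (\<integral>\<^sup>+y. indicator A y \<partial>M2)"
      using 2 by (intro nn_integral_cong_AE) (auto simp: nn_integral_multc)
    finally show "emeasure (distr (density (M1 \<Otimes>\<^sub>M M2) g) M2 snd) A = emeasure M2 A"
      by simp
  qed simp
  show "prob_space (density (M1 \<Otimes>\<^sub>M M2) g)"
    using M1.prob_space_axioms by (intro prob_space_distrD[of fst _ M1]) (auto simp: fst)
qed

section \<open>Empirical measures: index couplings and measurability of the Wasserstein
  distance\<close>

lemma prob_space_uniform_index:
  "0 < N \<Longrightarrow> prob_space (uniform_count_measure {..<N})" for N :: nat
  by (intro prob_space_uniform_count_measure) auto

lemma nn_integral_uniform_index:
  fixes N :: nat and f :: "nat \<Rightarrow> real"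
  assumes "0 < N" "\<And>i. i < N \<Longrightarrow> 0 \<le> f i"
  shows "(\<integral>\<^sup>+i. f i \<partial>uniform_count_measure {..<N}) = ennreal ((\<Sum>i<N. f i) / N)"
proof -
  have "(\<integral>\<^sup>+i. f i \<partial>uniform_count_measure {..<N}) = (\<Sum>i<N. ennreal (1 / N) * ennreal (f i))"
    unfolding uniform_count_measure_def by (subst nn_integral_point_measure_finite) auto
  also have "\<dots> = (\<Sum>i<N. ennreal (f i / N))"
    using assms by (intro sum.cong) (auto simp: ennreal_mult[symmetric])
  also have "\<dots> = ennreal ((\<Sum>i<N. f i) / N)"
    using assms by (subst sum_ennreal) (auto simp: sum_divide_distrib)
  finally show ?thesis .
qed

lemma AE_uniform_index:
  "(AE i in uniform_count_measure {..<N}. P i) \<longleftrightarrow> (\<forall>i<N. P i)" for N :: nat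
proof (cases "N = 0")
  case False
  then have "0 < ennreal (1 / real (card {..<N}))" by simp
  then show ?thesis unfolding uniform_count_measure_def AE_point_measure by auto
qed (auto intro!: AE_I2 simp: space_uniform_count_measure)


lemma emeasure_empirical:
  fixes x :: "nat \<Rightarrow> 'a::topological_space"
  assumes "A \<in> sets borel" "0 < N"
  shows "emeasure (empirical_measure N x) A = ennreal (card {i. i < N \<and> x i \<in> A} / N)"
proof -
  have "x -` A \<inter> {..<N} = {i. i < N \<and> x i \<in> A}" by auto
  moreover have "{i. i < N \<and> x i \<in> A} \<subseteq> {..<N}" by auto
  ultimately show ?thesis
    using assms(1) unfolding empirical_measure_def
    by (simp add: emeasure_distr space_uniform_count_measure emeasure_uniform_count_measure)
qed

context
  fixes \<mu> :: "'a::euclidean_space measure" and N :: nat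
  assumes \<mu>: "\<mu> \<in> P2" and N: "0 < N"
begin

interpretation U: prob_space "uniform_count_measure {..<N}" by (rule prob_space_uniform_index[OF N])

text \<open>A coupling of an empirical measure only sees the points of the sample, which may coincide;
  splitting the mass at each point evenly among the indices lifts it to a coupling with the
  index measure, which remains meaningful when the sample is perturbed.\<close>

lemma coupling_lift:
  assumes \<gamma>: "\<gamma> \<in> couplings (empirical_measure N x) \<mu>"
  obtains \<kappa> :: "(nat \<times> 'a \<times> 'a) measure" where
    "prob_space \<kappa>"
    "integrable \<kappa> (\<lambda>a. (norm (x (fst a) - snd (snd a)))\<^sup>2)"
    "(\<integral>a. (norm (x (fst a) - snd (snd a)))\<^sup>2 \<partial>\<kappa>) = (\<integral>z. (dist (fst z) (snd z))\<^sup>2 \<partial>\<gamma>)"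
    "AE a in \<kappa>. fst a < N"
    "\<forall>x'. (\<lambda>a. x' (fst a) :: 'a) \<in> borel_measurable \<kappa>"
    "(\<lambda>a. snd (snd a)) \<in> borel_measurable \<kappa>"
    "\<forall>x' :: nat \<Rightarrow> 'a. distr \<kappa> borel (\<lambda>a. x' (fst a)) = empirical_measure N x'"
    "distr \<kappa> borel (\<lambda>a. snd (snd a)) = \<mu>"
proof -
  let ?U = "uniform_count_measure {..<N}"
  from \<gamma> have [measurable_cong]: "sets \<gamma> = sets (borel \<Otimes>\<^sub>M borel)"
    and fst: "distr \<gamma> borel fst = empirical_measure N x" and snd: "distr \<gamma> borel snd = \<mu>"
    by (auto simp: couplings_def)
  have "prob_space (empirical_measure N x)"
    unfolding empirical_measure_def by (rule U.prob_space_distr) simp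
  then interpret \<gamma>: prob_space \<gamma>
    unfolding fst[symmetric] by (rule prob_space_distrD[rotated]) measurable
  define m where "m i = card {j. j < N \<and> x j = x i}" for i
  have m: "0 < m i" if "i < N" for i
    using that unfolding m_def by (subst card_gt_0_iff) auto
  \<comment> \<open>The atom at \<open>x i\<close> has mass \<open>m i / N\<close>, so
    \<open>N / m i\<close> normalises the row of index \<open>i\<close>; for a given atom, each of
    its \<open>m i\<close> indices receives the share \<open>1 / m i\<close>.\<close>
  define g where "g = (\<lambda>(i, z :: 'a \<times> 'a). indicat_real {x i} (fst z) * (N / m i))"
  have [measurable]: "(\<lambda>a. x' (fst a)) \<in> borel_measurable (?U \<Otimes>\<^sub>M \<gamma>)" for x' :: "nat \<Rightarrow> 'b::topological_space"
    by (rule measurable_compose[OF measurable_fst]) simp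
  have [measurable]: "(\<lambda>a. fst (snd a)) \<in> borel_measurable (?U \<Otimes>\<^sub>M \<gamma>)"
    "(\<lambda>a. snd (snd a)) \<in> borel_measurable (?U \<Otimes>\<^sub>M \<gamma>)"
    by (rule measurable_compose[OF measurable_snd]; measurable)+
  have g_eq: "g a = (if fst (snd a) = x (fst a) then N / m (fst a) else 0)" for a
    by (auto simp: g_def indicator_def split_beta)
  have [measurable]: "g \<in> borel_measurable (?U \<Otimes>\<^sub>M \<gamma>)"
    unfolding g_eq[abs_def] by measurable
  have "(\<integral>\<^sup>+z. g (i, z) \<partial>\<gamma>) = 1" if "i < N" for i
  proof -
    have "(\<integral>\<^sup>+z. g (i, z) \<partial>\<gamma>) = (\<integral>\<^sup>+z. ennreal (N / m i) * indicator {z\<in>space \<gamma>. fst z = x i} z \<partial>\<gamma>)"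
      by (intro nn_integral_cong) (auto simp: g_def indicator_def)
    also have "\<dots> = ennreal (N / m i) * emeasure \<gamma> {z\<in>space \<gamma>. fst z = x i}"
      by (subst nn_integral_cmult_indicator) auto
    also have "{z\<in>space \<gamma>. fst z = x i} = fst -` {x i} \<inter> space \<gamma>" by auto
    also have "emeasure \<gamma> (fst -` {x i} \<inter> space \<gamma>) = emeasure (empirical_measure N x) {x i}"
      unfolding fst[symmetric] by (subst emeasure_distr) auto
    also have "\<dots> = ennreal (m i / N)"
      using N by (subst emeasure_empirical) (auto simp: m_def)
    also have "ennreal (N / m i) * ennreal (m i / N) = 1"
      using m[OF that] N by (simp add: ennreal_mult[symmetric])
    finally show ?thesis .
  qed
  then have g1: "AE i in ?U. (\<integral>\<^sup>+z. g (i, z) \<partial>\<gamma>) = 1" by (simp add: AE_uniform_index)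
  \<comment> \<open>The column integral of \<open>g\<close> is one only over sample points, and the
    first marginal of \<open>\<gamma>\<close> charges no others.\<close>
  have "AE a in distr \<gamma> borel fst. a \<in> x ` {..<N}"
    unfolding fst empirical_measure_def
    by (subst AE_distr_iff) (auto simp: AE_uniform_index intro!: borel_closed finite_imp_closed)
  then have "AE z in \<gamma>. fst z \<in> x ` {..<N}"
    by (subst (asm) AE_distr_iff) (auto intro!: borel_closed finite_imp_closed)
  moreover have "(\<integral>\<^sup>+i. g (i, z) \<partial>?U) = 1" if z: "fst z \<in> x ` {..<N}" for z
  proof -
    obtain k where k: "k < N" "fst z = x k" using z by blast
    have "(\<integral>\<^sup>+i. g (i, z) \<partial>?U) = ennreal ((\<Sum>i<N. g (i, z)) / N)"
      using N by (intro nn_integral_uniform_index) (auto simp: g_def)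
    also have "(\<Sum>i<N. g (i, z)) = (\<Sum>i\<in>{j. j < N \<and> x j = x k}. N / m k)"
      by (rule sum.mono_neutral_cong_right) (auto simp: g_def k m_def indicator_def)
    also have "\<dots> = N" using m[OF k(1)] unfolding sum_constant m_def[symmetric] by simp
    finally show ?thesis using N by simp
  qed
  ultimately have g2: "AE z in \<gamma>. (\<integral>\<^sup>+i. g (i, z) \<partial>?U) = 1" by (auto elim: AE_mp)
  define \<kappa> where "\<kappa> = density (?U \<Otimes>\<^sub>M \<gamma>) g"
  have [measurable_cong]: "sets \<kappa> = sets (?U \<Otimes>\<^sub>M \<gamma>)" by (simp add: \<kappa>_def)
  have meas: "f \<in> borel_measurable (?U \<Otimes>\<^sub>M \<gamma>) \<Longrightarrow> f \<in> borel_measurable \<kappa>"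
    for f :: "_ \<Rightarrow> 'b::topological_space"
    by (simp add: \<kappa>_def)
  note rp = reweighted_product[OF U.prob_space_axioms \<gamma>.prob_space_axioms \<open>g \<in> borel_measurable (?U \<Otimes>\<^sub>M \<gamma>)\<close> g1 g2,
      folded \<kappa>_def]
  have x_AE: "AE a in \<kappa>. x (fst a) = fst (snd a)"
    unfolding \<kappa>_def by (subst AE_density) (auto simp: g_eq)
  have snd_meas: "snd \<in> \<kappa> \<rightarrow>\<^sub>M \<gamma>" and fst_meas: "fst \<in> \<kappa> \<rightarrow>\<^sub>M ?U"
    by (auto simp: \<kappa>_def)
  have "AE z in \<gamma>. norm (fst z) \<le> (\<Sum>i<N. norm (x i))"
    using \<open>AE z in \<gamma>. fst z \<in> x ` {..<N}\<close>
    by (rule AE_mp) (auto intro!: AE_I2 member_le_sum)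
  then have "AE z in \<gamma>. norm ((norm (fst z))\<^sup>2) \<le> (\<Sum>i<N. norm (x i))\<^sup>2"
    by eventually_elim (auto intro!: power_mono)
  then have fst_int: "integrable \<gamma> (\<lambda>z. (norm (fst z))\<^sup>2)"
    by (rule \<gamma>.integrable_const_bound) measurable
  have snd_int: "integrable \<gamma> (\<lambda>z. (norm (snd z))\<^sup>2)"
    using \<mu> unfolding P2_def snd[symmetric] by (auto simp: integrable_distr_eq)
  have dist_int: "integrable \<gamma> (\<lambda>z. (dist (fst z) (snd z))\<^sup>2)"
  proof (rule Bochner_Integration.integrable_bound)
    show "integrable \<gamma> (\<lambda>z. 2 * ((norm (fst z))\<^sup>2 + (norm (snd z))\<^sup>2))"
      using fst_int snd_int by auto
    have "(dist (fst z) (snd z))\<^sup>2 \<le> 2 * ((norm (fst z))\<^sup>2 + (norm (snd z))\<^sup>2)" for z :: "'a \<times> 'a"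
    proof -
      have "(dist (fst z) (snd z))\<^sup>2 \<le> (norm (fst z) + norm (snd z))\<^sup>2"
        by (intro power_mono) (auto simp: dist_norm intro: norm_triangle_ineq4)
      also have "\<dots> \<le> 2 * ((norm (fst z))\<^sup>2 + (norm (snd z))\<^sup>2)"
        using sum_squares_bound[of "norm (fst z)" "norm (snd z)"] by (simp add: power2_sum)
      finally show ?thesis .
    qed
    then show "AE z in \<gamma>. norm ((dist (fst z) (snd z))\<^sup>2) \<le> norm (2 * ((norm (fst z))\<^sup>2 + (norm (snd z))\<^sup>2))"
      by (intro AE_I2) (auto intro: order_trans[OF _ abs_ge_self])
  qed measurable
  have "integrable (distr \<kappa> \<gamma> snd) (\<lambda>z. (dist (fst z) (snd z))\<^sup>2)"
    using dist_int by (simp add: rp)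
  then have int: "integrable \<kappa> (\<lambda>a. (dist (fst (snd a)) (snd (snd a)))\<^sup>2)"
    by (subst (asm) integrable_distr_eq[OF snd_meas]) auto
  have "(\<integral>z. (dist (fst z) (snd z))\<^sup>2 \<partial>distr \<kappa> \<gamma> snd) = (\<integral>a. (dist (fst (snd a)) (snd (snd a)))\<^sup>2 \<partial>\<kappa>)"
    by (rule integral_distr[OF snd_meas]) measurable
  also have "\<dots> = (\<integral>a. (norm (x (fst a) - snd (snd a)))\<^sup>2 \<partial>\<kappa>)"
  proof (intro integral_cong_AE meas)
    show "AE a in \<kappa>. (dist (fst (snd a)) (snd (snd a)))\<^sup>2 = (norm (x (fst a) - snd (snd a)))\<^sup>2"
      using x_AE by eventually_elim (simp add: dist_norm)
  qed measurable
  finally have cost: "(\<integral>a. (norm (x (fst a) - snd (snd a)))\<^sup>2 \<partial>\<kappa>) = (\<integral>z. (dist (fst z) (snd z))\<^sup>2 \<partial>\<gamma>)"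
    by (simp add: rp)
  show ?thesis
  proof (rule that[OF rp(3) _ cost])
    show "integrable \<kappa> (\<lambda>a. (norm (x (fst a) - snd (snd a)))\<^sup>2)"
    proof (rule integrable_cong_AE_imp[OF int meas])
      show "AE a in \<kappa>. (dist (fst (snd a)) (snd (snd a)))\<^sup>2 = (norm (x (fst a) - snd (snd a)))\<^sup>2"
        using x_AE by eventually_elim (simp add: dist_norm)
    qed measurable
    show "AE a in \<kappa>. fst a < N"
      by (intro AE_I2) (auto simp: \<kappa>_def space_pair_measure space_uniform_count_measure)
    show "\<forall>x'. (\<lambda>a. x' (fst a) :: 'a) \<in> borel_measurable \<kappa>"
      by (intro allI meas) measurable
    show "(\<lambda>a. snd (snd a)) \<in> borel_measurable \<kappa>"
      by (intro meas) measurable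
    show "\<forall>x' :: nat \<Rightarrow> 'a. distr \<kappa> borel (\<lambda>a. x' (fst a)) = empirical_measure N x'"
      unfolding empirical_measure_def
      by (intro allI, subst rp(1)[symmetric], subst distr_distr[OF _ fst_meas]) (auto simp: comp_def)
    show "distr \<kappa> borel (\<lambda>a. snd (snd a)) = \<mu>"
      unfolding snd[symmetric]
      by (subst rp(2)[symmetric], subst distr_distr[OF _ snd_meas]) (auto simp: comp_def)
  qed
qed

text \<open>The independent coupling, that is the density one in
  \<open>reweighted_product\<close>.\<close>

lemma empirical_coupling_exists: "couplings (empirical_measure N x) \<mu> \<noteq> {}"
proof -
  let ?\<kappa> = "uniform_count_measure {..<N} \<Otimes>\<^sub>M \<mu>"
  from \<mu> have [measurable_cong]: "sets \<mu> = sets borel" and "prob_space \<mu>" by (auto simp: P2_def)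
  note rp = reweighted_product[OF U.prob_space_axioms \<open>prob_space \<mu>\<close>, of "\<lambda>_. 1"]
  interpret \<mu>: prob_space \<mu> by fact
  have 1: "distr ?\<kappa> (uniform_count_measure {..<N}) fst = uniform_count_measure {..<N}"
    "distr ?\<kappa> \<mu> snd = \<mu>"
    using rp(1,2) by (simp_all add: U.emeasure_space_1[simplified] \<mu>.emeasure_space_1 density_1)
  have x_meas: "(\<lambda>a. x (fst a)) \<in> borel_measurable ?\<kappa>"
    by (rule measurable_compose[OF measurable_fst]) simp
  have snd_meas: "snd \<in> borel_measurable ?\<kappa>" by measurable
  have "distr ?\<kappa> borel (\<lambda>a. x (fst a)) = empirical_measure N x"
    unfolding empirical_measure_def
    by (subst (2) 1(1)[symmetric], subst distr_distr[OF _ measurable_fst]) (auto simp: comp_def)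
  moreover have "distr ?\<kappa> borel snd = \<mu>"
    using 1(2) distr_cong[of ?\<kappa> ?\<kappa> \<mu> borel snd snd] \<open>sets \<mu> = sets borel\<close> by simp
  ultimately show ?thesis
    using distr_coupling[OF x_meas snd_meas] by auto
qed

text \<open>Upper semicontinuity in the sample: a coupling of cost below \<open>c\<^sup>2\<close> is
  lifted to the indices, and the same index plan is then reused for the perturbed points, whose cost
  is only slightly larger.\<close>

lemma wasserstein2_empirical_upper:
  assumes "wasserstein2 (empirical_measure N x) \<mu> < c"
  shows "\<exists>\<delta>>0. \<forall>x'. (\<forall>i<N. norm (x' i - x i) < \<delta>) \<longrightarrow> wasserstein2 (empirical_measure N x') \<mu> < c"
proof -
  have "0 < c"
    using wasserstein2_nonneg[OF empirical_coupling_exists, of x] assms by linarith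
  have "sqrt (INF \<gamma>\<in>couplings (empirical_measure N x) \<mu>. \<integral>z. (dist (fst z) (snd z))\<^sup>2 \<partial>\<gamma>) < sqrt (c\<^sup>2)"
    using assms \<open>0 < c\<close> by (simp add: wasserstein2_def)
  then have "(INF \<gamma>\<in>couplings (empirical_measure N x) \<mu>. \<integral>z. (dist (fst z) (snd z))\<^sup>2 \<partial>\<gamma>) < c\<^sup>2"
    by (simp only: real_sqrt_less_iff)
  then obtain \<gamma> where \<gamma>: "\<gamma> \<in> couplings (empirical_measure N x) \<mu>"
    and cost: "(\<integral>z. (dist (fst z) (snd z))\<^sup>2 \<partial>\<gamma>) < c\<^sup>2"
    using cINF_less_iff[OF empirical_coupling_exists couplings_cost_bdd_below] by blast
  from \<gamma> obtain \<kappa> :: "(nat \<times> 'a \<times> 'a) measure" where \<kappa>: "prob_space \<kappa>"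
    "integrable \<kappa> (\<lambda>a. (norm (x (fst a) - snd (snd a)))\<^sup>2)"
    "(\<integral>a. (norm (x (fst a) - snd (snd a)))\<^sup>2 \<partial>\<kappa>) = (\<integral>z. (dist (fst z) (snd z))\<^sup>2 \<partial>\<gamma>)"
    "AE a in \<kappa>. fst a < N"
    "\<forall>x'. (\<lambda>a. x' (fst a) :: 'a) \<in> borel_measurable \<kappa>"
    "(\<lambda>a. snd (snd a)) \<in> borel_measurable \<kappa>"
    "\<forall>x' :: nat \<Rightarrow> 'a. distr \<kappa> borel (\<lambda>a. x' (fst a)) = empirical_measure N x'"
    "distr \<kappa> borel (\<lambda>a. snd (snd a)) = \<mu>"
    by (rule coupling_lift)
  interpret \<kappa>: prob_space \<kappa> by fact
  define k where "k = (\<integral>a. (norm (x (fst a) - snd (snd a)))\<^sup>2 \<partial>\<kappa>)"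
  have k: "0 \<le> k" "k < c\<^sup>2" using cost by (simp_all add: k_def \<kappa>(3)[symmetric])
  \<comment> \<open>For \<open>\<delta> \<le> 1\<close> the perturbed cost is at most
    \<open>k + \<delta> * (2 + k)\<close>, from \<open>(\<delta> + u)\<^sup>2 \<le> (1 + \<delta>) *
    u\<^sup>2 + 2 * \<delta>\<close>; this choice spends at most half of the gap
    \<open>c\<^sup>2 - k\<close>.\<close>
  define \<delta> where "\<delta> = min 1 ((c\<^sup>2 - k) / (2 * (2 + k)))"
  have \<delta>: "0 < \<delta>" "\<delta> \<le> 1" using k by (auto simp: \<delta>_def)
  have "\<delta> * (2 + k) \<le> (c\<^sup>2 - k) / (2 * (2 + k)) * (2 + k)"
    using k by (intro mult_right_mono) (auto simp: \<delta>_def)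
  also have "\<dots> < c\<^sup>2 - k" using k by (simp add: divide_simps)
  finally have \<delta>c: "\<delta> * (2 + k) < c\<^sup>2 - k" .
  show ?thesis
  proof (intro exI[of _ \<delta>] conjI allI impI \<delta>)
    fix x' :: "nat \<Rightarrow> 'a" assume x': "\<forall>i<N. norm (x' i - x i) < \<delta>"
    have "AE a in \<kappa>. (norm (x' (fst a) - snd (snd a)))\<^sup>2 \<le> (1 + \<delta>) * (norm (x (fst a) - snd (snd a)))\<^sup>2 + 2 * \<delta>"
      using \<kappa>(4)
    proof (rule AE_mp, intro AE_I2 impI)
      fix a :: "nat \<times> 'a \<times> 'a" assume "fst a < N"
      define u where "u = norm (x (fst a) - snd (snd a))"
      have "norm (x' (fst a) - snd (snd a)) \<le> \<delta> + u"
        using x' \<open>fst a < N\<close> norm_triangle_ineq[of "x' (fst a) - x (fst a)" "x (fst a) - snd (snd a)"]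
        by (fastforce simp: u_def)
      then have "(norm (x' (fst a) - snd (snd a)))\<^sup>2 \<le> (\<delta> + u)\<^sup>2" by (intro power_mono) auto
      also have "\<dots> = u\<^sup>2 + \<delta> * \<delta> + \<delta> * (2 * u)" by (simp add: power2_eq_square algebra_simps)
      also have "\<dots> \<le> u\<^sup>2 + \<delta> * 1 + \<delta> * (1 + u\<^sup>2)"
        using \<delta> sum_squares_bound[of 1 u] by (intro add_mono mult_left_mono) auto
      finally show "(norm (x' (fst a) - snd (snd a)))\<^sup>2 \<le> (1 + \<delta>) * (norm (x (fst a) - snd (snd a)))\<^sup>2 + 2 * \<delta>"
        by (simp add: u_def algebra_simps)
    qed
    then have "(\<integral>a. (norm (x' (fst a) - snd (snd a)))\<^sup>2 \<partial>\<kappa>)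
        \<le> (\<integral>a. (1 + \<delta>) * (norm (x (fst a) - snd (snd a)))\<^sup>2 + 2 * \<delta> \<partial>\<kappa>)"
      using \<kappa>(2) \<delta> by (intro integral_mono_AE') auto
    also have "\<dots> = k + \<delta> * (2 + k)"
      using \<kappa>(2) by (simp add: k_def \<kappa>.prob_space algebra_simps)
    also have "\<dots> < c\<^sup>2" using \<delta>c by simp
    finally have "(\<integral>a. (norm (x' (fst a) - snd (snd a)))\<^sup>2 \<partial>\<kappa>) < c\<^sup>2" .
    then have "sqrt (\<integral>a. (norm (x' (fst a) - snd (snd a)))\<^sup>2 \<partial>\<kappa>) < c"
      using \<open>0 < c\<close> real_less_lsqrt by (simp add: real_sqrt_less_iff[of _ "c\<^sup>2", simplified, symmetric])
    with wasserstein2_distr_le[OF \<kappa>(5)[rule_format, of x'] \<kappa>(6)]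
    show "wasserstein2 (empirical_measure N x') \<mu> < c"
      by (simp add: \<kappa>(7)[rule_format, of x'] \<kappa>(8))
  qed
qed

text \<open>By upper semicontinuity the strict sublevel sets are open in the product topology on
  sequences, hence Borel. This replaces an infimum over an uncountable family of couplings.\<close>

lemma measurable_wasserstein2_empirical:
  fixes Y :: "nat \<Rightarrow> 'b \<Rightarrow> 'a"
  assumes Y: "\<And>i. i < N \<Longrightarrow> Y i \<in> borel_measurable M"
  shows "(\<lambda>\<omega>. wasserstein2 (empirical_measure N (\<lambda>i. Y i \<omega>)) \<mu>) \<in> borel_measurable M"
  unfolding borel_measurable_iff_less
proof
  fix c
  define O' where "O' = {x :: nat \<Rightarrow> 'a. wasserstein2 (empirical_measure N x) \<mu> < c}"
  have "open O'"
    unfolding open_subopen[of O']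
  proof
    fix x assume "x \<in> O'"
    then obtain \<delta> where \<delta>: "0 < \<delta>"
      "\<And>x'. (\<forall>i<N. norm (x' i - x i) < \<delta>) \<Longrightarrow> wasserstein2 (empirical_measure N x') \<mu> < c"
      using wasserstein2_empirical_upper[of x c] unfolding O'_def by blast
    let ?B = "\<Inter>i\<in>{..<N}. {x'. norm (x' i - x i) < \<delta>}"
    have "open ?B"
      by (intro open_INT ballI open_Collect_less continuous_intros continuous_on_product_coordinates) auto
    moreover have "x \<in> ?B" "?B \<subseteq> O'" using \<delta> by (auto simp: O'_def)
    ultimately show "\<exists>B. open B \<and> x \<in> B \<and> B \<subseteq> O'" by blast
  qed
  \<comment> \<open>Measurability is known only for indices below \<open>N\<close>; padding with 0
    yields a measurable sequence with the same empirical measure.\<close>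
  define Z where "Z \<omega> i = (if i < N then Y i \<omega> else 0)" for \<omega> i
  have "Z \<in> borel_measurable M"
  proof (rule measurable_coordinatewise_then_product)
    show "(\<lambda>\<omega>. Z \<omega> i) \<in> borel_measurable M" for i
      using Y by (cases "i < N") (auto simp: Z_def)
  qed
  then have "Z -` O' \<inter> space M \<in> sets M" using \<open>open O'\<close> by measurable
  also have "empirical_measure N (Z \<omega>) = empirical_measure N (\<lambda>i. Y i \<omega>)" for \<omega>
    unfolding empirical_measure_def by (rule distr_cong) (auto simp: Z_def space_uniform_count_measure)
  then have "Z -` O' \<inter> space M = {\<omega> \<in> space M. wasserstein2 (empirical_measure N (\<lambda>i. Y i \<omega>)) \<mu> < c}"
    by (auto simp: O'_def)
  finally show "{\<omega> \<in> space M. wasserstein2 (empirical_measure N (\<lambda>i. Y i \<omega>)) \<mu> < c} \<in> sets M" .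
qed

end

section \<open>Couplings along dyadic partitions\<close>

lemma refinement_chain:
  assumes "\<And>n p q. n < m \<Longrightarrow> p \<in> I \<Longrightarrow> q \<in> I \<Longrightarrow> l (Suc n) p = l (Suc n) q \<Longrightarrow> l n p = l n q"
    and "n \<le> m" "p \<in> I" "q \<in> I" "l m p = l m q"
  shows "l n p = l n q"
  using assms(2)
proof (induction rule: inc_induct)
  case base
  show ?case by (rule assms(5))
next
  case (step k)
  show ?case by (rule assms(1)[OF step.hyps(2) assms(3,4) step.IH])
qed

text \<open>Mass is matched greedily inside the cells of the finest partition; the residual masses are
  coupled recursively along the coarser ones. Matching within a cell does not change the
  differences of the cell masses, and what remains after level \<open>n\<close> is the positive part of these
  differences.\<close>

lemma tree_coupling:
  fixes a b :: "'q \<Rightarrow> real" and l :: "nat \<Rightarrow> 'q \<Rightarrow> 'c"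
  assumes fin: "finite I" and "\<And>p. p \<in> I \<Longrightarrow> 0 \<le> a p" "\<And>p. p \<in> I \<Longrightarrow> 0 \<le> b p" and "sum a I = sum b I"
    and "\<And>n p q. n < m \<Longrightarrow> p \<in> I \<Longrightarrow> q \<in> I \<Longrightarrow> l (Suc n) p = l (Suc n) q \<Longrightarrow> l n p = l n q"
    and const: "\<And>p q. p \<in> I \<Longrightarrow> q \<in> I \<Longrightarrow> l 0 p = l 0 q"
  shows "\<exists>\<pi>. (\<forall>p\<in>I. \<forall>q\<in>I. 0 \<le> \<pi> p q) \<and> (\<forall>p\<in>I. (\<Sum>q\<in>I. \<pi> p q) = a p) \<and> (\<forall>q\<in>I. (\<Sum>p\<in>I. \<pi> p q) = b q) \<and>
    (\<forall>n\<le>m. (\<Sum>p\<in>I. \<Sum>q\<in>I. if l n p = l n q then 0 else \<pi> p q)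
      \<le> (\<Sum>c\<in>l n ` I. \<bar>\<Sum>p\<in>{p\<in>I. l n p = c}. a p - b p\<bar>))"
  using assms(2-5)
proof (induction m arbitrary: a b)
  case 0
  \<comment> \<open>At level 0 all labels agree, so the normalised product plan separates nothing.
    If the total mass is 0, all masses vanish and \<open>x / 0 = 0\<close> still gives the right
    marginals.\<close>
  let ?s = "sum a I"
  have a0: "a p = 0" if "?s = 0" "p \<in> I" for p
    using sum_nonneg_eq_0_iff[OF fin, of a] 0(1) that by blast
  have b0: "b p = 0" if "?s = 0" "p \<in> I" for p
    using sum_nonneg_eq_0_iff[OF fin, of b] 0(2) that unfolding 0(3) by blast
  have mass: "(\<Sum>p\<in>I. \<Sum>q\<in>I. if l 0 p = l 0 q then 0 else a p * b q / ?s) = 0"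
  proof (intro sum.neutral ballI)
    fix p q assume "p \<in> I" "q \<in> I"
    then have "l 0 p = l 0 q" by (rule const)
    then show "(if l 0 p = l 0 q then 0 else a p * b q / ?s) = 0" by simp
  qed
  have row: "(\<Sum>q\<in>I. a p * b q / ?s) = a p" if "p \<in> I" for p
  proof -
    have "(\<Sum>q\<in>I. a p * b q / ?s) = a p * sum b I / ?s"
      by (simp add: sum_divide_distrib sum_distrib_left)
    also have "\<dots> = a p" using a0[OF _ that] unfolding 0(3)[symmetric] by (cases "?s = 0") auto
    finally show ?thesis .
  qed
  have col: "(\<Sum>p\<in>I. a p * b q / ?s) = b q" if "q \<in> I" for q
  proof -
    have "(\<Sum>p\<in>I. a p * b q / ?s) = ?s * b q / ?s"
      by (simp add: sum_divide_distrib sum_distrib_right)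
    then show ?thesis using b0[OF _ that] by (cases "?s = 0") auto
  qed
  have "0 \<le> ?s" using 0 by (intro sum_nonneg) auto
  then show ?case
    using 0(1,2) row col mass by (intro exI[of _ "\<lambda>p q. a p * b q / ?s"]) (auto intro!: sum_nonneg)
next
  case (Suc m)
  let ?l = "l (Suc m)"
  define A where "A c = (\<Sum>p\<in>{p\<in>I. ?l p = c}. a p)" for c
  define B where "B c = (\<Sum>p\<in>{p\<in>I. ?l p = c}. b p)" for c
  \<comment> \<open>Dividing by the larger mass makes the product plan inside a cell exhaust the
    smaller one and keeps both residuals nonnegative; what remains of \<open>a\<close> in the cell
    is \<open>max (A c - B c) 0\<close>.\<close>
  define X where "X c = max (A c) (B c)" for c
  define \<sigma> where "\<sigma> p q = (if ?l p = ?l q then a p * b q / X (?l p) else 0)" for p q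
  define a' where "a' p = a p - (\<Sum>q\<in>I. \<sigma> p q)" for p
  define b' where "b' q = b q - (\<Sum>p\<in>I. \<sigma> p q)" for q
  note a = Suc.prems(1) and b = Suc.prems(2)
  have AB: "0 \<le> A c" "0 \<le> B c" for c
    using a b by (auto simp: A_def B_def intro!: sum_nonneg)
  then have X: "0 \<le> X c" "A c \<le> X c" "B c \<le> X c" for c by (auto simp: X_def max_def)
  have \<sigma>: "0 \<le> \<sigma> p q" if "p \<in> I" "q \<in> I" for p q
    using a b X that by (simp add: \<sigma>_def)
  have \<sigma>_same: "\<sigma> p q = 0" if "l n p \<noteq> l n q" "p \<in> I" "q \<in> I" "n \<le> Suc m" for n p q
  proof (rule ccontr)
    assume "\<sigma> p q \<noteq> 0"
    then have "?l p = ?l q" by (auto simp: \<sigma>_def split: if_splits)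
    have "l n p = l n q"
      by (rule refinement_chain[where I = I and l = l and m = "Suc m"]; fact)
    with that(1) show False ..
  qed
  have row: "(\<Sum>q\<in>I. \<sigma> p q) = a p * B (?l p) / X (?l p)" if "p \<in> I" for p
  proof -
    have "(\<Sum>q\<in>I. \<sigma> p q) = (\<Sum>q\<in>{q\<in>I. ?l q = ?l p}. a p * b q / X (?l p))"
      by (rule sum.mono_neutral_cong_right) (auto simp: \<sigma>_def fin)
    then show ?thesis by (simp add: B_def sum_divide_distrib sum_distrib_left)
  qed
  have col: "(\<Sum>p\<in>I. \<sigma> p q) = b q * A (?l q) / X (?l q)" if "q \<in> I" for q
  proof -
    have "(\<Sum>p\<in>I. \<sigma> p q) = (\<Sum>p\<in>{p\<in>I. ?l p = ?l q}. b q * a p / X (?l q))"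
      by (rule sum.mono_neutral_cong_right) (auto simp: \<sigma>_def fin)
    then show ?thesis by (simp add: A_def sum_divide_distrib sum_distrib_left)
  qed
  have frac: "u * v / X c \<le> u" if "0 \<le> u" "v \<le> X c" for u v c
    using that X(1)[of c] by (cases "X c = 0") (auto simp: divide_simps mult_left_mono)
  have a': "0 \<le> a' p" if "p \<in> I" for p
    using frac[OF a[OF that] X(3)] row[OF that] by (simp add: a'_def)
  have b': "0 \<le> b' q" if "q \<in> I" for q
    using frac[OF b[OF that] X(2)] col[OF that] by (simp add: b'_def)
  \<comment> \<open>The matched part stays inside the cells of every level up to
    \<open>Suc m\<close>, so its row and column sums over such a cell agree and cancel.\<close>
  have diff: "(\<Sum>p\<in>{p\<in>I. l n p = c}. a' p - b' p) = (\<Sum>p\<in>{p\<in>I. l n p = c}. a p - b p)" if "n \<le> Suc m" for n c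
  proof -
    have "(\<Sum>p\<in>{p\<in>I. l n p = c}. \<Sum>q\<in>I. \<sigma> p q) = (\<Sum>p\<in>I. \<Sum>q\<in>I. if l n p = c then \<sigma> p q else 0)"
      by (simp add: sum.inter_filter[OF fin] if_distrib[of "\<lambda>P. sum _ _"] cong: if_cong)
         (auto intro!: sum.cong)
    also have "\<dots> = (\<Sum>q\<in>I. \<Sum>p\<in>I. if l n p = c then \<sigma> p q else 0)"
      by (rule sum.swap)
    also have "\<dots> = (\<Sum>q\<in>I. \<Sum>p\<in>I. if l n q = c then \<sigma> p q else 0)"
      using \<sigma>_same that by (intro sum.cong refl) (metis (mono_tags, lifting))
    also have "\<dots> = (\<Sum>q\<in>{q\<in>I. l n q = c}. \<Sum>p\<in>I. \<sigma> p q)"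
      by (simp add: sum.inter_filter[OF fin]) (auto intro!: sum.cong)
    finally show ?thesis by (simp add: a'_def b'_def sum_subtractf)
  qed
  have total: "sum a' I = sum b' I"
  proof -
    have "(\<Sum>p\<in>I. \<Sum>q\<in>I. \<sigma> p q) = (\<Sum>q\<in>I. \<Sum>p\<in>I. \<sigma> p q)" by (rule sum.swap)
    then show ?thesis using Suc.prems(3) unfolding a'_def b'_def sum_subtractf by linarith
  qed
  have refine: "l n p = l n q" if "n < m" "p \<in> I" "q \<in> I" "l (Suc n) p = l (Suc n) q" for n p q
    by (rule Suc.prems(4)[OF less_SucI that(2-4)]) (rule that(1))
  from Suc.IH[OF a' b' total refine] obtain \<pi> where
    \<pi>: "\<And>p q. p \<in> I \<Longrightarrow> q \<in> I \<Longrightarrow> 0 \<le> \<pi> p q"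
    and \<pi>_row: "\<And>p. p \<in> I \<Longrightarrow> (\<Sum>q\<in>I. \<pi> p q) = a' p" and \<pi>_col: "\<And>q. q \<in> I \<Longrightarrow> (\<Sum>p\<in>I. \<pi> p q) = b' q"
    and \<pi>_mass: "\<And>n. n \<le> m \<Longrightarrow> (\<Sum>p\<in>I. \<Sum>q\<in>I. if l n p = l n q then 0 else \<pi> p q)
      \<le> (\<Sum>c\<in>l n ` I. \<bar>\<Sum>p\<in>{p\<in>I. l n p = c}. a' p - b' p\<bar>)"
    by blast
  have mass_eq: "(\<Sum>p\<in>I. \<Sum>q\<in>I. if l n p = l n q then 0 else \<sigma> p q + \<pi> p q)
      = (\<Sum>p\<in>I. \<Sum>q\<in>I. if l n p = l n q then 0 else \<pi> p q)" if "n \<le> Suc m" for n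
    using \<sigma>_same that by (intro sum.cong refl) auto
  have residual: "sum a' I \<le> (\<Sum>c\<in>?l ` I. \<bar>A c - B c\<bar>)"
  proof -
    have "sum a' I = (\<Sum>c\<in>?l ` I. \<Sum>p\<in>{p\<in>I. ?l p = c}. a' p)"
      by (rule sum.image_gen[OF fin])
    also have "\<dots> = (\<Sum>c\<in>?l ` I. A c - A c * B c / X c)"
    proof (rule sum.cong)
      fix c
      have "(\<Sum>p\<in>{p\<in>I. ?l p = c}. a' p) = (\<Sum>p\<in>{p\<in>I. ?l p = c}. a p - a p * B c / X c)"
        using row by (intro sum.cong) (auto simp: a'_def)
      then show "(\<Sum>p\<in>{p\<in>I. ?l p = c}. a' p) = A c - A c * B c / X c"
        by (simp add: A_def sum_subtractf sum_divide_distrib sum_distrib_right)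
    qed auto
    also have "\<dots> \<le> (\<Sum>c\<in>?l ` I. \<bar>A c - B c\<bar>)"
    proof (rule sum_mono)
      fix c
      show "A c - A c * B c / X c \<le> \<bar>A c - B c\<bar>"
        using AB[of c] by (cases "A c \<le> B c"; cases "A c = 0"; cases "B c = 0") (auto simp: X_def max_def)
    qed
    finally show ?thesis .
  qed
  show ?case
  proof (intro exI[of _ "\<lambda>p q. \<sigma> p q + \<pi> p q"] conjI ballI allI impI)
    fix n assume n: "n \<le> Suc m"
    show "(\<Sum>p\<in>I. \<Sum>q\<in>I. if l n p = l n q then 0 else \<sigma> p q + \<pi> p q)
        \<le> (\<Sum>c\<in>l n ` I. \<bar>\<Sum>p\<in>{p\<in>I. l n p = c}. a p - b p\<bar>)"
    proof (cases "n = Suc m")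
      case False
      then show ?thesis using n \<pi>_mass[of n] by (simp add: mass_eq diff)
    next
      \<comment> \<open>The recursive plan knows nothing of the finest level, so there the whole
        residual mass is counted as separated.\<close>
      case True
      have "(\<Sum>p\<in>I. \<Sum>q\<in>I. if ?l p = ?l q then 0 else \<pi> p q) \<le> (\<Sum>p\<in>I. \<Sum>q\<in>I. \<pi> p q)"
        using \<pi> by (intro sum_mono) auto
      also have "\<dots> = sum a' I" using \<pi>_row by (intro sum.cong) auto
      also have "\<dots> \<le> (\<Sum>c\<in>?l ` I. \<bar>A c - B c\<bar>)" by (rule residual)
      finally show ?thesis using True by (simp add: mass_eq A_def B_def sum_subtractf)
    qed
  qed (use \<sigma> \<pi> \<pi>_row \<pi>_col in \<open>auto simp: sum.distrib a'_def b'_def\<close>)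
qed

section \<open>Dyadic cells and their geometry\<close>

text \<open>The dyadic cell of level \<open>n\<close> of the cube $[-h,h)^d$ containing \<open>y\<close>, as a vector of
  integers in $\{0,\dots,2^n-1\}$.\<close>

definition dyadic :: "real \<Rightarrow> nat \<Rightarrow> 'a::euclidean_space \<Rightarrow> 'a \<Rightarrow> int" where
  "dyadic h n y = (\<lambda>b\<in>Basis. \<lfloor>2 ^ n * ((y \<bullet> b + h) / (2 * h))\<rfloor>)"

definition cells :: "nat \<Rightarrow> ('a::euclidean_space \<Rightarrow> int) set" where
  "cells n = Basis \<rightarrow>\<^sub>E {0..<2 ^ n}"

text \<open>Acts on labels rather than points, because \<open>tree_coupling\<close> is applied to
  the finite set of labels of the finest level; dropping \<open>k\<close> binary digits in each
  coordinate moves \<open>k\<close> levels up.\<close>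

definition coarsen :: "nat \<Rightarrow> ('a::euclidean_space \<Rightarrow> int) \<Rightarrow> 'a \<Rightarrow> int" where
  "coarsen k Q = (\<lambda>b\<in>Basis. Q b div 2 ^ k)"

lemma finite_cells: "finite (cells n)"
  by (simp add: cells_def finite_PiE)

lemma card_cells: "card (cells n :: ('a::euclidean_space \<Rightarrow> int) set) = 2 ^ (n * DIM('a))"
  by (simp add: cells_def card_PiE nat_power_eq power_mult)

text \<open>The strict bound keeps each rescaled coordinate in \<open>[0, 1)\<close>, off the upper
  face of the half-open cube. This is why the cube is later taken with half-width
  \<open>r + 1\<close>.\<close>

lemma dyadic_in_cells:
  assumes "norm y < h"
  shows "dyadic h n y \<in> cells n"
  unfolding dyadic_def cells_def
proof (rule restrict_PiE_iff[THEN iffD2], intro ballI)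
  fix b :: 'a assume "b \<in> Basis"
  then have "\<bar>y \<bullet> b\<bar> < h" using Basis_le_norm[of b y] assms by linarith
  then have "0 \<le> (y \<bullet> b + h) / (2 * h)" "(y \<bullet> b + h) / (2 * h) < 1" by (auto simp: divide_simps abs_less_iff)
  then have "0 \<le> 2 ^ n * ((y \<bullet> b + h) / (2 * h))" "2 ^ n * ((y \<bullet> b + h) / (2 * h)) < 2 ^ n * 1"
    by (intro mult_nonneg_nonneg mult_strict_left_mono; simp)+
  then show "\<lfloor>2 ^ n * ((y \<bullet> b + h) / (2 * h))\<rfloor> \<in> {0..<2 ^ n}"
    by (auto simp: floor_less_iff)
qed

lemma coarsen_dyadic:
  assumes "n \<le> m"
  shows "coarsen (m - n) (dyadic h m y) = dyadic h n y"
proof -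
  have "\<lfloor>2 ^ m * u\<rfloor> div 2 ^ (m - n) = \<lfloor>2 ^ n * u\<rfloor>" for u :: real
  proof -
    have "\<lfloor>2 ^ m * u / real_of_int (2 ^ (m - n))\<rfloor> = \<lfloor>2 ^ m * u\<rfloor> div 2 ^ (m - n)"
      by (rule floor_divide_real_eq_div) auto
    moreover have "(2::real) ^ m = 2 ^ n * 2 ^ (m - n)" using assms by (simp add: power_add[symmetric])
    then have "2 ^ m * u / real_of_int (2 ^ (m - n)) = 2 ^ n * u" by simp
    ultimately show ?thesis by simp
  qed
  then show ?thesis
    by (auto simp: coarsen_def dyadic_def restrict_def fun_eq_iff simp del: times_divide_eq_right)
qed

lemma coarsen_in_cells:
  assumes "n \<le> m" "Q \<in> cells m"
  shows "coarsen (m - n) Q \<in> cells n"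
  unfolding coarsen_def cells_def
proof (rule restrict_PiE_iff[THEN iffD2], intro ballI)
  fix b :: 'a assume "b \<in> Basis"
  then have "0 \<le> Q b" "Q b < 2 ^ m" using assms by (auto simp: cells_def PiE_iff)
  moreover have "(2::int) ^ m = 2 ^ n * 2 ^ (m - n)" using assms by (simp add: power_add[symmetric])
  moreover have "2 ^ n * 2 ^ (m - n) \<le> Q b" if "2 ^ n \<le> Q b div 2 ^ (m - n)"
  proof -
    have "2 ^ n * 2 ^ (m - n) \<le> Q b div 2 ^ (m - n) * 2 ^ (m - n)"
      by (rule mult_right_mono[OF that]) auto
    also have "\<dots> \<le> Q b"
    proof -
      have "0 \<le> Q b mod 2 ^ (m - n)" by simp
      then show ?thesis using div_mult_mod_eq[of "Q b" "2 ^ (m - n)"] by linarith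
    qed
    finally show ?thesis .
  qed
  ultimately show "Q b div 2 ^ (m - n) \<in> {0..<2 ^ n}"
    by (auto simp: pos_imp_zdiv_nonneg_iff not_le[symmetric])
qed

lemma coarsen_refine:
  assumes "n < m" "coarsen (m - Suc n) Q = coarsen (m - Suc n) Q'"
  shows "coarsen (m - n) Q = coarsen (m - n) Q'"
proof -
  have "Suc (m - Suc n) = m - n" using assms by simp
  then have "coarsen (m - n) Q = (\<lambda>b\<in>Basis. coarsen (m - Suc n) Q b div 2)" for Q :: "'a \<Rightarrow> int"
    by (auto simp: coarsen_def restrict_def fun_eq_iff simp flip: zdiv_zmult2_eq power_Suc2)
  then show ?thesis using assms(2) by simp
qed

lemma dyadic_diameter:
  fixes x y :: "'a::euclidean_space" and h :: real
  assumes "dyadic h n x = dyadic h n y" "0 < h"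
  shows "(norm (x - y))\<^sup>2 \<le> DIM('a) * (2 * h)\<^sup>2 / 4 ^ n"
proof -
  have b: "((x - y) \<bullet> b)\<^sup>2 \<le> (2 * h / 2 ^ n)\<^sup>2" if "b \<in> Basis" for b
  proof -
    define u where "u z = 2 ^ n * ((z \<bullet> b + h) / (2 * h))" for z
    have "\<lfloor>u x\<rfloor> = \<lfloor>u y\<rfloor>"
      using fun_cong[OF assms(1), of b] that by (simp add: dyadic_def u_def)
    then have "\<bar>u x - u y\<bar> \<le> 1" by linarith
    then have "\<bar>u x - u y\<bar> * (2 * h / 2 ^ n) \<le> 1 * (2 * h / 2 ^ n)"
      using assms(2) by (intro mult_right_mono) auto
    also have "\<bar>u x - u y\<bar> * (2 * h / 2 ^ n) = \<bar>(u x - u y) * (2 * h / 2 ^ n)\<bar>"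
      using assms(2) by (simp add: abs_mult)
    also have "(u x - u y) * (2 * h / 2 ^ n) = (x - y) \<bullet> b"
      using assms(2) by (simp add: u_def field_simps inner_diff_left)
    finally have "\<bar>(x - y) \<bullet> b\<bar> \<le> \<bar>2 * h / 2 ^ n\<bar>" using assms(2) by simp
    then show ?thesis by (simp only: abs_le_square_iff)
  qed
  have "(norm (x - y))\<^sup>2 = (\<Sum>b\<in>Basis. ((x - y) \<bullet> b)\<^sup>2)"
    by (simp only: power2_norm_eq_inner, subst euclidean_inner, simp only: power2_eq_square)
  also have "\<dots> \<le> (\<Sum>b\<in>(Basis :: 'a set). (2 * h / 2 ^ n)\<^sup>2)"
    by (intro sum_mono b)
  also have "\<dots> = DIM('a) * (2 * h)\<^sup>2 / 4 ^ n"
  proof -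
    have "((2::real) ^ n)\<^sup>2 = 4 ^ n" by (simp add: power2_eq_square power_mult_distrib[symmetric])
    then show ?thesis by (simp only: sum_constant power_divide times_divide_eq_right)
  qed
  finally show ?thesis .
qed

text \<open>Two points that first separate at level \<open>n\<close> share a cell at level
  \<open>n - 1\<close>, whose squared diameter is four times that of level \<open>n\<close>; this is
  the factor 4 before the sum. Level 0 is a single cell and never separates.\<close>

lemma dist_dyadic_le:
  fixes x y :: "'a::euclidean_space" and h :: real
  assumes "norm x < h" "norm y < h"
  shows "(norm (x - y))\<^sup>2 \<le> DIM('a) * (2 * h)\<^sup>2 * (1 / 4 ^ m
    + 4 * (\<Sum>n=1..m. (if dyadic h n x = dyadic h n y then 0 else 1) / 4 ^ n))"
proof (induction m)
  have h: "0 < h" using assms(1) norm_ge_zero[of x] by linarith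
  case 0
  have "dyadic h 0 z = (\<lambda>b\<in>Basis. 0)" if "norm z < h" for z :: 'a
    using dyadic_in_cells[OF that, of 0] by (auto simp: cells_def PiE_def extensional_def fun_eq_iff Pi_iff)
  then show ?case using dyadic_diameter[of h 0 x y] assms h by simp
next
  have h: "0 < h" using assms(1) norm_ge_zero[of x] by linarith
  case (Suc m)
  show ?case
  proof (cases "dyadic h (Suc m) x = dyadic h (Suc m) y")
    case True
    have "(norm (x - y))\<^sup>2 \<le> DIM('a) * (2 * h)\<^sup>2 * (1 / 4 ^ Suc m + 0)"
      using dyadic_diameter[OF True h] by simp
    also have "\<dots> \<le> DIM('a) * (2 * h)\<^sup>2 * (1 / 4 ^ Suc m
        + 4 * (\<Sum>n=1..Suc m. (if dyadic h n x = dyadic h n y then 0 else 1) / 4 ^ n))"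
      by (intro mult_left_mono add_left_mono mult_nonneg_nonneg sum_nonneg) auto
    finally show ?thesis .
  next
    case False
    have "(1::real) / 4 ^ m = 4 * (1 / 4 ^ Suc m)" "0 \<le> (1::real) / 4 ^ Suc m" by simp_all
    moreover have "(\<Sum>n=1..Suc m. (if dyadic h n x = dyadic h n y then 0 else 1) / (4::real) ^ n)
      = (\<Sum>n=1..m. (if dyadic h n x = dyadic h n y then 0 else 1) / 4 ^ n) + 1 / 4 ^ Suc m"
      using False by simp
    ultimately have "1 / 4 ^ m + 4 * (\<Sum>n=1..m. (if dyadic h n x = dyadic h n y then 0 else 1) / 4 ^ n)
        \<le> 1 / 4 ^ Suc m + 4 * (\<Sum>n=1..Suc m. (if dyadic h n x = dyadic h n y then 0 else 1) / (4::real) ^ n)"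
      by linarith
    then have "DIM('a) * (2 * h)\<^sup>2 * (1 / 4 ^ m + 4 * (\<Sum>n=1..m. (if dyadic h n x = dyadic h n y then 0 else 1) / 4 ^ n))
        \<le> DIM('a) * (2 * h)\<^sup>2 * (1 / 4 ^ Suc m + 4 * (\<Sum>n=1..Suc m. (if dyadic h n x = dyadic h n y then 0 else 1) / 4 ^ n))"
      by (rule mult_left_mono) auto
    with Suc show ?thesis by (rule order_trans)
  qed
qed

lemma (in prob_space) expectation_le_sqrt:
  fixes f :: "'a \<Rightarrow> real"
  assumes [measurable]: "f \<in> borel_measurable M" and sq: "integrable M (\<lambda>x. (f x)\<^sup>2)"
  shows "integrable M f" and "expectation (\<lambda>x. \<bar>f x\<bar>) \<le> sqrt (expectation (\<lambda>x. (f x)\<^sup>2))"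
proof -
  show int: "integrable M f"
  proof (rule Bochner_Integration.integrable_bound)
    show "integrable M (\<lambda>x. 1 + (f x)\<^sup>2)" using sq by simp
    have "\<bar>f x\<bar> \<le> 1 + (f x)\<^sup>2" for x
      using sum_squares_bound[of 1 "\<bar>f x\<bar>"] by simp
    then show "AE x in M. norm (f x) \<le> norm (1 + (f x)\<^sup>2)"
      by (intro AE_I2) (auto intro: order_trans[OF _ abs_ge_self])
  qed simp
  have "(expectation (\<lambda>x. \<bar>f x\<bar>))\<^sup>2 \<le> expectation (\<lambda>x. (f x)\<^sup>2)"
    using variance_eq[of "\<lambda>x. \<bar>f x\<bar>"] variance_positive[of "\<lambda>x. \<bar>f x\<bar>"] int sq by simp
  then show "expectation (\<lambda>x. \<bar>f x\<bar>) \<le> sqrt (expectation (\<lambda>x. (f x)\<^sup>2))"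
    by (rule real_le_rsqrt)
qed

lemma dyadic_eq_iff:
  "dyadic h n x = dyadic h n y \<longleftrightarrow> (\<forall>b\<in>Basis. \<lfloor>2 ^ n * ((x \<bullet> b + h) / (2 * h))\<rfloor> = \<lfloor>2 ^ n * ((y \<bullet> b + h) / (2 * h))\<rfloor>)"
  by (auto simp: dyadic_def restrict_def fun_eq_iff)

text \<open>A nonempty cell is described through a representative by finitely many equations between
  measurable floors, which avoids a sigma-algebra on the labels.\<close>

lemma borel_dyadic_cell[measurable]: "{y :: 'a::euclidean_space. dyadic h n y = c} \<in> sets borel"
proof (cases "\<exists>y0 :: 'a. dyadic h n y0 = c")
  case True
  then obtain y0 :: 'a where "dyadic h n y0 = c" by blast
  then have "{y. dyadic h n y = c} = {y \<in> space borel. \<forall>b\<in>Basis.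
      \<lfloor>2 ^ n * ((y \<bullet> b + h) / (2 * h))\<rfloor> = \<lfloor>2 ^ n * ((y0 \<bullet> b + h) / (2 * h))\<rfloor>}"
    unfolding dyadic_eq_iff[symmetric] by auto
  also have "\<dots> \<in> sets borel" by measurable
  finally show ?thesis .
qed auto

lemma pred_dyadic_eq:
  fixes X Y :: "'b \<Rightarrow> 'a::euclidean_space"
  assumes [measurable]: "X \<in> borel_measurable M" "Y \<in> borel_measurable M"
  shows "Measurable.pred M (\<lambda>a. dyadic h n (X a) = dyadic h n (Y a))"
  unfolding dyadic_eq_iff by measurable

definition discrepancy :: "real \<Rightarrow> nat \<Rightarrow> nat \<Rightarrow> (nat \<Rightarrow> 'a::euclidean_space) \<Rightarrow> 'a measure \<Rightarrow> real" where
  "discrepancy h n N x \<mu> =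
     (\<Sum>c\<in>cells n. \<bar>card {i. i < N \<and> dyadic h n (x i) = c} / N - measure \<mu> {y. dyadic h n y = c}\<bar>)"

lemma sum_card_fibres:
  fixes N :: nat
  assumes "finite I" "\<And>i. i < N \<Longrightarrow> f i \<in> I"
  shows "(\<Sum>p\<in>{p\<in>I. P p}. card {i. i < N \<and> f i = p}) = card {i. i < N \<and> P (f i)}"
proof -
  have "(\<Sum>p\<in>{p\<in>I. P p}. \<Sum>i\<in>{i. i \<in> {i. i < N \<and> P (f i)} \<and> f i = p}. 1) = (\<Sum>i\<in>{i. i < N \<and> P (f i)}. 1::nat)"
    using assms by (intro sum.group) auto
  moreover have "{i. i \<in> {i. i < N \<and> P (f i)} \<and> f i = p} = {i. i < N \<and> f i = p}" if "P p" for p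
    using that by auto
  ultimately show ?thesis by simp
qed

lemma (in prob_space) sum_measure_fibres:
  assumes "finite I" "AE y in M. f y \<in> I" "\<And>p. p \<in> I \<Longrightarrow> {y \<in> space M. f y = p} \<in> sets M"
    "{y \<in> space M. P (f y)} \<in> sets M"
  shows "(\<Sum>p\<in>{p\<in>I. P p}. measure M {y \<in> space M. f y = p}) = measure M {y \<in> space M. P (f y)}"
proof -
  have "(\<Sum>p\<in>{p\<in>I. P p}. measure M {y \<in> space M. f y = p}) = measure M (\<Union>p\<in>{p\<in>I. P p}. {y \<in> space M. f y = p})"
    using assms by (intro finite_measure_finite_Union[symmetric]) (auto simp: disjoint_family_on_def)
  also have "\<dots> = measure M {y \<in> space M. P (f y)}"
    using assms by (intro finite_measure_eq_AE) (auto intro!: sets.finite_UN)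
  finally show ?thesis .
qed

section \<open>From a plan between cells to a plan between sample indices and the law\<close>

context
  fixes \<mu> :: "'a::euclidean_space measure" and h :: real and N :: nat
  assumes prob: "prob_space \<mu>" and sets: "sets \<mu> = sets borel" and h: "AE y in \<mu>. norm y < h" and N: "0 < N"
begin

interpretation U: prob_space "uniform_count_measure {..<N}" by (rule prob_space_uniform_index[OF N])
interpretation \<mu>: prob_space \<mu> by (rule prob)
interpretation pair_prob_space "uniform_count_measure {..<N}" \<mu> ..

lemma space_mu: "space \<mu> = UNIV"
  using sets_eq_imp_space_eq[OF sets] by simp

lemma AE_in_cells: "AE y in \<mu>. dyadic h n y \<in> cells n"
  using h by eventually_elim (rule dyadic_in_cells)

lemma sum_cell_measure:
  assumes "n \<le> m"
  shows "(\<Sum>p\<in>{p\<in>cells m. coarsen (m - n) p = c}. measure \<mu> {y. dyadic h m y = p}) = measure \<mu> {y. dyadic h n y = c}"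
  using \<mu>.sum_measure_fibres[OF finite_cells AE_in_cells, of m "\<lambda>p. coarsen (m - n) p = c"] assms
  by (simp add: space_mu sets coarsen_dyadic borel_dyadic_cell)

lemma sum_cell_measure_1: "(\<Sum>p\<in>cells m. measure \<mu> {y. dyadic h m y = p}) = 1"
  using \<mu>.sum_measure_fibres[OF finite_cells AE_in_cells, of m "\<lambda>_. True"] \<mu>.prob_space
  by (simp add: space_mu sets borel_dyadic_cell)

text \<open>The first marginal is the index measure rather than the empirical measure, so that the
  plan built from the initial data can later be evaluated along whole trajectories.\<close>

lemma dyadic_plan:
  fixes x :: "nat \<Rightarrow> 'a"
  assumes x: "\<And>i. i < N \<Longrightarrow> norm (x i) < h"
  obtains \<kappa> :: "(nat \<times> 'a) measure" where
    "prob_space \<kappa>" "fst \<in> \<kappa> \<rightarrow>\<^sub>M uniform_count_measure {..<N}" "snd \<in> borel_measurable \<kappa>"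
    "distr \<kappa> (uniform_count_measure {..<N}) fst = uniform_count_measure {..<N}" "distr \<kappa> borel snd = \<mu>"
    "integrable \<kappa> (\<lambda>a. (norm (x (fst a) - snd a))\<^sup>2)"
    "(\<integral>a. (norm (x (fst a) - snd a))\<^sup>2 \<partial>\<kappa>)
      \<le> DIM('a) * (2 * h)\<^sup>2 * (1 / 4 ^ m + 4 * (\<Sum>n=1..m. discrepancy h n N x \<mu> / 4 ^ n))"
proof -
  let ?U = "uniform_count_measure {..<N}" and ?I = "cells m :: ('a \<Rightarrow> int) set"
  define lab where "lab = (dyadic h m :: 'a \<Rightarrow> _)"
  define a where "a p = card {i. i < N \<and> lab (x i) = p} / N" for p
  define b where "b p = measure \<mu> {y. lab y = p}" for p
  define l where "l n p = coarsen (m - n) p" for n and p :: "'a \<Rightarrow> int"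
  have [measurable_cong]: "sets \<mu> = sets borel" by (rule sets)
  have lab_in: "lab (x i) \<in> ?I" if "i < N" for i
    unfolding lab_def using x[OF that] by (rule dyadic_in_cells)
  have l_lab: "l n (lab y) = dyadic h n y" if "n \<le> m" for n y
    unfolding l_def lab_def using that by (rule coarsen_dyadic)
  \<comment> \<open>Summing the finest masses over the descendants of a level-\<open>n\<close> cell
    gives the mass of that cell; with \<open>bsum\<close> this turns the bound of
    \<open>tree_coupling\<close> into \<open>discrepancy\<close>.\<close>
  have asum: "(\<Sum>p\<in>{p\<in>?I. l n p = c}. a p) = card {i. i < N \<and> dyadic h n (x i) = c} / N" if "n \<le> m" for n c
    using sum_card_fibres[OF finite_cells lab_in, where P = "\<lambda>p. l n p = c"] that
    by (simp add: a_def sum_divide_distrib[symmetric] of_nat_sum[symmetric] l_lab del: of_nat_sum)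
  have bsum: "(\<Sum>p\<in>{p\<in>?I. l n p = c}. b p) = measure \<mu> {y. dyadic h n y = c}" if "n \<le> m" for n c
    unfolding b_def l_def lab_def using that by (rule sum_cell_measure)
  have "sum a ?I = 1"
    using sum_card_fibres[OF finite_cells lab_in, where P = "\<lambda>p. True"] N
    by (simp add: a_def sum_divide_distrib[symmetric] of_nat_sum[symmetric] del: of_nat_sum)
  then have ab: "sum a ?I = sum b ?I"
    using sum_cell_measure_1[of m] by (simp add: b_def lab_def)
  have a0: "0 \<le> a p" and b0: "0 \<le> b p" for p by (auto simp: a_def b_def)
  have l0: "l 0 p = l 0 q" if "p \<in> ?I" "q \<in> ?I" for p q
  proof -
    have "l 0 p = (\<lambda>b\<in>Basis. 0)" if "p \<in> ?I" for p
      using that by (auto simp: l_def coarsen_def cells_def PiE_iff restrict_def fun_eq_iff intro!: div_pos_pos_trivial)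
    then show ?thesis using that by simp
  qed
  have refine: "l n p = l n q" if "n < m" "l (Suc n) p = l (Suc n) q" for n p q
    using that unfolding l_def by (rule coarsen_refine)
  obtain \<pi> where \<pi>: "\<And>p q. p \<in> ?I \<Longrightarrow> q \<in> ?I \<Longrightarrow> 0 \<le> \<pi> p q"
    and row: "\<And>p. p \<in> ?I \<Longrightarrow> (\<Sum>q\<in>?I. \<pi> p q) = a p" and col: "\<And>q. q \<in> ?I \<Longrightarrow> (\<Sum>p\<in>?I. \<pi> p q) = b q"
    and mass: "\<And>n. n \<le> m \<Longrightarrow> (\<Sum>p\<in>?I. \<Sum>q\<in>?I. if l n p = l n q then 0 else \<pi> p q)
      \<le> (\<Sum>c\<in>l n ` ?I. \<bar>\<Sum>p\<in>{p\<in>?I. l n p = c}. a p - b p\<bar>)"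
    using tree_coupling[where I = ?I and a = a and b = b and m = m and l = l, OF finite_cells a0 b0 ab refine l0]
    by blast
  have disc: "(\<Sum>p\<in>?I. \<Sum>q\<in>?I. if l n p = l n q then 0 else \<pi> p q) \<le> discrepancy h n N x \<mu>" if n: "n \<le> m" for n
  proof -
    have "(\<Sum>c\<in>l n ` ?I. \<bar>\<Sum>p\<in>{p\<in>?I. l n p = c}. a p - b p\<bar>)
        \<le> (\<Sum>c\<in>cells n. \<bar>\<Sum>p\<in>{p\<in>?I. l n p = c}. a p - b p\<bar>)"
      using coarsen_in_cells[OF n] by (intro sum_mono2 finite_cells) (auto simp: l_def)
    also have "\<dots> = discrepancy h n N x \<mu>"
      unfolding discrepancy_def sum_subtractf asum[OF n] bsum[OF n] ..
    finally show ?thesis using mass[OF n] by simp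
  qed
  \<comment> \<open>A cell of zero mass carries nothing of the plan, so the divisions by
    \<open>a p\<close> and \<open>b q\<close> below do no harm.\<close>
  have \<pi>_a: "\<pi> p q = 0" if "p \<in> ?I" "q \<in> ?I" "a p = 0" for p q
    using row[OF that(1)] sum_nonneg_eq_0_iff[OF finite_cells, of m "\<lambda>q. \<pi> p q"] \<pi> that by metis
  have \<pi>_b: "\<pi> p q = 0" if "p \<in> ?I" "q \<in> ?I" "b q = 0" for p q
    using col[OF that(2)] sum_nonneg_eq_0_iff[OF finite_cells, of m "\<lambda>p. \<pi> p q"] \<pi> that by metis
  define A where "A p = {i. i < N \<and> lab (x i) = p}" for p
  define B where "B q = {y. lab y = q}" for q
  have [measurable]: "B q \<in> sets borel" "A p \<in> sets ?U" for p q
    by (auto simp: B_def A_def lab_def sets_uniform_count_measure)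
  have measA: "measure ?U (A p) = a p" for p
    by (subst measure_uniform_count_measure) (auto simp: A_def a_def)
  have measB: "measure \<mu> (B q) = b q" for q
    by (simp add: B_def b_def)
  \<comment> \<open>The discrete plan is spread uniformly relative to the product measure: the
    rectangle \<open>A p \<times> B q\<close> has product mass \<open>a p * b q\<close> and receives
    exactly \<open>\<pi> p q\<close>.\<close>
  define g where "g z = (\<Sum>p\<in>?I. \<Sum>q\<in>?I. \<pi> p q / (a p * b q) * (indicat_real (A p) (fst z) * indicat_real (B q) (snd z)))"
    for z :: "nat \<times> 'a"
  have g0: "0 \<le> g z" for z
    unfolding g_def using \<pi> a0 b0 by (intro sum_nonneg mult_nonneg_nonneg divide_nonneg_nonneg) auto
  have [measurable]: "g \<in> borel_measurable (?U \<Otimes>\<^sub>M \<mu>)"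
    unfolding g_def[abs_def] by measurable
  have indA: "(\<Sum>p\<in>?I. f p * indicat_real (A p) i) = f (lab (x i))" if "i < N" for f i
  proof -
    have "(\<Sum>p\<in>?I. f p * indicat_real (A p) i) = (\<Sum>p\<in>?I. if p = lab (x i) then f p else 0)"
      using that by (intro sum.cong) (auto simp: A_def indicator_def)
    then show ?thesis using lab_in[OF that] by (simp add: finite_cells)
  qed
  have G1: "(\<integral>\<^sup>+y. g (i, y) \<partial>\<mu>) = 1" if i: "i < N" for i
  proof -
    have int: "integrable \<mu> (\<lambda>y. \<pi> p q / (a p * b q) * (indicat_real (A p) i * indicat_real (B q) y))" for p q
      by (intro integrable_mult_right \<mu>.integrable_const_bound[where B = 1]) (auto simp: indicator_def)
    have "(\<integral>y. g (i, y) \<partial>\<mu>) = (\<Sum>p\<in>?I. \<Sum>q\<in>?I. \<pi> p q / (a p * b q) * (indicat_real (A p) i * b q))"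
      unfolding g_def using int by (simp add: measB)
    also have "\<dots> = (\<Sum>p\<in>?I. (\<Sum>q\<in>?I. \<pi> p q / a p) * indicat_real (A p) i)"
      unfolding sum_distrib_right using \<pi>_b by (intro sum.cong refl) auto
    also have "\<dots> = (\<Sum>q\<in>?I. \<pi> (lab (x i)) q / a (lab (x i)))"
      by (rule indA[OF i])
    also have "\<dots> = 1"
    proof -
      have "a (lab (x i)) \<noteq> 0"
        using i N by (auto simp: a_def card_eq_0_iff)
      then show ?thesis
        using row[OF lab_in[OF i]] by (simp add: sum_divide_distrib[symmetric])
    qed
    finally have "(\<integral>y. g (i, y) \<partial>\<mu>) = 1" .
    moreover have "integrable \<mu> (\<lambda>y. g (i, y))"
      unfolding g_def using int by simp
    ultimately show ?thesis
      using g0 by (simp add: nn_integral_eq_integral)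
  qed
  \<comment> \<open>On a cell of zero measure \<open>g\<close> vanishes and cannot integrate to one;
    such cells together form a null set.\<close>
  have "AE y in \<mu>. \<forall>q\<in>?I. b q = 0 \<longrightarrow> lab y \<noteq> q"
  proof (intro AE_finite_allI finite_cells)
    fix q
    have "AE y in \<mu>. lab y \<noteq> q" if "b q = 0"
    proof -
      have "B q \<in> \<mu>.events" by measurable
      then have "AE y in \<mu>. y \<notin> B q" using \<mu>.prob_eq_0[of "B q"] that by (simp add: measB)
      then show ?thesis by (simp add: B_def)
    qed
    then show "AE y in \<mu>. b q = 0 \<longrightarrow> lab y \<noteq> q" by simp
  qed
  moreover have "AE y in \<mu>. lab y \<in> ?I" unfolding lab_def by (rule AE_in_cells)
  ultimately have G2: "AE y in \<mu>. (\<integral>\<^sup>+i. g (i, y) \<partial>?U) = 1"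
  proof eventually_elim
    case (elim y)
    have indB: "(\<Sum>q\<in>?I. f q * indicat_real (B q) y) = f (lab y)" for f
    proof -
      have "(\<Sum>q\<in>?I. f q * indicat_real (B q) y) = (\<Sum>q\<in>?I. if q = lab y then f q else 0)"
        by (intro sum.cong) (auto simp: B_def indicator_def)
      then show ?thesis using elim(2) by (simp add: finite_cells)
    qed
    have "(\<Sum>i<N. g (i, y)) / N = (\<Sum>i<N. \<Sum>q\<in>?I. \<pi> (lab (x i)) q / (a (lab (x i)) * b q) * indicat_real (B q) y) / N"
    proof -
      have "g (i, y) = (\<Sum>q\<in>?I. \<pi> (lab (x i)) q / (a (lab (x i)) * b q) * indicat_real (B q) y)" if "i < N" for i
      proof -
        have "g (i, y) = (\<Sum>p\<in>?I. (\<Sum>q\<in>?I. \<pi> p q / (a p * b q) * indicat_real (B q) y) * indicat_real (A p) i)"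
          unfolding g_def sum_distrib_right by (intro sum.cong refl) (simp add: mult_ac)
        then show ?thesis by (simp only: indA[OF that])
      qed
      then show ?thesis by simp
    qed
    also have "\<dots> = (\<Sum>i<N. \<pi> (lab (x i)) (lab y) / (a (lab (x i)) * b (lab y))) / N"
      unfolding indB ..
    also have "(\<Sum>i<N. \<pi> (lab (x i)) (lab y) / (a (lab (x i)) * b (lab y)))
        = (\<Sum>i<N. \<Sum>p\<in>?I. \<pi> p (lab y) / (a p * b (lab y)) * indicat_real (A p) i)"
      by (intro sum.cong refl) (simp only: indA lessThan_iff)
    also have "\<dots> = (\<Sum>p\<in>?I. \<Sum>i<N. \<pi> p (lab y) / (a p * b (lab y)) * indicat_real (A p) i)"
      by (rule sum.swap)
    also have "\<dots> / N = (\<Sum>p\<in>?I. \<pi> p (lab y) / (a p * b (lab y)) * a p)"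
    proof -
      have "(\<Sum>i<N. indicat_real (A p) i) = a p * N" for p
      proof -
        have "(\<Sum>i<N. indicat_real (A p) i) = (\<Sum>i\<in>{..<N} \<inter> A p. 1)"
          by (simp add: indicator_def sum.If_cases)
        also have "{..<N} \<inter> A p = {i. i < N \<and> lab (x i) = p}" by (auto simp: A_def)
        finally show ?thesis using N by (simp add: a_def)
      qed
      then have "(\<Sum>i<N. k * indicat_real (A p) i) / N = k * a p" for k p
        using N by (simp add: sum_distrib_left[symmetric])
      then show ?thesis by (subst sum_divide_distrib) (intro sum.cong refl)
    qed
    also have "\<dots> = (\<Sum>p\<in>?I. \<pi> p (lab y) / b (lab y))"
      using \<pi>_a elim(2) by (intro sum.cong refl) auto
    also have "\<dots> = 1"
    proof -
      have "b (lab y) \<noteq> 0" using elim by blast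
      then show ?thesis using col[OF elim(2)] by (simp add: sum_divide_distrib[symmetric])
    qed
    finally show ?case
      using g0 N by (subst nn_integral_uniform_index) auto
  qed
  define \<kappa> where "\<kappa> = density (?U \<Otimes>\<^sub>M \<mu>) g"
  have [measurable_cong]: "sets \<kappa> = sets (?U \<Otimes>\<^sub>M \<mu>)" by (simp add: \<kappa>_def)
  have "AE i in ?U. (\<integral>\<^sup>+y. g (i, y) \<partial>\<mu>) = 1" using G1 by (simp add: AE_uniform_index)
  note rp = reweighted_product[OF U.prob_space_axioms prob \<open>g \<in> borel_measurable (?U \<Otimes>\<^sub>M \<mu>)\<close> this G2, folded \<kappa>_def]
  interpret \<kappa>: prob_space \<kappa> by (rule rp)
  have fst_meas: "fst \<in> \<kappa> \<rightarrow>\<^sub>M ?U" by (simp add: \<kappa>_def)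
  have snd_meas: "snd \<in> borel_measurable \<kappa>" by measurable
  have x_meas: "(\<lambda>a. x (fst a)) \<in> borel_measurable \<kappa>"
    by (rule measurable_compose[OF fst_meas]) simp
  have snd_distr: "distr \<kappa> borel snd = \<mu>"
    using rp(2) distr_cong[of \<kappa> \<kappa> \<mu> borel snd snd] sets by simp
  define D where "D n a = (if dyadic h n (x (fst a)) = dyadic h n (snd a) then 0 else 1 :: real)" for n and a :: "nat \<times> 'a"
  have D_pred: "Measurable.pred (?U \<Otimes>\<^sub>M \<mu>) (\<lambda>a. dyadic h n (x (fst a)) = dyadic h n (snd a))" for n
  proof -
    have "(\<lambda>a. x (fst a)) \<in> borel_measurable (?U \<Otimes>\<^sub>M \<mu>)"
      by (rule measurable_compose[OF measurable_fst]) simp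
    moreover have "snd \<in> borel_measurable (?U \<Otimes>\<^sub>M \<mu>)" by measurable
    ultimately show ?thesis by (rule pred_dyadic_eq)
  qed
  have D_meas[measurable]: "D n \<in> borel_measurable (?U \<Otimes>\<^sub>M \<mu>)" for n
    unfolding D_def[abs_def] using D_pred by (intro measurable_If measurable_const) (auto simp: pred_def)
  have D_int: "integrable \<kappa> (D n)" for n
  proof (rule \<kappa>.integrable_bounded[where B = 1])
    show "D n \<in> borel_measurable \<kappa>" using D_meas by (simp add: \<kappa>_def)
  qed (simp add: D_def)
  \<comment> \<open>Integrating \<open>D n\<close> gives the plan's mass on pairs of labels with
    different ancestors at level \<open>n\<close>. The conversion back to \<open>\<pi>\<close> is
    stated as an inequality, which also covers pairs with \<open>a p * b q = 0\<close>.\<close>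
  have D_le: "(\<integral>a. D n a \<partial>\<kappa>) \<le> discrepancy h n N x \<mu>" if n: "n \<le> m" for n
  proof -
    let ?w = "\<lambda>p q. if l n p = l n q then 0 else \<pi> p q / (a p * b q)"
    have rect: "integrable (?U \<Otimes>\<^sub>M \<mu>) (\<lambda>z. indicat_real (A p) (fst z) * indicat_real (B q) (snd z))"
      "(\<integral>z. indicat_real (A p) (fst z) * indicat_real (B q) (snd z) \<partial>(?U \<Otimes>\<^sub>M \<mu>)) = a p * b q" for p q
    proof -
      have eq: "(\<lambda>z. indicat_real (A p) (fst z) * indicat_real (B q) (snd z)) = indicat_real (A p \<times> B q)"
        by (auto simp: indicator_def fun_eq_iff)
      have [measurable]: "A p \<times> B q \<in> sets (?U \<Otimes>\<^sub>M \<mu>)" by measurable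
      have "emeasure (?U \<Otimes>\<^sub>M \<mu>) (A p \<times> B q) = emeasure ?U (A p) * emeasure \<mu> (B q)"
        by (rule \<mu>.emeasure_pair_measure_Times) measurable
      then have "measure (?U \<Otimes>\<^sub>M \<mu>) (A p \<times> B q) = a p * b q"
        by (simp add: measure_def enn2real_mult measA[symmetric] measB[symmetric])
      then show "(\<integral>z. indicat_real (A p) (fst z) * indicat_real (B q) (snd z) \<partial>(?U \<Otimes>\<^sub>M \<mu>)) = a p * b q"
        unfolding eq by simp
      show "integrable (?U \<Otimes>\<^sub>M \<mu>) (\<lambda>z. indicat_real (A p) (fst z) * indicat_real (B q) (snd z))"
        unfolding eq by (intro integrable_real_indicator) (auto simp: P.emeasure_finite less_top[symmetric])
    qed
    have "(\<integral>a. D n a \<partial>\<kappa>) = (\<integral>z. g z *\<^sub>R D n z \<partial>(?U \<Otimes>\<^sub>M \<mu>))"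
      unfolding \<kappa>_def using g0 by (intro integral_density) auto
    also have "\<dots> = (\<integral>z. (\<Sum>p\<in>?I. \<Sum>q\<in>?I. ?w p q * (indicat_real (A p) (fst z) * indicat_real (B q) (snd z))) \<partial>(?U \<Otimes>\<^sub>M \<mu>))"
    proof (intro Bochner_Integration.integral_cong refl)
      fix z :: "nat \<times> 'a"
      have "\<pi> p q / (a p * b q) * (indicat_real (A p) (fst z) * indicat_real (B q) (snd z)) * D n z
          = ?w p q * (indicat_real (A p) (fst z) * indicat_real (B q) (snd z))" for p q
        by (auto simp: D_def A_def B_def indicator_def l_lab[OF n, symmetric])
      then show "g z *\<^sub>R D n z = (\<Sum>p\<in>?I. \<Sum>q\<in>?I. ?w p q * (indicat_real (A p) (fst z) * indicat_real (B q) (snd z)))"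
        by (simp add: g_def sum_distrib_right)
    qed
    also have "\<dots> = (\<Sum>p\<in>?I. \<Sum>q\<in>?I. ?w p q * (a p * b q))"
      using rect by simp
    also have "\<dots> \<le> (\<Sum>p\<in>?I. \<Sum>q\<in>?I. if l n p = l n q then 0 else \<pi> p q)"
      using \<pi> by (intro sum_mono) auto
    also have "\<dots> \<le> discrepancy h n N x \<mu>" by (rule disc[OF n])
    finally show ?thesis .
  qed
  have snd_AE: "AE a in \<kappa>. norm (snd a) < h"
    using h unfolding snd_distr[symmetric] by (subst (asm) AE_distr_iff[OF snd_meas]) auto
  have fst_AE: "AE a in \<kappa>. norm (x (fst a)) < h"
    using x by (intro AE_I2) (auto simp: \<kappa>_def space_pair_measure space_uniform_count_measure)
  let ?c = "\<lambda>a. DIM('a) * (2 * h)\<^sup>2 * (1 / 4 ^ m + 4 * (\<Sum>n=1..m. D n a / 4 ^ n))"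
  have le: "AE a in \<kappa>. (norm (x (fst a) - snd a))\<^sup>2 \<le> ?c a"
    using snd_AE fst_AE by eventually_elim (unfold D_def, rule dist_dyadic_le)
  have int: "integrable \<kappa> (\<lambda>a. ?c a)"
    using D_int by (intro integrable_mult_right Bochner_Integration.integrable_add
        Bochner_Integration.integrable_sum integrable_divide) auto
  have "(\<integral>a. (norm (x (fst a) - snd a))\<^sup>2 \<partial>\<kappa>) \<le> (\<integral>a. ?c a \<partial>\<kappa>)"
  proof (intro integral_mono_AE' int le)
    show "AE a in \<kappa>. 0 \<le> ?c a"
      using le by eventually_elim (rule order_trans[OF zero_le_power2])
  qed
  also have "\<dots> = DIM('a) * (2 * h)\<^sup>2 * (1 / 4 ^ m + 4 * (\<Sum>n=1..m. (\<integral>a. D n a \<partial>\<kappa>) / 4 ^ n))"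
    using D_int by (simp add: \<kappa>.prob_space)
  also have "\<dots> \<le> DIM('a) * (2 * h)\<^sup>2 * (1 / 4 ^ m + 4 * (\<Sum>n=1..m. discrepancy h n N x \<mu> / 4 ^ n))"
    using D_le by (intro mult_left_mono add_left_mono sum_mono divide_right_mono) auto
  finally have cost: "(\<integral>a. (norm (x (fst a) - snd a))\<^sup>2 \<partial>\<kappa>)
      \<le> DIM('a) * (2 * h)\<^sup>2 * (1 / 4 ^ m + 4 * (\<Sum>n=1..m. discrepancy h n N x \<mu> / 4 ^ n))" .
  have "integrable \<kappa> (\<lambda>a. (norm (x (fst a) - snd a))\<^sup>2)"
  proof (rule Bochner_Integration.integrable_bound[OF int])
    show "(\<lambda>a. (norm (x (fst a) - snd a))\<^sup>2) \<in> borel_measurable \<kappa>"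
      using x_meas snd_meas by measurable
    show "AE a in \<kappa>. norm ((norm (x (fst a) - snd a))\<^sup>2)
        \<le> norm (?c a)"
      using le by eventually_elim (simp only: real_norm_def abs_power2 order_trans[OF _ abs_ge_self])
  qed
  from that[OF rp(3) fst_meas snd_meas rp(1) snd_distr this cost] show ?thesis .
qed

end

section \<open>Convergence rate of empirical measures\<close>

text \<open>The count is a sum of indicators; after centring, independence removes the mixed terms
  and leaves a variance of at most \<open>N * p\<close>. Keeping the factor \<open>p\<close> is what
  makes the later sum over many small cells affordable.\<close>

lemma (in prob_space) expected_frequency_deviation:
  fixes Y :: "nat \<Rightarrow> 'a \<Rightarrow> 'b::euclidean_space"
  assumes indep: "indep_vars (\<lambda>_. borel) Y {..<N}" and law: "\<And>i. i < N \<Longrightarrow> distr M borel (Y i) = \<mu>"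
    and [measurable]: "B \<in> sets borel" and N: "0 < N"
  shows "integrable M (\<lambda>\<omega>. \<bar>card {i. i < N \<and> Y i \<omega> \<in> B} / N - measure \<mu> B\<bar>)"
    and "expectation (\<lambda>\<omega>. \<bar>card {i. i < N \<and> Y i \<omega> \<in> B} / N - measure \<mu> B\<bar>) \<le> sqrt (measure \<mu> B / N)"
proof -
  define p where "p = measure \<mu> B"
  define Z where "Z i \<omega> = indicat_real B (Y i \<omega>) - p" for i \<omega>
  have Y[measurable]: "Y i \<in> borel_measurable M" if "i < N" for i
    using indep that by (auto simp: indep_vars_def)
  have Z_meas: "Z i \<in> borel_measurable M" if "i < N" for i
    using Y[OF that] unfolding Z_def[abs_def] by measurable
  have p: "0 \<le> p" "p \<le> 1"
  proof -
    have "prob_space \<mu>" using law[OF N] prob_space_distr[OF Y[OF N]] by simp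
    then show "0 \<le> p" "p \<le> 1" by (auto simp: p_def intro: prob_space.prob_le_1)
  qed
  have Z_bd: "\<bar>Z i \<omega>\<bar> \<le> 1" for i \<omega>
    using p by (auto simp: Z_def indicator_def)
  have E_ind: "expectation (\<lambda>\<omega>. indicat_real B (Y i \<omega>)) = p" if "i < N" for i
  proof -
    have "expectation (\<lambda>\<omega>. indicat_real B (Y i \<omega>)) = (\<integral>y. indicat_real B y \<partial>distr M borel (Y i))"
      using Y[OF that] by (intro integral_distr[symmetric]) auto
    also have "\<dots> = measure (distr M borel (Y i)) B" by simp
    finally show ?thesis unfolding law[OF that] p_def .
  qed
  have int_ind: "integrable M (\<lambda>\<omega>. indicat_real B (Y i \<omega>))" if "i < N" for i
    using Y[OF that] by (intro integrable_bounded[where B = 1]) (auto simp: indicator_def)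
  have EZ: "expectation (Z i) = 0" if "i < N" for i
    using E_ind[OF that] int_ind[OF that] unfolding Z_def[abs_def] by (simp add: prob_space)
  have intZZ: "integrable M (\<lambda>\<omega>. Z i \<omega> * Z j \<omega>)" if "i < N" "j < N" for i j
    using Z_meas that Z_bd by (intro integrable_bounded[where B = "1 * 1"]) (auto simp: abs_mult intro!: mult_le_one)
  have EZZ: "expectation (\<lambda>\<omega>. Z i \<omega> * Z j \<omega>) = 0" if "i < N" "j < N" "i \<noteq> j" for i j
  proof -
    have "indep_vars (\<lambda>_. borel) (\<lambda>i \<omega>. indicat_real B (Y i \<omega>) - p) {..<N}"
      by (rule indep_vars_compose2[OF indep]) auto
    then have "indep_vars (\<lambda>_. borel) Z {..<N}" unfolding Z_def .
    then have ij: "indep_vars (\<lambda>_. borel) Z {i, j}" by (rule indep_vars_subset) (use that in auto)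
    have "integrable M (Z k)" if "k \<in> {i, j}" for k
      using that \<open>i < N\<close> \<open>j < N\<close> Z_meas Z_bd by (intro integrable_bounded[where B = 1]) auto
    then have "(\<integral>\<omega>. (\<Prod>k\<in>{i, j}. Z k \<omega>) \<partial>M) = (\<Prod>k\<in>{i, j}. expectation (Z k))"
      by (intro indep_vars_lebesgue_integral ij) auto
    then show ?thesis using that EZ by simp
  qed
  have EZ2: "expectation (\<lambda>\<omega>. Z i \<omega> * Z i \<omega>) \<le> p" if "i < N" for i
  proof -
    have "Z i \<omega> * Z i \<omega> = (1 - 2 * p) * indicat_real B (Y i \<omega>) + p * p" for \<omega>
      by (simp add: Z_def indicator_def algebra_simps)
    then have "expectation (\<lambda>\<omega>. Z i \<omega> * Z i \<omega>) = (1 - 2 * p) * p + p * p"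
      using E_ind[OF that] int_ind[OF that] by (simp add: prob_space)
    also have "\<dots> = p - p * p" by (simp add: algebra_simps)
    also have "\<dots> \<le> p" by simp
    finally show ?thesis .
  qed
  define S where "S \<omega> = (\<Sum>i<N. Z i \<omega>)" for \<omega>
  have S_meas: "S \<in> borel_measurable M"
    unfolding S_def[abs_def] using Z_meas by (intro borel_measurable_sum) auto
  have S_bd: "\<bar>S \<omega>\<bar> \<le> N" for \<omega>
  proof -
    have "\<bar>S \<omega>\<bar> \<le> (\<Sum>i<N. \<bar>Z i \<omega>\<bar>)" unfolding S_def by (rule sum_abs)
    also have "\<dots> \<le> (\<Sum>i<N. 1)" by (intro sum_mono Z_bd)
    finally show ?thesis by simp
  qed
  have S_sq_int: "integrable M (\<lambda>\<omega>. (S \<omega>)\<^sup>2)"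
  proof (rule integrable_bounded)
    show "(\<lambda>\<omega>. (S \<omega>)\<^sup>2) \<in> borel_measurable M" using S_meas by measurable
    show "norm ((S \<omega>)\<^sup>2) \<le> (real N)\<^sup>2" for \<omega>
      using power_mono[OF S_bd[of \<omega>] abs_ge_zero, of 2] by simp
  qed
  have sq: "(S \<omega>)\<^sup>2 = (\<Sum>i<N. \<Sum>j<N. Z i \<omega> * Z j \<omega>)" for \<omega>
    by (simp add: S_def power2_eq_square sum_product)
  have "expectation (\<lambda>\<omega>. (S \<omega>)\<^sup>2) = (\<Sum>i<N. \<Sum>j<N. expectation (\<lambda>\<omega>. Z i \<omega> * Z j \<omega>))"
    unfolding sq using intZZ
    by (subst Bochner_Integration.integral_sum; (intro sum.cong refl Bochner_Integration.integral_sum Bochner_Integration.integrable_sum)?) auto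
  also have "\<dots> \<le> (\<Sum>i<N. \<Sum>j<N. if i = j then p else 0)"
    using EZZ EZ2 by (intro sum_mono) auto
  also have "\<dots> = N * p" by simp
  finally have ES: "expectation (\<lambda>\<omega>. (S \<omega>)\<^sup>2) \<le> N * p" .
  have eq: "\<bar>card {i. i < N \<and> Y i \<omega> \<in> B} / N - measure \<mu> B\<bar> = \<bar>S \<omega>\<bar> / N" for \<omega>
  proof -
    have "(\<Sum>i<N. indicat_real B (Y i \<omega>)) = (\<Sum>i\<in>{..<N} \<inter> {i. Y i \<omega> \<in> B}. 1)"
      by (simp add: indicator_def sum.If_cases)
    also have "{..<N} \<inter> {i. Y i \<omega> \<in> B} = {i. i < N \<and> Y i \<omega> \<in> B}" by auto
    finally have "S \<omega> = card {i. i < N \<and> Y i \<omega> \<in> B} - N * p"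
      by (simp add: S_def Z_def sum_subtractf)
    then have "card {i. i < N \<and> Y i \<omega> \<in> B} / N - p = S \<omega> / N" using N by (simp add: field_simps)
    then show ?thesis by (simp add: p_def)
  qed
  note ES_sqrt = expectation_le_sqrt[OF S_meas S_sq_int]
  show "integrable M (\<lambda>\<omega>. \<bar>card {i. i < N \<and> Y i \<omega> \<in> B} / N - measure \<mu> B\<bar>)"
    unfolding eq using ES_sqrt(1) by auto
  have "expectation (\<lambda>\<omega>. \<bar>S \<omega>\<bar>) \<le> sqrt (N * p)"
    using ES_sqrt(2) real_sqrt_le_mono[OF ES] by (rule order_trans)
  then have "expectation (\<lambda>\<omega>. \<bar>S \<omega>\<bar> / N) \<le> sqrt (N * p) / N"
    by (simp add: divide_right_mono)
  also have "\<dots> = sqrt (p / N)"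
    using N by (simp add: real_sqrt_mult real_sqrt_divide field_simps)
  finally show "expectation (\<lambda>\<omega>. \<bar>card {i. i < N \<and> Y i \<omega> \<in> B} / N - measure \<mu> B\<bar>) \<le> sqrt (measure \<mu> B / N)"
    by (simp add: eq p_def)
qed

text \<open>Cauchy-Schwarz over the \<open>2 ^ (n * d)\<close> cells, whose masses add up to
  one.\<close>

lemma (in prob_space) expected_discrepancy:
  fixes Y :: "nat \<Rightarrow> 'a \<Rightarrow> 'b::euclidean_space"
  assumes indep: "indep_vars (\<lambda>_. borel) Y {..<N}" and law: "\<And>i. i < N \<Longrightarrow> distr M borel (Y i) = \<mu>" and N: "0 < N"
    and h: "AE y in \<mu>. norm y < h"
  shows "integrable M (\<lambda>\<omega>. discrepancy h n N (\<lambda>i. Y i \<omega>) \<mu>)"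
    and "expectation (\<lambda>\<omega>. discrepancy h n N (\<lambda>i. Y i \<omega>) \<mu>) \<le> sqrt (2 ^ (n * DIM('b)) / N)"
proof -
  let ?p = "\<lambda>c. measure \<mu> {y. dyadic h n y = c}" and ?C = "cells n :: ('b \<Rightarrow> int) set"
  have sets: "sets \<mu> = sets borel" using law[OF N] by auto
  have prob: "prob_space \<mu>"
    using prob_space_distr[of "Y 0" borel] indep law[OF N] N by (auto simp: indep_vars_def)
  have eq: "discrepancy h n N (\<lambda>i. Y i \<omega>) \<mu> = (\<Sum>c\<in>?C. \<bar>card {i. i < N \<and> Y i \<omega> \<in> {y. dyadic h n y = c}} / N - ?p c\<bar>)" for \<omega>
    by (simp add: discrepancy_def)
  note dev = expected_frequency_deviation[OF indep law borel_dyadic_cell N]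
  show "integrable M (\<lambda>\<omega>. discrepancy h n N (\<lambda>i. Y i \<omega>) \<mu>)"
    unfolding eq by (intro Bochner_Integration.integrable_sum dev(1)) auto
  have "expectation (\<lambda>\<omega>. discrepancy h n N (\<lambda>i. Y i \<omega>) \<mu>)
      = (\<Sum>c\<in>?C. expectation (\<lambda>\<omega>. \<bar>card {i. i < N \<and> Y i \<omega> \<in> {y. dyadic h n y = c}} / N - ?p c\<bar>))"
    unfolding eq by (intro Bochner_Integration.integral_sum dev(1)) auto
  also have "\<dots> \<le> (\<Sum>c\<in>?C. sqrt (?p c / N))"
    by (intro sum_mono dev(2)) auto
  also have "\<dots> \<le> sqrt (2 ^ (n * DIM('b)) / N)"
  proof (rule real_le_rsqrt)
    have "(\<Sum>c\<in>?C. sqrt (?p c / N))\<^sup>2 \<le> (\<Sum>c\<in>?C. (sqrt (?p c / N))\<^sup>2) * card ?C"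
      by (intro sum_squared_le_sum_of_squares finite_cells)
    also have "(\<Sum>c\<in>?C. (sqrt (?p c / N))\<^sup>2) = (\<Sum>c\<in>?C. ?p c) / N"
      by (simp add: sum_divide_distrib)
    also have "(\<Sum>c\<in>?C. ?p c) = 1"
      by (rule sum_cell_measure_1[OF prob sets h N])
    finally show "(\<Sum>c\<in>?C. sqrt (?p c / N))\<^sup>2 \<le> 2 ^ (n * DIM('b)) / N"
      by (simp add: card_cells)
  qed
  finally show "expectation (\<lambda>\<omega>. discrepancy h n N (\<lambda>i. Y i \<omega>) \<mu>) \<le> sqrt (2 ^ (n * DIM('b)) / N)" .
qed

section \<open>Geometric sums and the choice of the finest level\<close>

lemma sum_power_le:
  fixes r :: real
  assumes "0 \<le> r" "r < 1"
  shows "(\<Sum>n=1..m. r ^ n) \<le> 1 / (1 - r)"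
proof -
  have "(\<Sum>n=1..m. r ^ n) \<le> (\<Sum>n\<le>m. r ^ n)"
    using assms by (intro sum_mono2) auto
  also have "\<dots> = (1 - r ^ Suc m) / (1 - r)"
    using assms by (subst sum_gp0) auto
  also have "\<dots> \<le> 1 / (1 - r)" using assms by (intro divide_right_mono) auto
  finally show ?thesis .
qed

lemma sum_power_gt_1_le:
  fixes r :: real
  assumes "1 < r"
  shows "(\<Sum>n=1..m. r ^ n) \<le> r ^ m * (r / (r - 1))"
proof (induction m)
  case 0
  then show ?case using assms by simp
next
  case (Suc m)
  have "(\<Sum>n=1..Suc m. r ^ n) \<le> r ^ m * (r / (r - 1)) + r ^ Suc m" using Suc by simp
  also have "\<dots> = r ^ Suc m * (r / (r - 1))" using assms by (simp add: field_simps)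
  finally show ?case .
qed

text \<open>The summands are a geometric progression of ratio \<open>sqrt (2 ^ d) / 4\<close> over
  \<open>sqrt N\<close>. The ratio is below, equal to or above one according to
  \<open>d < 4\<close>, \<open>d = 4\<close>, \<open>d > 4\<close>, which is where the three regimes
  come from. The level \<open>m\<close> may depend on \<open>N\<close>, the constant may
  not.\<close>

lemma dyadic_rate:
  fixes d :: nat
  shows "\<exists>C\<ge>0. \<forall>N\<ge>2. \<exists>m. 1 / 4 ^ m + 4 * (\<Sum>n=1..m. sqrt (2 ^ (n * d) / real N) / 4 ^ n) \<le> C * (chaos_rate d N)\<^sup>2"
proof -
  have summand: "sqrt (2 ^ (n * d) / real N) / 4 ^ n = (sqrt (2 ^ d) / 4) ^ n / sqrt N" for n N :: nat
  proof -
    have "sqrt (2 ^ (n * d)) = sqrt (2 ^ d) ^ n"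
      by (simp add: power_mult real_sqrt_power mult.commute[of n d])
    then show ?thesis by (simp add: real_sqrt_divide power_divide)
  qed
  have pw: "(real N powr (- 1 / 4))\<^sup>2 = 1 / sqrt N" if "2 \<le> N" for N :: nat
  proof -
    have "(real N powr (- 1 / 4))\<^sup>2 = real N powr (- (1 / 2))"
      by (simp add: power2_eq_square powr_add[symmetric])
    also have "\<dots> = inverse (sqrt N)"
      by (simp only: powr_minus powr_half_sqrt of_nat_0_le_iff)
    finally show ?thesis by (simp only: inverse_eq_divide)
  qed
  have sqrt_le: "sqrt N \<le> N" if "2 \<le> N" for N :: nat
    using that by (intro real_le_lsqrt) (auto simp: power2_eq_square)
  consider "d < 4" | "d = 4" | "4 < d" by linarith
  then show ?thesis
  proof cases
    case 1
    \<comment> \<open>The ratio for \<open>d = 3\<close>, which dominates those of smaller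
      dimensions. Since the sum converges, the crude level \<open>m = N\<close> suffices to bring
      \<open>1 / 4 ^ m\<close> below \<open>1 / sqrt N\<close>.\<close>
    define r where "r = sqrt 8 / 4"
    have r: "0 \<le> r" "r < 1" by (auto simp: r_def intro!: real_less_lsqrt)
    have "(2::real) ^ d \<le> 2 ^ 3" using 1 by (intro power_increasing) auto
    then have dr: "sqrt (2 ^ d) / 4 \<le> r" by (simp add: r_def)
    show ?thesis
    proof (intro exI[of _ "1 + 4 / (1 - r)"] conjI allI impI)
      show "0 \<le> 1 + 4 / (1 - r)" using r by simp
      fix N :: nat assume N: "2 \<le> N"
      have "(\<Sum>n=1..N. sqrt (2 ^ (n * d) / real N) / 4 ^ n) \<le> (\<Sum>n=1..N. r ^ n / sqrt N)"
        unfolding summand using dr by (intro sum_mono divide_right_mono power_mono) auto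
      also have "\<dots> \<le> 1 / (1 - r) / sqrt N"
        unfolding sum_divide_distrib[symmetric] by (intro divide_right_mono sum_power_le r) auto
      finally have s: "(\<Sum>n=1..N. sqrt (2 ^ (n * d) / real N) / 4 ^ n) \<le> 1 / (1 - r) / sqrt N" .
      have "real N < 2 ^ N" by (rule of_nat_less_two_power)
      also have "(2::real) ^ N \<le> 4 ^ N" by (rule power_mono) auto
      finally have "real N \<le> 4 ^ N" by simp
      then have "1 / 4 ^ N \<le> 1 / sqrt N"
        by (intro frac_le order_trans[OF sqrt_le[OF N]]) (use N in simp_all)
      with s have "1 / 4 ^ N + 4 * (\<Sum>n=1..N. sqrt (2 ^ (n * d) / real N) / 4 ^ n)
          \<le> 1 / sqrt N + 4 * (1 / (1 - r) / sqrt N)" by linarith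
      also have "\<dots> = (1 + 4 / (1 - r)) * (1 / sqrt N)" by (simp add: add_divide_distrib)
      also have "1 / sqrt N = (chaos_rate d N)\<^sup>2"
        using 1 by (simp only: chaos_rate_def if_True pw[OF N])
      finally show "\<exists>m. 1 / 4 ^ m + 4 * (\<Sum>n=1..m. sqrt (2 ^ (n * d) / real N) / 4 ^ n)
          \<le> (1 + 4 / (1 - r)) * (chaos_rate d N)\<^sup>2" by blast
    qed
  next
    case 2
    show ?thesis
    \<comment> \<open>\<open>9 = 1 + 4 * 2\<close>: the diameter term costs one unit of
      \<open>ln N / ln 2\<close>, the \<open>k + 1\<close> equal summands at most two, both because
      \<open>ln N / ln 2\<close> is at least one for \<open>2 \<le> N\<close>.\<close>
    proof (intro exI[of _ "9 / ln 2"] conjI allI impI)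
      show "0 \<le> 9 / ln (2::real)" by simp
      fix N :: nat assume N: "2 \<le> N"
      obtain k where k: "2 ^ k \<le> N" "N < 2 ^ (k + 1)" using ex_power_ivl1[of 2 N] N by auto
      have one: "1 \<le> ln N / ln 2" using N by simp
      have "k * ln 2 \<le> ln N"
      proof -
        have "real (2 ^ k) \<le> real N" using k(1) by (simp only: of_nat_le_iff)
        then have "ln (2 ^ k) \<le> ln (real N)" using N by (subst ln_le_cancel_iff) auto
        then show ?thesis by (simp add: ln_realpow)
      qed
      then have "real k \<le> ln N / ln 2" by (simp add: pos_le_divide_eq)
      then have "real k + 1 \<le> 2 * (ln N / ln 2)" using one by linarith
      then have m: "real (k + 1) \<le> 2 * (ln N / ln 2)" unfolding of_nat_add of_nat_1 .
      have "sqrt ((2::real) ^ d) = 4" using 2 by (simp add: real_sqrt_unique)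
      then have "(\<Sum>n=1..k+1. sqrt (2 ^ (n * d) / real N) / 4 ^ n) = real (k + 1) / sqrt N"
        unfolding summand by simp
      also have "\<dots> \<le> 2 * (ln N / ln 2) / sqrt N" using m by (intro divide_right_mono) auto
      finally have s: "(\<Sum>n=1..k+1. sqrt (2 ^ (n * d) / real N) / 4 ^ n) \<le> 2 * (ln N / ln 2) / sqrt N" .
      have "real N \<le> real (2 ^ (k + 1))" using k(2) by (simp only: of_nat_le_iff)
      also have "\<dots> = 2 ^ (k + 1)" by simp
      also have "\<dots> \<le> (4::real) ^ (k + 1)" by (rule power_mono) auto
      finally have "real N \<le> 4 ^ (k + 1)" .
      then have "1 / 4 ^ (k + 1) \<le> 1 / sqrt N"
        by (intro frac_le order_trans[OF sqrt_le[OF N]]) (use N in simp_all)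
      also have "\<dots> \<le> (ln N / ln 2) / sqrt N" using one by (intro divide_right_mono) auto
      finally have "1 / 4 ^ (k + 1) + 4 * (\<Sum>n=1..k+1. sqrt (2 ^ (n * d) / real N) / 4 ^ n)
          \<le> (ln N / ln 2) / sqrt N + 4 * (2 * (ln N / ln 2) / sqrt N)" using s by linarith
      also have "\<dots> = 9 / ln 2 * (1 / sqrt N * ln N)" by simp
      also have "1 / sqrt N * ln N = (chaos_rate d N)\<^sup>2"
      proof -
        have rate: "chaos_rate d N = real N powr (- 1 / 4) * sqrt (ln N)" using 2 by (simp add: chaos_rate_def)
        show ?thesis unfolding rate power_mult_distrib pw[OF N] using N by simp
      qed
      finally show "\<exists>m. 1 / 4 ^ m + 4 * (\<Sum>n=1..m. sqrt (2 ^ (n * d) / real N) / 4 ^ n)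
          \<le> 9 / ln 2 * (chaos_rate d N)\<^sup>2" by blast
    qed
  next
    case 3
    define r where "r = sqrt (2 ^ d) / 4"
    have "(2::real) ^ 4 < 2 ^ d" using 3 by (intro power_strict_increasing) auto
    then have "4 < sqrt (2 ^ d)" by (intro real_less_rsqrt) simp
    then have r: "1 < r" by (simp add: r_def)
    \<comment> \<open>The first factor collects the diameter term and the sum, which is dominated by
      its last term. The final 4 is the loss from rounding the level:
      \<open>N < (2 ^ d) ^ (m + 1)\<close> gives \<open>1 / 4 ^ m\<close> at most 4 times the
      squared rate.\<close>
    define C where "C = (1 + 4 * (r / (r - 1))) * 4"
    show ?thesis
    proof (intro exI[of _ C] conjI allI impI)
      show "0 \<le> C" using r by (simp add: C_def)
      fix N :: nat assume N: "2 \<le> N"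
      have "(2::nat) ^ 1 \<le> 2 ^ d" using 3 by (intro power_increasing) auto
      then obtain m where m: "(2 ^ d) ^ m \<le> N" "N < (2 ^ d) ^ (m + 1)" using ex_power_ivl1[of "2 ^ d" N] N by auto
      have "real ((2 ^ d) ^ m) \<le> real N" using m(1) by (simp only: of_nat_le_iff)
      then have "sqrt ((2 ^ d) ^ m) \<le> sqrt N" by simp
      then have rm: "r ^ m / sqrt N \<le> 1 / 4 ^ m"
        using N by (simp add: r_def power_divide real_sqrt_power[symmetric] field_simps)
      have s: "(\<Sum>n=1..m. sqrt (2 ^ (n * d) / real N) / 4 ^ n) \<le> 1 / 4 ^ m * (r / (r - 1))"
      proof -
        have "(\<Sum>n=1..m. sqrt (2 ^ (n * d) / real N) / 4 ^ n) = (\<Sum>n=1..m. r ^ n) / sqrt N"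
          unfolding summand r_def by (simp add: sum_divide_distrib)
        also have "\<dots> \<le> r ^ m * (r / (r - 1)) / sqrt N"
          by (intro divide_right_mono sum_power_gt_1_le r) auto
        also have "\<dots> = r ^ m / sqrt N * (r / (r - 1))" by simp
        also have "\<dots> \<le> 1 / 4 ^ m * (r / (r - 1))" using rm r by (intro mult_right_mono) auto
        finally show ?thesis .
      qed
      have "real N \<le> real ((2 ^ d) ^ (m + 1))" using m(2) by (simp only: of_nat_le_iff)
      also have "\<dots> = 2 powr (real d * (real m + 1))"
        by (simp add: powr_realpow[symmetric] power_mult[symmetric] powr_powr distrib_left powr_add)
      finally have "real N powr (2 / d) \<le> (2 powr (real d * (real m + 1))) powr (2 / d)"
        by (intro powr_mono2) auto
      also have "\<dots> = 2 powr (2 * (real m + 1))" using 3 by (simp add: powr_powr mult.commute)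
      also have "\<dots> = 4 * 4 ^ m"
        by (simp add: powr_add powr_powr[symmetric] powr_realpow distrib_left)
      finally have "real N powr (2 / d) \<le> 4 * 4 ^ m" .
      then have "1 / 4 ^ m \<le> 4 * (1 / real N powr (2 / d))"
        using N by (simp add: field_simps)
      also have "1 / real N powr (2 / d) = (chaos_rate d N)\<^sup>2"
        using 3 by (simp add: chaos_rate_def power2_eq_square powr_add[symmetric] powr_minus_divide[symmetric])
      finally have q: "1 / 4 ^ m \<le> 4 * (chaos_rate d N)\<^sup>2" .
      have "1 / 4 ^ m + 4 * (\<Sum>n=1..m. sqrt (2 ^ (n * d) / real N) / 4 ^ n) \<le> (1 + 4 * (r / (r - 1))) * (1 / 4 ^ m)"
      proof -
        have "1 / 4 ^ m + 4 * (\<Sum>n=1..m. sqrt (2 ^ (n * d) / real N) / 4 ^ n) \<le> 1 / 4 ^ m + 4 * (1 / 4 ^ m * (r / (r - 1)))"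
          using s by linarith
        also have "\<dots> = (1 + 4 * (r / (r - 1))) * (1 / 4 ^ m)"
          unfolding distrib_right mult_1 by (simp only: mult_ac)
        finally show ?thesis .
      qed
      also have "\<dots> \<le> (1 + 4 * (r / (r - 1))) * (4 * (chaos_rate d N)\<^sup>2)"
        using q r by (intro mult_left_mono) auto
      also have "\<dots> = C * (chaos_rate d N)\<^sup>2" by (simp add: C_def)
      finally show "\<exists>m. 1 / 4 ^ m + 4 * (\<Sum>n=1..m. sqrt (2 ^ (n * d) / real N) / 4 ^ n) \<le> C * (chaos_rate d N)\<^sup>2"
        by blast
    qed
  qed
qed

section \<open>The McKean--Vlasov flow\<close>

lemma continuous_on_Max_image:
  fixes f :: "'i \<Rightarrow> 'a::topological_space \<Rightarrow> real"
  assumes "finite I" "I \<noteq> {}" "\<And>i. i \<in> I \<Longrightarrow> continuous_on S (f i)"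
  shows "continuous_on S (\<lambda>x. Max ((\<lambda>i. f i x) ` I))"
  using assms
proof (induction I rule: finite_ne_induct)
  case (insert i I)
  then show ?case by (auto intro!: continuous_intros)
qed auto

text \<open>The maximum over the particles is continuous but not differentiable, so each particle is
  integrated separately and Gronwall is applied to the maximum in integral form. The constant
  \<open>k\<close> absorbs a forcing term into the unknown.\<close>

lemma max_gronwall:
  fixes p :: "nat \<Rightarrow> real \<Rightarrow> 'a::euclidean_space"
  assumes N: "0 < N" and "0 \<le> b"
    and der: "\<And>i s. i < N \<Longrightarrow> s \<in> {0..T} \<Longrightarrow> (p i has_vector_derivative p' i s) (at s within {0..T})"
    and bound: "\<And>i s. i < N \<Longrightarrow> s \<in> {0..T} \<Longrightarrow> norm (p' i s) \<le> b * (k + Max ((\<lambda>j. norm (p j s)) ` {..<N}))"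
    and init: "\<And>i. i < N \<Longrightarrow> norm (p i 0) \<le> a"
    and i: "i < N" and t: "t \<in> {0..T}"
  shows "k + norm (p i t) \<le> (k + a) * exp (b * t)"
proof -
  define u where "u s = k + Max ((\<lambda>j. norm (p j s)) ` {..<N})" for s
  have ne: "{..<N} \<noteq> {}" using N by auto
  have "continuous_on {0..T} (p j)" if "j < N" for j
    using der[OF that] has_vector_derivative_continuous continuous_on_eq_continuous_within by blast
  then have cont: "continuous_on {0..T} u"
    unfolding u_def using ne by (intro continuous_intros continuous_on_Max_image) auto
  have le: "u t \<le> (k + a) + b * integral {0..t} u" if t: "t \<in> {0..T}" for t
  proof -
    have sub: "{0..t} \<subseteq> {0..T}" using t by auto
    have "norm (p j t) \<le> a + b * integral {0..t} u" if j: "j < N" for j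
    proof -
      have "(p' j has_integral (p j t - p j 0)) {0..t}"
        using t by (intro fundamental_theorem_of_calculus)
          (auto intro: has_vector_derivative_within_subset[OF der[OF j] sub])
      moreover have u_int: "u integrable_on {0..t}"
        by (intro integrable_continuous_real continuous_on_subset[OF cont sub])
      ultimately have "norm (p j t - p j 0) \<le> integral {0..t} (\<lambda>s. b * u s)"
      proof -
        assume p': "(p' j has_integral (p j t - p j 0)) {0..t}" and u_int: "u integrable_on {0..t}"
        have "norm (integral {0..t} (p' j)) \<le> integral {0..t} (\<lambda>s. b * u s)"
        proof (rule integral_norm_bound_integral)
          show "p' j integrable_on {0..t}" using p' by (rule has_integral_integrable)
          show "(\<lambda>s. b * u s) integrable_on {0..t}" using u_int by (rule integrable_on_mult_right)
          show "norm (p' j s) \<le> b * u s" if "s \<in> {0..t}" for s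
            unfolding u_def using sub that by (intro bound j) auto
        qed
        then show ?thesis using integral_unique[OF p'] by simp
      qed
      then have "norm (p j t - p j 0) \<le> b * integral {0..t} u" by simp
      then show ?thesis
        using norm_triangle_ineq[of "p j t - p j 0" "p j 0"] init[OF j] by simp
    qed
    then have "Max ((\<lambda>j. norm (p j t)) ` {..<N}) \<le> a + b * integral {0..t} u"
      using ne by (intro Max.boundedI) auto
    then show ?thesis by (simp add: u_def)
  qed
  have "norm (p i t) \<le> Max ((\<lambda>j. norm (p j t)) ` {..<N})"
    using i by (intro Max_ge) auto
  then show ?thesis
    using gronwall[OF cont \<open>0 \<le> b\<close> le t] by (simp add: u_def)
qed

locale mean_field_attention = attention_params \<rho> \<Theta> D
  for \<rho> :: "('d::finite, 'k::finite) param measure" and \<Theta> D +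
  fixes F :: "real^'d \<Rightarrow> real^'d" and LF T r :: real and \<mu>0 :: "(real^'d) measure"
  assumes F_lipschitz: "\<And>x y. norm (F x - F y) \<le> LF * norm (x - y)"
    and LF: "0 \<le> LF" and T: "0 < T" and r: "0 \<le> r"
    and prob_\<mu>0: "prob_space \<mu>0" and sets_\<mu>0: "sets \<mu>0 = sets borel" and supp_\<mu>0: "AE y in \<mu>0. norm y \<le> r"
begin

text \<open>Attention contributes \<open>D\<close>, the perceptron its Lipschitz constant and its
  value at 0; the latter can be counted as a rate because \<open>norm_field_le\<close> works with
  radii of at least one.\<close>

definition A :: real where "A = D + LF + norm (F 0)"

text \<open>A priori radius at time \<open>T\<close>: one plus the largest norm grows at rate at
  most \<open>A\<close>, starting from \<open>1 + r\<close>.\<close>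

definition R :: real where "R = (1 + r) * exp (A * T)"

definition L :: real where "L = attn_lip D R + LF"

definition field :: "(real^'d) measure \<Rightarrow> real^'d \<Rightarrow> real^'d" where
  "field \<nu> x = attention_field \<rho> \<nu> x + F x"

lemma A_nonneg: "0 \<le> A"
  using D_nonneg LF by (simp add: A_def)

lemma R_ge: "r \<le> R" "1 \<le> R"
proof -
  have "(1 + r) * 1 \<le> (1 + r) * exp (A * T)"
    using r T A_nonneg by (intro mult_left_mono) auto
  then have "1 + r \<le> R" by (simp only: R_def mult_1_right)
  then show "r \<le> R" "1 \<le> R" using r by simp_all
qed

lemma attn_lip_nonneg: "0 \<le> attn_lip D R'"
  using D_nonneg by (simp add: attn_lip_def)

lemma L_nonneg: "0 \<le> L"
  using attn_lip_nonneg LF by (simp add: L_def)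

context
  fixes \<kappa> :: "'c measure"
  assumes prob: "prob_space \<kappa>"
begin

lemma norm_field_le:
  assumes "Y \<in> borel_measurable \<kappa>" "\<And>a. a \<in> space \<kappa> \<Longrightarrow> norm (Y a) \<le> s" "norm x \<le> s" "1 \<le> s"
  shows "norm (field (distr \<kappa> borel Y) x) \<le> A * s"
proof -
  have "norm (F x) \<le> norm (F x - F 0) + norm (F 0)"
    using norm_triangle_ineq[of "F x - F 0" "F 0"] by simp
  also have "\<dots> \<le> LF * s + norm (F 0) * s"
    using F_lipschitz[of x 0] mult_left_mono[OF assms(3) LF] mult_left_mono[OF assms(4), of "norm (F 0)"] by simp
  finally have "norm (F x) \<le> LF * s + norm (F 0) * s" .
  with norm_attention_field_le[OF prob assms(1,2)]
  have "norm (attention_field \<rho> (distr \<kappa> borel Y) x) + norm (F x) \<le> D * s + (LF * s + norm (F 0) * s)"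
    by (intro add_mono) auto
  then show ?thesis
    unfolding field_def A_def by (intro order_trans[OF norm_triangle_ineq]) (simp add: algebra_simps)
qed

lemma field_lipschitz:
  assumes "Y \<in> borel_measurable \<kappa>" "\<And>a. a \<in> space \<kappa> \<Longrightarrow> norm (Y a) \<le> R'"
    and "Y' \<in> borel_measurable \<kappa>" "\<And>a. a \<in> space \<kappa> \<Longrightarrow> norm (Y' a) \<le> R'"
    and "norm x \<le> R'" "norm x' \<le> R'"
  shows "norm (field (distr \<kappa> borel Y) x - field (distr \<kappa> borel Y') x')
    \<le> (attn_lip D R' + LF) * (norm (x - x') + (\<integral>a. norm (Y a - Y' a) \<partial>\<kappa>))"
proof -
  let ?I = "\<integral>a. norm (Y a - Y' a) \<partial>\<kappa>"
  have "field (distr \<kappa> borel Y) x - field (distr \<kappa> borel Y') x'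
      = (attention_field \<rho> (distr \<kappa> borel Y) x - attention_field \<rho> (distr \<kappa> borel Y') x') + (F x - F x')"
    by (simp add: field_def)
  also have "norm \<dots> \<le> attn_lip D R' * (norm (x - x') + ?I) + LF * norm (x - x')"
    using attention_field_lipschitz[OF prob assms] F_lipschitz[of x x']
    by (intro order_trans[OF norm_triangle_ineq] add_mono) auto
  also have "\<dots> \<le> attn_lip D R' * (norm (x - x') + ?I) + LF * (norm (x - x') + ?I)"
    using LF by (intro add_left_mono mult_left_mono) auto
  finally show ?thesis by (simp add: distrib_right)
qed

text \<open>The Lipschitz constant depends on the radius, so continuity is local: around each
  \<open>x\<close> the ball is taken large enough to have \<open>x\<close> in its interior. The weak
  formulation needs the field on the whole space, not only where the flow goes.\<close>

lemma continuous_on_field: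
  assumes "Y \<in> borel_measurable \<kappa>" "\<And>a. a \<in> space \<kappa> \<Longrightarrow> norm (Y a) \<le> R'"
  shows "continuous_on UNIV (field (distr \<kappa> borel Y))"
proof (rule continuous_at_imp_continuous_on, rule ballI)
  fix x :: "real^'d"
  define c where "c = max R' (norm x + 1)"
  have "(attn_lip D c + LF)-lipschitz_on (cball 0 c) (field (distr \<kappa> borel Y))"
  proof (rule lipschitz_onI)
    fix u v :: "real^'d" assume uv: "u \<in> cball 0 c" "v \<in> cball 0 c"
    have "norm (Y a) \<le> c" if "a \<in> space \<kappa>" for a
      using assms(2)[OF that] by (simp add: c_def)
    then show "dist (field (distr \<kappa> borel Y) u) (field (distr \<kappa> borel Y) v) \<le> (attn_lip D c + LF) * dist u v"
      using field_lipschitz[OF assms(1) _ assms(1), of c u v] uv by (simp add: dist_norm)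
  qed (use attn_lip_nonneg LF in auto)
  then have "continuous_on (cball 0 c) (field (distr \<kappa> borel Y))"
    by (rule lipschitz_on_continuous_on)
  moreover have "norm x < c" unfolding c_def by linarith
  then have "x \<in> interior (cball 0 c)" by (simp add: interior_cball)
  ultimately show "isCont (field (distr \<kappa> borel Y)) x" by (rule continuous_on_interior)
qed

end

end

locale mean_field_flow = mean_field_attention \<rho> \<Theta> D F LF T r \<mu>0
  for \<rho> :: "('d::finite, 'k::finite) param measure" and \<Theta> D F LF T r \<mu>0 +
  fixes X :: "real \<Rightarrow> real^'d \<Rightarrow> real^'d"
  assumes X_bound: "\<And>t y. t \<in> {0..T} \<Longrightarrow> norm (X t y) \<le> R"
    and X_meas: "\<And>t. t \<in> {0..T} \<Longrightarrow> X t \<in> borel_measurable borel"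
    and X_time: "\<And>t s y. t \<in> {0..T} \<Longrightarrow> s \<in> {0..T} \<Longrightarrow> norm (X t y - X s y) \<le> A * R * \<bar>t - s\<bar>"
    and X_space: "\<And>t y y'. t \<in> {0..T} \<Longrightarrow> norm (X t y - X t y') \<le> exp (L * T) * norm (y - y')"
    and X_0: "\<And>y. norm y \<le> r \<Longrightarrow> X 0 y = y"
    and X_deriv: "\<And>t y. t \<in> {0..T} \<Longrightarrow>
      ((\<lambda>s. X s y) has_vector_derivative field (distr \<mu>0 borel (X t)) (X t y)) (at t within {0..T})"
    and X_field_cont: "continuous_on ({0..T} \<times> UNIV) (\<lambda>(t, y). field (distr \<mu>0 borel (X t)) (X t y))"

lemma (in mean_field_attention) flow_exists:
  "\<exists>X. mean_field_flow \<rho> \<Theta> D F LF T r \<mu>0 X"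
proof -
  interpret \<mu>0: prob_space \<mu>0 by (rule prob_\<mu>0)
  have meas: "Y \<in> borel_measurable borel \<Longrightarrow> Y \<in> borel_measurable \<mu>0" for Y :: "real^'d \<Rightarrow> real^'d"
    by (simp add: measurable_cong_sets[OF sets_\<mu>0 refl])
  obtain X where
    "\<And>t y. t \<in> {0..T} \<Longrightarrow> norm (X t y) \<le> R"
    "\<And>t y. t \<in> {0..T} \<Longrightarrow> X t \<in> borel_measurable borel"
    "\<And>t s y. t \<in> {0..T} \<Longrightarrow> s \<in> {0..T} \<Longrightarrow> norm (X t y - X s y) \<le> A * R * \<bar>t - s\<bar>"
    "\<And>t y y'. t \<in> {0..T} \<Longrightarrow> norm (X t y - X t y') \<le> exp (L * T) * norm (y - y')"
    "\<And>y. norm y \<le> r \<Longrightarrow> X 0 y = y"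
    "\<And>t y. t \<in> {0..T} \<Longrightarrow>
      ((\<lambda>s. X s y) has_vector_derivative field (distr \<mu>0 borel (X t)) (X t y)) (at t within {0..T})"
    "continuous_on ({0..T} \<times> UNIV) (\<lambda>(t, y). field (distr \<mu>0 borel (X t)) (X t y))"
  proof (rule mean_field_ode_solution[where b = "\<lambda>Y x. field (distr \<mu>0 borel Y) x" and A = A and L = L and r = r and R = R and T = T])
    show "prob_space \<mu>0" "sets \<mu>0 = sets borel" "0 < T" "0 \<le> A" "0 \<le> L" "0 \<le> r" "R = (1 + r) * exp (A * T)"
      using prob_\<mu>0 sets_\<mu>0 T A_nonneg L_nonneg r by (auto simp: R_def)
    show "norm (field (distr \<mu>0 borel Y) x) \<le> A * s"
      if "Y \<in> borel_measurable borel" "1 \<le> s" "\<And>y. norm (Y y) \<le> s" "norm x \<le> s" for Y x s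
      using that by (intro norm_field_le[OF prob_\<mu>0] meas)
    show "norm (field (distr \<mu>0 borel Y) x - field (distr \<mu>0 borel Y') x')
        \<le> L * (norm (x - x') + \<mu>0.expectation (\<lambda>y. norm (Y y - Y' y)))"
      if "Y \<in> borel_measurable borel" "Y' \<in> borel_measurable borel" "\<And>y. norm (Y y) \<le> R" "\<And>y. norm (Y' y) \<le> R"
        "norm x \<le> R" "norm x' \<le> R" for Y Y' x x'
      unfolding L_def using that by (intro field_lipschitz[OF prob_\<mu>0] meas)
  qed (rule that)
  then show ?thesis
    by (intro exI[of _ X] mean_field_flow.intro mean_field_flow_axioms.intro mean_field_attention_axioms)
qed

context mean_field_flow
begin

interpretation \<mu>0: prob_space \<mu>0 by (rule prob_\<mu>0)

definition law :: "real \<Rightarrow> (real^'d) measure" where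
  "law t = distr \<mu>0 borel (X t)"

lemma X_meas': "t \<in> {0..T} \<Longrightarrow> X t \<in> borel_measurable \<mu>0"
  using X_meas by (simp add: measurable_cong_sets[OF sets_\<mu>0 refl])

lemma law_0: "law 0 = \<mu>0"
proof -
  have "AE y in \<mu>0. X 0 y = id y" using supp_\<mu>0 by eventually_elim (simp add: X_0)
  moreover have "X 0 \<in> borel_measurable \<mu>0" using T by (intro X_meas') auto
  moreover have "id \<in> borel_measurable \<mu>0" by (simp add: measurable_cong_sets[OF sets_\<mu>0 refl])
  ultimately have "distr \<mu>0 borel (X 0) = distr \<mu>0 borel id"
    by (intro distr_cong_AE refl)
  also have "\<dots> = \<mu>0" unfolding id_def by (rule distr_id2) (simp add: sets_\<mu>0)
  finally show ?thesis by (simp add: law_def)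
qed

lemma law_P2:
  assumes "t \<in> {0..T}"
  shows "law t \<in> P2"
proof -
  have [measurable]: "X t \<in> borel_measurable \<mu>0" using assms by (rule X_meas')
  have "integrable \<mu>0 (\<lambda>y. (norm (X t y))\<^sup>2)"
    using X_bound[OF assms] by (intro \<mu>0.integrable_bounded[where B = "R\<^sup>2"]) (auto intro: power_mono)
  then show ?thesis
    by (auto simp: P2_def law_def integrable_distr_eq intro: \<mu>0.prob_space_distr)
qed

text \<open>The laws at two times are coupled by the common starting point, so the Lipschitz bound
  of the flow in time carries over to the Wasserstein distance.\<close>

lemma law_continuous: "continuous_P2_curve T law"
  unfolding continuous_P2_curve_def
proof (intro ballI conjI law_P2)
  fix t assume t: "t \<in> {0..T}"
  show "((\<lambda>s. wasserstein2 (law s) (law t)) \<longlongrightarrow> 0) (at t within {0..T})"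
  proof (rule tendsto_sandwich)
    have "wasserstein2 (law s) (law t) \<le> A * R * \<bar>s - t\<bar>" "0 \<le> wasserstein2 (law s) (law t)"
      if s: "s \<in> {0..T}" for s
    proof -
      have m: "X s \<in> borel_measurable \<mu>0" "X t \<in> borel_measurable \<mu>0" using s t by (auto intro: X_meas')
      have sq: "(norm (X s y - X t y))\<^sup>2 \<le> (A * R * \<bar>s - t\<bar>)\<^sup>2" for y
        using X_time[OF s t] by (intro power_mono) auto
      have "integrable \<mu>0 (\<lambda>y. (norm (X s y - X t y))\<^sup>2)"
        using m sq by (intro \<mu>0.integrable_bounded[where B = "(A * R * \<bar>s - t\<bar>)\<^sup>2"]) auto
      then have "(\<integral>y. (norm (X s y - X t y))\<^sup>2 \<partial>\<mu>0) \<le> (\<integral>y. (A * R * \<bar>s - t\<bar>)\<^sup>2 \<partial>\<mu>0)"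
        using sq by (intro integral_mono) auto
      then have "sqrt (\<integral>y. (norm (X s y - X t y))\<^sup>2 \<partial>\<mu>0) \<le> sqrt ((A * R * \<bar>s - t\<bar>)\<^sup>2)"
        by (intro real_sqrt_le_mono) (simp add: \<mu>0.prob_space)
      then show "wasserstein2 (law s) (law t) \<le> A * R * \<bar>s - t\<bar>"
        using wasserstein2_distr_le[OF m] A_nonneg R_ge by (simp add: law_def)
      show "0 \<le> wasserstein2 (law s) (law t)"
        unfolding law_def using m by (rule wasserstein2_distr_nonneg)
    qed
    then show "\<forall>\<^sub>F s in at t within {0..T}. 0 \<le> wasserstein2 (law s) (law t)"
      "\<forall>\<^sub>F s in at t within {0..T}. wasserstein2 (law s) (law t) \<le> A * R * \<bar>s - t\<bar>"
      by (auto simp: eventually_at_filter)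
    have "((\<lambda>s. A * R * \<bar>s - t\<bar>) \<longlongrightarrow> A * R * \<bar>t - t\<bar>) (at t within {0..T})"
      by (intro tendsto_intros)
    then show "((\<lambda>s. A * R * \<bar>s - t\<bar>) \<longlongrightarrow> 0) (at t within {0..T})" by simp
  qed auto
qed

section \<open>The image laws solve the weak equation\<close>

context
  fixes \<phi> :: "real^'d \<Rightarrow> real" and g :: "real^'d \<Rightarrow> real^'d"
  assumes test: "test_function \<phi> g"
begin

text \<open>By the chain rule, the time derivative of \<open>\<phi>\<close> along the trajectory
  started at \<open>y\<close>.\<close>

definition rate_along :: "real \<Rightarrow> real^'d \<Rightarrow> real" where
  "rate_along s y = g (X s y) \<bullet> field (law s) (X s y)"

lemma g_cont: "continuous_on UNIV g" and \<phi>_deriv: "(\<phi> has_derivative (\<lambda>h. g x \<bullet> h)) (at x)"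
  using test by (auto simp: test_function_def)

lemma g_bound: "\<exists>B\<ge>0. \<forall>x. norm x \<le> R \<longrightarrow> norm (g x) \<le> B"
proof -
  have "compact (g ` cball 0 R)"
    by (intro compact_continuous_image continuous_on_subset[OF g_cont]) auto
  then obtain B where "\<forall>y\<in>g ` cball 0 R. norm y \<le> B"
    using compact_imp_bounded bounded_iff by blast
  then show ?thesis by (intro exI[of _ "max 0 B"]) (auto simp: le_max_iff_disj)
qed

lemma rate_along_bound: "\<exists>B. \<forall>s\<in>{0..T}. \<forall>y. \<bar>rate_along s y\<bar> \<le> B"
proof -
  obtain B where B: "0 \<le> B" "\<And>x. norm x \<le> R \<Longrightarrow> norm (g x) \<le> B" using g_bound by blast
  have "\<bar>rate_along s y\<bar> \<le> B * (A * R)" if s: "s \<in> {0..T}" for s y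
  proof -
    have "\<bar>rate_along s y\<bar> \<le> norm (g (X s y)) * norm (field (law s) (X s y))"
      unfolding rate_along_def by (rule Cauchy_Schwarz_ineq2)
    also have "\<dots> \<le> B * (A * R)"
      unfolding law_def using B X_bound[OF s] R_ge X_meas'[OF s]
      by (intro mult_mono norm_field_le[OF prob_\<mu>0]) auto
    finally show ?thesis .
  qed
  then show ?thesis by blast
qed

lemma rate_along_cont: "continuous_on ({0..T} \<times> UNIV) (\<lambda>(s, y). rate_along s y)"
proof -
  have X_cont: "continuous_on ({0..T} \<times> UNIV) (\<lambda>z. X (fst z) (snd z))"
  proof (rule continuous_on_two_lipschitz[where a = "A * R" and b = "exp (L * T)"])
    fix z z' :: "real \<times> (real^'d)" assume z: "z \<in> {0..T} \<times> UNIV" "z' \<in> {0..T} \<times> UNIV"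
    have "norm (X (fst z) (snd z) - X (fst z') (snd z'))
        \<le> norm (X (fst z) (snd z) - X (fst z') (snd z)) + norm (X (fst z') (snd z) - X (fst z') (snd z'))"
      using norm_triangle_ineq[of "X (fst z) (snd z) - X (fst z') (snd z)" "X (fst z') (snd z) - X (fst z') (snd z')"]
      by simp
    also have "\<dots> \<le> A * R * \<bar>fst z - fst z'\<bar> + exp (L * T) * norm (snd z - snd z')"
      using z by (intro add_mono X_time X_space) auto
    finally show "dist (X (fst z) (snd z)) (X (fst z') (snd z')) \<le> A * R * dist (fst z) (fst z') + exp (L * T) * dist (snd z) (snd z')"
      by (simp add: dist_norm)
  qed (use A_nonneg R_ge in auto)
  show ?thesis
    using X_field_cont unfolding split_beta rate_along_def law_def
    by (intro continuous_intros continuous_on_compose2[OF g_cont X_cont]) auto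
qed

lemma flux_integrable:
  assumes t: "t \<in> {0..T}"
  shows "integrable (law t) (\<lambda>x. g x \<bullet> field (law t) x)"
    and "(\<integral>x. g x \<bullet> field (law t) x \<partial>law t) = (\<integral>y. rate_along t y \<partial>\<mu>0)"
proof -
  have m: "X t \<in> borel_measurable \<mu>0" by (rule X_meas'[OF t])
  have "continuous_on UNIV (\<lambda>x. g x \<bullet> field (law t) x)"
    unfolding law_def using X_bound[OF t] by (intro continuous_intros g_cont continuous_on_field[OF prob_\<mu>0 m])
  then have gm[measurable]: "(\<lambda>x. g x \<bullet> field (law t) x) \<in> borel_measurable borel"
    by (rule borel_measurable_continuous_onI)
  obtain B where "\<And>y. \<bar>rate_along t y\<bar> \<le> B" using rate_along_bound t by blast
  then have "integrable \<mu>0 (\<lambda>y. g (X t y) \<bullet> field (law t) (X t y))"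
    using measurable_compose[OF m gm] unfolding rate_along_def
    by (intro \<mu>0.integrable_bounded[where B = B]) auto
  then show "integrable (law t) (\<lambda>x. g x \<bullet> field (law t) x)"
    by (subst (1) law_def) (simp add: integrable_distr_eq[OF m gm])
  show "(\<integral>x. g x \<bullet> field (law t) x \<partial>law t) = (\<integral>y. rate_along t y \<partial>\<mu>0)"
    using integral_distr[OF m gm] by (simp add: rate_along_def law_def)
qed

lemma rate_along_pair_integrable:
  assumes t: "t \<in> {0..T}"
  shows "integrable (lborel \<Otimes>\<^sub>M \<mu>0) (\<lambda>(s, y). indicator {0..t} s *\<^sub>R rate_along s y)"
proof -
  interpret pair_sigma_finite lborel \<mu>0 ..
  obtain B where B: "\<And>s y. s \<in> {0..T} \<Longrightarrow> \<bar>rate_along s y\<bar> \<le> B" using rate_along_bound by blast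
  \<comment> \<open>The product carries the Borel sets of the product space, so joint continuity
    yields joint measurability.\<close>
  have pair_sets: "sets (lborel \<Otimes>\<^sub>M \<mu>0) = sets (borel :: (real \<times> (real^'d)) measure)"
    using sets_pair_measure_cong[OF sets_lborel sets_\<mu>0] unfolding borel_prod .
  have "continuous_on ({0..t} \<times> UNIV) (\<lambda>(s, y). rate_along s y)"
    by (rule continuous_on_subset[OF rate_along_cont]) (use t in auto)
  moreover have "{0..t} \<times> (UNIV :: (real^'d) set) \<in> sets borel"
    by (intro borel_closed closed_Times) auto
  ultimately have "(\<lambda>z. indicator ({0..t} \<times> UNIV) z *\<^sub>R (case z of (s, y) \<Rightarrow> rate_along s y)) \<in> borel_measurable borel"
    by (rule borel_measurable_continuous_on_indicator[rotated])
  also have "(\<lambda>z. indicator ({0..t} \<times> UNIV) z *\<^sub>R (case z of (s, y) \<Rightarrow> rate_along s y))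
      = (\<lambda>(s, y). indicator {0..t} s *\<^sub>R rate_along s y)"
    by (auto simp: fun_eq_iff indicator_def)
  finally have meas: "(\<lambda>(s, y). indicator {0..t} s *\<^sub>R rate_along s y) \<in> borel_measurable (lborel \<Otimes>\<^sub>M \<mu>0)"
    by (simp add: measurable_cong_sets[OF pair_sets refl])
  show ?thesis
  proof (rule Bochner_Integration.integrable_bound[OF _ meas])
    have "emeasure (lborel \<Otimes>\<^sub>M \<mu>0) ({0..t} \<times> space \<mu>0) = emeasure lborel {0..t} * emeasure \<mu>0 (space \<mu>0)"
      by (intro \<mu>0.emeasure_pair_measure_Times) auto
    also have "\<dots> < \<infinity>" using t by (simp add: \<mu>0.emeasure_space_1 less_top[symmetric])
    finally show "integrable (lborel \<Otimes>\<^sub>M \<mu>0) (\<lambda>z. B * indicat_real ({0..t} \<times> space \<mu>0) z)"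
      by (intro integrable_mult_right integrable_real_indicator) auto
    show "AE z in lborel \<Otimes>\<^sub>M \<mu>0. norm (case z of (s, y) \<Rightarrow> indicator {0..t} s *\<^sub>R rate_along s y)
        \<le> norm (B * indicat_real ({0..t} \<times> space \<mu>0) z)"
      using B t by (intro AE_I2) (auto simp: indicator_def space_pair_measure intro: order_trans[OF _ abs_ge_self])
  qed
qed

lemma test_along_flow:
  assumes t: "t \<in> {0..T}"
  shows "(\<integral>s. indicator {0..t} s *\<^sub>R rate_along s y \<partial>lborel) = \<phi> (X t y) - \<phi> (X 0 y)"
proof (rule integral_FTC_Icc)
  have sub: "{0..t} \<subseteq> {0..T}" using t by auto
  show "0 \<le> t" using t by simp
  show "((\<lambda>s. \<phi> (X s y)) has_vector_derivative rate_along s y) (at s within {0..t})" if "0 \<le> s" "s \<le> t" for s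
  proof -
    have s: "s \<in> {0..T}" using that t by auto
    have "((\<lambda>s. X s y) has_derivative (\<lambda>h. h *\<^sub>R field (law s) (X s y))) (at s within {0..t})"
      using has_vector_derivative_within_subset[OF X_deriv[OF s] sub]
      by (simp add: has_vector_derivative_def law_def)
    from has_derivative_compose[OF this \<phi>_deriv] show ?thesis
      by (simp add: has_vector_derivative_def rate_along_def)
  qed
  have "continuous_on {0..t} (\<lambda>s. (s, y))" by (intro continuous_intros)
  from continuous_on_compose2[OF rate_along_cont this] show "continuous_on {0..t} (\<lambda>s. rate_along s y)"
    using t by (simp add: image_subset_iff)
qed

lemma test_integral:
  assumes t: "t \<in> {0..T}"
  shows "integrable \<mu>0 (\<lambda>y. \<phi> (X t y))" "(\<integral>x. \<phi> x \<partial>law t) = (\<integral>y. \<phi> (X t y) \<partial>\<mu>0)"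
proof -
  have m: "X t \<in> borel_measurable \<mu>0" by (rule X_meas'[OF t])
  have cont: "continuous_on UNIV \<phi>"
    by (rule continuous_at_imp_continuous_on) (rule ballI, rule has_derivative_continuous[OF \<phi>_deriv])
  then have \<phi>m: "\<phi> \<in> borel_measurable borel" by (rule borel_measurable_continuous_onI)
  have "compact (\<phi> ` cball 0 R)"
    by (intro compact_continuous_image continuous_on_subset[OF cont]) auto
  then obtain B where B: "\<forall>y\<in>\<phi> ` cball 0 R. norm y \<le> B"
    using compact_imp_bounded bounded_iff by blast
  show "integrable \<mu>0 (\<lambda>y. \<phi> (X t y))"
    using measurable_compose[OF m \<phi>m] B X_bound[OF t] by (intro \<mu>0.integrable_bounded[where B = B]) auto
  show "(\<integral>x. \<phi> x \<partial>law t) = (\<integral>y. \<phi> (X t y) \<partial>\<mu>0)"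
    unfolding law_def by (rule integral_distr[OF m \<phi>m])
qed

text \<open>The fundamental theorem of calculus on each trajectory, integrated over the starting
  points; Fubini exchanges time and starting point.\<close>

lemma weak_equation:
  assumes t: "t \<in> {0..T}"
  shows "set_integrable lborel {0..t} (\<lambda>s. \<integral>x. g x \<bullet> field (law s) x \<partial>law s)"
    and "(\<integral>x. \<phi> x \<partial>law t) - (\<integral>x. \<phi> x \<partial>\<mu>0) = (LBINT s:{0..t}. (\<integral>x. g x \<bullet> field (law s) x \<partial>law s))"
proof -
  interpret pair_sigma_finite lborel \<mu>0 ..
  have eq: "indicator {0..t} s *\<^sub>R (\<integral>x. g x \<bullet> field (law s) x \<partial>law s) = (\<integral>y. indicator {0..t} s *\<^sub>R rate_along s y \<partial>\<mu>0)" for s :: real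
    using flux_integrable(2)[of s] t by (auto simp: indicator_def)
  note int = rate_along_pair_integrable[OF t]
  show "set_integrable lborel {0..t} (\<lambda>s. \<integral>x. g x \<bullet> field (law s) x \<partial>law s)"
    unfolding set_integrable_def eq using integrable_fst'[OF int] by simp
  have "(LBINT s:{0..t}. (\<integral>x. g x \<bullet> field (law s) x \<partial>law s)) = (\<integral>s. \<integral>y. indicator {0..t} s *\<^sub>R rate_along s y \<partial>\<mu>0 \<partial>lborel)"
    unfolding set_lebesgue_integral_def eq ..
  also have "\<dots> = (\<integral>y. \<integral>s. indicator {0..t} s *\<^sub>R rate_along s y \<partial>lborel \<partial>\<mu>0)"
    by (rule Fubini_integral[OF int, symmetric])
  also have "\<dots> = (\<integral>y. \<phi> (X t y) - \<phi> (X 0 y) \<partial>\<mu>0)"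
    using test_along_flow[OF t] by simp
  also have "\<dots> = (\<integral>y. \<phi> (X t y) \<partial>\<mu>0) - (\<integral>y. \<phi> (X 0 y) \<partial>\<mu>0)"
    using test_integral(1) t T by (intro Bochner_Integration.integral_diff) auto
  also have "\<dots> = (\<integral>x. \<phi> x \<partial>law t) - (\<integral>x. \<phi> x \<partial>\<mu>0)"
    using test_integral(2)[OF t] test_integral(2)[of 0] T by (simp add: law_0)
  finally show "(\<integral>x. \<phi> x \<partial>law t) - (\<integral>x. \<phi> x \<partial>\<mu>0) = (LBINT s:{0..t}. (\<integral>x. g x \<bullet> field (law s) x \<partial>law s))" ..
qed

end

lemma law_weak_solution: "weak_solution T \<rho> F \<mu>0 law"
proof -
  have "attention_field_defined \<rho> (law t)" if "t \<in> {0..T}" for t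
    unfolding law_def using X_bound[OF that] by (intro attention_field_defined_distr[OF prob_\<mu>0 X_meas'[OF that]])
  then show ?thesis
    unfolding weak_solution_def field_def[symmetric]
    using law_continuous law_0 flux_integrable(1) weak_equation T by auto
qed

end

section \<open>Stability of the particle system\<close>

context mean_field_flow
begin

text \<open>Comes from \<open>(e + u)\<^sup>2 \<le> 2 * e\<^sup>2 + 2 * u\<^sup>2\<close>, where
  \<open>e\<close> is the particle error, at most \<open>exp (2 * L * T) * exp (L * T)\<close> times
  the root of the cost, and \<open>u\<close> is the initial displacement stretched by the flow. It
  also dominates the factor for single particles, so one constant serves both claims.\<close>

definition stability :: real where
  "stability = sqrt (2 * exp (2 * L * T) * exp (2 * L * T) * (exp (L * T))\<^sup>2 + 2 * (exp (L * T))\<^sup>2)"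

context
  fixes N :: nat and p :: "nat \<Rightarrow> real \<Rightarrow> real^'d"
  assumes N: "0 < N" and p_init: "\<And>i. i < N \<Longrightarrow> norm (p i 0) \<le> r"
    and p_deriv: "\<And>i t. i < N \<Longrightarrow> t \<in> {0..T} \<Longrightarrow>
      ((\<lambda>s. p i s) has_vector_derivative field (empirical_measure N (\<lambda>j. p j t)) (p i t)) (at t within {0..T})"
begin

text \<open>The field at one particle depends on all others, but its growth bound involves only
  their largest norm, so the estimate closes for the maximum.\<close>

lemma particle_bound:
  assumes "i < N" "t \<in> {0..T}"
  shows "norm (p i t) \<le> R"
proof -
  have "1 + norm (p i t) \<le> (1 + r) * exp (A * t)"
  proof (rule max_gronwall[OF N A_nonneg p_deriv _ p_init assms])
    fix i s assume i: "i < N" and s: "s \<in> {0..T}"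
    let ?m = "Max ((\<lambda>j. norm (p j s)) ` {..<N})"
    have le: "norm (p j s) \<le> ?m" if "j < N" for j
      using that by (intro Max_ge) auto
    have "0 \<le> ?m" using le[OF N] norm_ge_zero order_trans by blast
    moreover have "norm (p j s) \<le> 1 + ?m" if "j < N" for j
      using le[OF that] by linarith
    ultimately show "norm (field (empirical_measure N (\<lambda>j. p j s)) (p i s)) \<le> A * (1 + ?m)"
      unfolding empirical_measure_def using i
      by (intro norm_field_le[OF prob_space_uniform_index[OF N]]) (auto simp: space_uniform_count_measure)
  qed
  also have "\<dots> \<le> R"
    using assms r A_nonneg by (auto simp: R_def intro!: mult_left_mono)
  finally show ?thesis by simp
qed

context
  fixes \<kappa> :: "(nat \<times> (real^'d)) measure" and c :: real
  assumes prob_\<kappa>: "prob_space \<kappa>" and fst_\<kappa>: "fst \<in> \<kappa> \<rightarrow>\<^sub>M uniform_count_measure {..<N}"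
    and snd_\<kappa>: "snd \<in> borel_measurable \<kappa>"
    and distr_fst: "distr \<kappa> (uniform_count_measure {..<N}) fst = uniform_count_measure {..<N}"
    and distr_snd: "distr \<kappa> borel snd = \<mu>0"
    and cost_int: "integrable \<kappa> (\<lambda>a. (norm (p (fst a) 0 - snd a))\<^sup>2)"
    and cost: "(\<integral>a. (norm (p (fst a) 0 - snd a))\<^sup>2 \<partial>\<kappa>) \<le> c"
begin

interpretation \<kappa>: prob_space \<kappa> by (rule prob_\<kappa>)

lemma index_less: "a \<in> space \<kappa> \<Longrightarrow> fst a < N"
  using measurable_space[OF fst_\<kappa>] by (simp add: space_uniform_count_measure)

lemma particle_meas: "(\<lambda>a. p (fst a) t) \<in> borel_measurable \<kappa>"
  by (rule measurable_compose[OF fst_\<kappa>]) simp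

lemma flow_meas: "t \<in> {0..T} \<Longrightarrow> (\<lambda>a. X t (snd a)) \<in> borel_measurable \<kappa>"
  by (rule measurable_compose[OF snd_\<kappa> X_meas])

text \<open>With \<open>law_distr\<close> this realises both driving measures on the same
  \<open>\<kappa>\<close> at every time, which is what \<open>field_lipschitz\<close> asks
  for.\<close>

lemma empirical_distr: "empirical_measure N (\<lambda>j. p j t) = distr \<kappa> borel (\<lambda>a. p (fst a) t)"
  unfolding empirical_measure_def
  by (subst distr_fst[symmetric], subst distr_distr[OF _ fst_\<kappa>]) (auto simp: comp_def)

lemma law_distr:
  assumes "t \<in> {0..T}"
  shows "law t = distr \<kappa> borel (\<lambda>a. X t (snd a))"
  unfolding law_def
  by (subst distr_snd[symmetric], subst distr_distr[OF X_meas[OF assms] snd_\<kappa>]) (simp add: comp_def)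

text \<open>Particles are compared with the flow started at their own initial positions, so this
  vanishes at time 0.\<close>

definition error :: "real \<Rightarrow> real" where
  "error t = Max ((\<lambda>j. norm (p j t - X t (p j 0))) ` {..<N})"

definition mean_cost :: real where
  "mean_cost = (\<integral>a. norm (p (fst a) 0 - snd a) \<partial>\<kappa>)"

lemma mean_cost_le: "0 \<le> mean_cost" "mean_cost \<le> sqrt c" "0 \<le> c"
  and mean_cost_int: "integrable \<kappa> (\<lambda>a. norm (p (fst a) 0 - snd a))"
proof -
  have m: "(\<lambda>a. norm (p (fst a) 0 - snd a)) \<in> borel_measurable \<kappa>"
    using particle_meas snd_\<kappa> by measurable
  note E = \<kappa>.expectation_le_sqrt[OF m cost_int]
  show "integrable \<kappa> (\<lambda>a. norm (p (fst a) 0 - snd a))" by (rule E(1))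
  show "0 \<le> mean_cost" by (simp add: mean_cost_def)
  show "mean_cost \<le> sqrt c"
    unfolding mean_cost_def using order_trans[OF E(2) real_sqrt_le_mono[OF cost]] by simp
  show "0 \<le> c" by (rule order_trans[OF _ cost]) simp
qed

lemma error_ge: "j < N \<Longrightarrow> norm (p j t - X t (p j 0)) \<le> error t"
  unfolding error_def by (intro Max_ge) auto

text \<open>The intermediate point is the flow from the particle's own start: the first leg is the
  particle error, the second is the initial displacement stretched by the flow.\<close>

lemma coupled_distance_le:
  assumes t: "t \<in> {0..T}" and a: "a \<in> space \<kappa>"
  shows "norm (p (fst a) t - X t (snd a)) \<le> error t + exp (L * T) * norm (p (fst a) 0 - snd a)"
proof -
  have "norm (p (fst a) t - X t (snd a)) \<le> norm (p (fst a) t - X t (p (fst a) 0)) + norm (X t (p (fst a) 0) - X t (snd a))"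
    using norm_triangle_ineq[of "p (fst a) t - X t (p (fst a) 0)" "X t (p (fst a) 0) - X t (snd a)"] by simp
  also have "\<dots> \<le> error t + exp (L * T) * norm (p (fst a) 0 - snd a)"
    using error_ge[OF index_less[OF a]] X_space[OF t] by (intro add_mono)
  finally show ?thesis .
qed

lemma error_le:
  assumes t: "t \<in> {0..T}" and i: "i < N"
  shows "norm (p i t - X t (p i 0)) \<le> exp (2 * L * T) * (exp (L * T) * mean_cost)"
proof -
  \<comment> \<open>The fields differ by at most
    \<open>L * (2 * error s + exp (L * T) * mean_cost)\<close>; writing this as
    \<open>2 * L * (k + error s)\<close> fits \<open>max_gronwall\<close> with rate
    \<open>2 * L\<close> and initial value 0.\<close>
  define k where "k = exp (L * T) * mean_cost / 2"
  have k: "0 \<le> k" using mean_cost_le by (simp add: k_def)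
  have "k + norm (p i t - X t (p i 0)) \<le> (k + 0) * exp (2 * L * t)"
  proof (rule max_gronwall[where p = "\<lambda>i t. p i t - X t (p i 0)" and T = T and
      p' = "\<lambda>i s. field (empirical_measure N (\<lambda>j. p j s)) (p i s) - field (law s) (X s (p i 0))"])
    fix i s assume i: "i < N" and s: "s \<in> {0..T}"
    show "((\<lambda>t. p i t - X t (p i 0)) has_vector_derivative
        field (empirical_measure N (\<lambda>j. p j s)) (p i s) - field (law s) (X s (p i 0))) (at s within {0..T})"
      unfolding law_def by (intro derivative_intros p_deriv X_deriv i s)
    have d_int: "integrable \<kappa> (\<lambda>a. norm (p (fst a) s - X s (snd a)))"
    proof (rule \<kappa>.integrable_bounded)
      show "(\<lambda>a. norm (p (fst a) s - X s (snd a))) \<in> borel_measurable \<kappa>"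
        using particle_meas flow_meas[OF s] by measurable
      show "norm (norm (p (fst a) s - X s (snd a))) \<le> R + R" if "a \<in> space \<kappa>" for a
        using particle_bound[OF index_less[OF that] s] X_bound[OF s, of "snd a"]
          norm_triangle_ineq4[of "p (fst a) s" "X s (snd a)"] by simp
    qed
    have "(\<integral>a. norm (p (fst a) s - X s (snd a)) \<partial>\<kappa>) \<le> (\<integral>a. error s + exp (L * T) * norm (p (fst a) 0 - snd a) \<partial>\<kappa>)"
      using d_int mean_cost_int coupled_distance_le[OF s] by (intro integral_mono) auto
    also have "\<dots> = error s + exp (L * T) * mean_cost"
      using mean_cost_int by (simp add: mean_cost_def \<kappa>.prob_space)
    finally have mean: "(\<integral>a. norm (p (fst a) s - X s (snd a)) \<partial>\<kappa>) \<le> error s + exp (L * T) * mean_cost" .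
    have "norm (field (empirical_measure N (\<lambda>j. p j s)) (p i s) - field (law s) (X s (p i 0)))
        \<le> L * (norm (p i s - X s (p i 0)) + (\<integral>a. norm (p (fst a) s - X s (snd a)) \<partial>\<kappa>))"
      unfolding empirical_distr law_distr[OF s] L_def
      using particle_bound[OF index_less s] particle_bound[OF i s] X_bound[OF s]
      by (intro field_lipschitz[OF prob_\<kappa> particle_meas _ flow_meas[OF s]])
    also have "\<dots> \<le> L * (error s + (error s + exp (L * T) * mean_cost))"
      using mean error_ge[OF i] L_nonneg by (intro mult_left_mono add_mono) auto
    also have "\<dots> = 2 * L * (k + error s)"
      by (simp add: k_def algebra_simps)
    finally show "norm (field (empirical_measure N (\<lambda>j. p j s)) (p i s) - field (law s) (X s (p i 0)))
        \<le> 2 * L * (k + Max ((\<lambda>j. norm (p j s - X s (p j 0))) ` {..<N}))"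
      by (simp add: error_def)
  next
    fix i assume "i < N"
    then show "norm (p i 0 - X 0 (p i 0)) \<le> 0" using p_init by (simp add: X_0)
  qed (use N L_nonneg i t in auto)
  also have "\<dots> \<le> k * exp (2 * L * T)"
    using k t L_nonneg by (auto intro!: mult_left_mono)
  also have "\<dots> \<le> exp (2 * L * T) * (exp (L * T) * mean_cost)"
    using mean_cost_le by (simp add: k_def)
  finally show ?thesis using k by simp
qed

lemma stability_estimate:
  assumes t: "t \<in> {0..T}"
  shows "\<And>i. i < N \<Longrightarrow> norm (p i t - X t (p i 0)) \<le> stability * sqrt c"
    and "wasserstein2 (empirical_measure N (\<lambda>j. p j t)) (law t) \<le> stability * sqrt c"
proof -
  let ?E = "exp (L * T)" and ?G = "exp (2 * L * T)"
  have e: "norm (p i t - X t (p i 0)) \<le> ?G * ?E * sqrt c" if "i < N" for i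
  proof -
    have "norm (p i t - X t (p i 0)) \<le> ?G * (?E * mean_cost)" by (rule error_le[OF t that])
    also have "\<dots> \<le> ?G * (?E * sqrt c)" using mean_cost_le by (intro mult_left_mono) auto
    finally show ?thesis by simp
  qed
  have st: "?G * ?E \<le> stability"
    unfolding stability_def
  proof (rule real_le_rsqrt)
    have "0 \<le> (?G * ?E)\<^sup>2" "0 \<le> ?E\<^sup>2" by auto
    then show "(?G * ?E)\<^sup>2 \<le> 2 * ?G * ?G * ?E\<^sup>2 + 2 * ?E\<^sup>2"
      by (simp add: power_mult_distrib power2_eq_square[of ?G])
  qed
  show "norm (p i t - X t (p i 0)) \<le> stability * sqrt c" if "i < N" for i
    using e[OF that] mult_right_mono[OF st, of "sqrt c"] mean_cost_le by simp
  have "error t \<le> ?G * ?E * sqrt c"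
    unfolding error_def using e N by (intro Max.boundedI) auto
  then have err: "(error t)\<^sup>2 \<le> (?G * ?E * sqrt c)\<^sup>2"
    using order_trans[OF norm_ge_zero error_ge[OF N, of t]] by (intro power_mono) auto
  have sq: "(norm (p (fst a) t - X t (snd a)))\<^sup>2 \<le> 2 * (?G * ?E * sqrt c)\<^sup>2 + 2 * ?E\<^sup>2 * (norm (p (fst a) 0 - snd a))\<^sup>2"
    if a: "a \<in> space \<kappa>" for a
  proof -
    define u where "u = ?E * norm (p (fst a) 0 - snd a)"
    have "(norm (p (fst a) t - X t (snd a)))\<^sup>2 \<le> (error t + u)\<^sup>2"
      unfolding u_def using coupled_distance_le[OF t a] by (intro power_mono) auto
    also have "\<dots> \<le> 2 * (error t)\<^sup>2 + 2 * u\<^sup>2"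
      using sum_squares_bound[of "error t" u] by (simp add: power2_sum)
    finally show ?thesis using err by (simp add: u_def power_mult_distrib)
  qed
  have "(\<integral>a. (norm (p (fst a) t - X t (snd a)))\<^sup>2 \<partial>\<kappa>)
      \<le> (\<integral>a. 2 * (?G * ?E * sqrt c)\<^sup>2 + 2 * ?E\<^sup>2 * (norm (p (fst a) 0 - snd a))\<^sup>2 \<partial>\<kappa>)"
    using sq cost_int by (intro integral_mono') auto
  also have "\<dots> = 2 * (?G * ?E * sqrt c)\<^sup>2 + 2 * ?E\<^sup>2 * (\<integral>a. (norm (p (fst a) 0 - snd a))\<^sup>2 \<partial>\<kappa>)"
    using cost_int by (simp add: \<kappa>.prob_space)
  also have "\<dots> \<le> 2 * (?G * ?E * sqrt c)\<^sup>2 + 2 * ?E\<^sup>2 * c"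
    by (intro add_left_mono mult_left_mono cost) auto
  also have "\<dots> = (2 * ?G * ?G * ?E\<^sup>2 + 2 * ?E\<^sup>2) * c"
    unfolding power_mult_distrib power2_eq_square[of ?G]
    using mean_cost_le by (simp add: algebra_simps)
  finally have "sqrt (\<integral>a. (norm (p (fst a) t - X t (snd a)))\<^sup>2 \<partial>\<kappa>) \<le> stability * sqrt c"
    unfolding stability_def real_sqrt_mult[symmetric] by (rule real_sqrt_le_mono)
  then show "wasserstein2 (empirical_measure N (\<lambda>j. p j t)) (law t) \<le> stability * sqrt c"
    unfolding empirical_distr law_distr[OF t]
    by (rule order_trans[OF wasserstein2_distr_le[OF particle_meas flow_meas[OF t]]])
qed

end

end

text \<open>The bound of \<open>dyadic_plan\<close> for the half-width \<open>r + 1\<close>. It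
  depends on the initial positions alone, so its expectation is accessible through the independence
  of the initial data.\<close>

definition dyadic_cost :: "nat \<Rightarrow> nat \<Rightarrow> (nat \<Rightarrow> real^'d) \<Rightarrow> real" where
  "dyadic_cost m N x = DIM(real^'d) * (2 * (r + 1))\<^sup>2 * (1 / 4 ^ m + 4 * (\<Sum>n=1..m. discrepancy (r + 1) n N x \<mu>0 / 4 ^ n))"

text \<open>A deterministic statement about one realisation, valid for every level \<open>m\<close>;
  the level is chosen only after taking expectations.\<close>

lemma particle_deviation:
  assumes N: "0 < N" and init: "\<And>i. i < N \<Longrightarrow> norm (p i 0) \<le> r"
    and deriv: "\<And>i t. i < N \<Longrightarrow> t \<in> {0..T} \<Longrightarrow>
      ((\<lambda>s. p i s) has_vector_derivative field (empirical_measure N (\<lambda>j. p j t)) (p i t)) (at t within {0..T})"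
    and t: "t \<in> {0..T}"
  shows "\<And>i. i < N \<Longrightarrow> norm (p i t - X t (p i 0)) \<le> stability * sqrt (dyadic_cost m N (\<lambda>j. p j 0))"
    and "wasserstein2 (empirical_measure N (\<lambda>j. p j t)) (law t) \<le> stability * sqrt (dyadic_cost m N (\<lambda>j. p j 0))"
proof -
  have "AE y in \<mu>0. norm y < r + 1" using supp_\<mu>0 by eventually_elim simp
  moreover have "norm (p i 0) < r + 1" if "i < N" for i using init[OF that] by simp
  ultimately obtain \<kappa> :: "(nat \<times> (real^'d)) measure" where \<kappa>: "prob_space \<kappa>"
    "fst \<in> \<kappa> \<rightarrow>\<^sub>M uniform_count_measure {..<N}" "snd \<in> borel_measurable \<kappa>"
    "distr \<kappa> (uniform_count_measure {..<N}) fst = uniform_count_measure {..<N}" "distr \<kappa> borel snd = \<mu>0"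
    "integrable \<kappa> (\<lambda>a. (norm (p (fst a) 0 - snd a))\<^sup>2)"
    "(\<integral>a. (norm (p (fst a) 0 - snd a))\<^sup>2 \<partial>\<kappa>) \<le> dyadic_cost m N (\<lambda>j. p j 0)"
    using dyadic_plan[OF prob_\<mu>0 sets_\<mu>0 _ N, of "r + 1" "\<lambda>j. p j 0" m] unfolding dyadic_cost_def by blast
  note st = stability_estimate[where p = p, OF N init deriv \<kappa> t]
  show "norm (p i t - X t (p i 0)) \<le> stability * sqrt (dyadic_cost m N (\<lambda>j. p j 0))" if "i < N" for i
    by (rule st(1)[OF _ _ _ that])
  show "wasserstein2 (empirical_measure N (\<lambda>j. p j t)) (law t) \<le> stability * sqrt (dyadic_cost m N (\<lambda>j. p j 0))"
    by (rule st(2))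
qed

end

section \<open>Propagation of chaos\<close>

lemma chaos_rate_nonneg: "2 \<le> N \<Longrightarrow> 0 \<le> chaos_rate d N"
  by (auto simp: chaos_rate_def)

context mean_field_flow
begin

lemma stability_nonneg: "0 \<le> stability"
  by (simp add: stability_def)

lemma dyadic_cost_nonneg: "0 \<le> dyadic_cost m N x"
  by (auto simp: dyadic_cost_def discrepancy_def intro!: mult_nonneg_nonneg add_nonneg_nonneg sum_nonneg divide_nonneg_nonneg)

lemma expected_dyadic_cost:
  fixes Y :: "nat \<Rightarrow> 'w \<Rightarrow> real^'d"
  assumes "prob_space M" "prob_space.indep_vars M (\<lambda>_. borel) Y {..<N}"
    "\<And>i. i < N \<Longrightarrow> distr M borel (Y i) = \<mu>0" and N: "0 < N"
  shows "integrable M (\<lambda>\<omega>. dyadic_cost m N (\<lambda>i. Y i \<omega>))"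
    and "(\<integral>\<omega>. dyadic_cost m N (\<lambda>i. Y i \<omega>) \<partial>M) \<le> CARD('d) * (2 * (r + 1))\<^sup>2 *
      (1 / 4 ^ m + 4 * (\<Sum>n=1..m. sqrt (2 ^ (n * CARD('d)) / N) / 4 ^ n))"
proof -
  interpret M: prob_space M by fact
  have "AE y in \<mu>0. norm y < r + 1" using supp_\<mu>0 by eventually_elim simp
  note disc = M.expected_discrepancy[OF assms(2,3) N this]
  show "integrable M (\<lambda>\<omega>. dyadic_cost m N (\<lambda>i. Y i \<omega>))"
    unfolding dyadic_cost_def using disc(1)
    by (intro integrable_mult_right Bochner_Integration.integrable_add Bochner_Integration.integrable_sum
        integrable_divide M.integrable_const) auto
  have "(\<integral>\<omega>. dyadic_cost m N (\<lambda>i. Y i \<omega>) \<partial>M) = CARD('d) * (2 * (r + 1))\<^sup>2 *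
      (1 / 4 ^ m + 4 * (\<Sum>n=1..m. M.expectation (\<lambda>\<omega>. discrepancy (r + 1) n N (\<lambda>i. Y i \<omega>) \<mu>0) / 4 ^ n))"
    unfolding dyadic_cost_def using disc(1) by (simp add: M.prob_space)
  also have "\<dots> \<le> CARD('d) * (2 * (r + 1))\<^sup>2 *
      (1 / 4 ^ m + 4 * (\<Sum>n=1..m. sqrt (2 ^ (n * CARD('d)) / N) / 4 ^ n))"
    using disc(2) by (intro mult_left_mono add_left_mono sum_mono divide_right_mono) auto
  finally show "(\<integral>\<omega>. dyadic_cost m N (\<lambda>i. Y i \<omega>) \<partial>M) \<le> CARD('d) * (2 * (r + 1))\<^sup>2 *
      (1 / 4 ^ m + 4 * (\<Sum>n=1..m. sqrt (2 ^ (n * CARD('d)) / N) / 4 ^ n))" .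
qed

context
  fixes \<mu> :: "real \<Rightarrow> (real^'d) measure"
  assumes \<mu>: "\<And>t. t \<in> {0..T} \<Longrightarrow> \<mu> t = law t"
begin

text \<open>The space and the particles are left unchanged, so equality of joint path laws is
  immediate. All randomness of the copies sits in the initial positions.\<close>

lemma flow_copies:
  assumes ps: "particle_system T \<rho> F \<mu>0 N M x"
  shows "mckean_vlasov_coupling T \<rho> F \<mu>0 \<mu> N M x M x (\<lambda>i t \<omega>. X t (x i 0 \<omega>))"
proof -
  from ps interpret M: prob_space M by (simp add: particle_system_def)
  define z where "z = (\<lambda>i t \<omega>. X t (x i 0 \<omega>))"
  have x0: "x i 0 \<in> borel_measurable M" "distr M borel (x i 0) = \<mu>0" if "i < N" for i
    using ps that T by (auto simp: particle_system_def)
  have indep: "M.indep_vars (\<lambda>_. borel) (\<lambda>i. x i 0) {..<N}"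
    using ps by (simp add: particle_system_def)
  \<comment> \<open>The whole path is a measurable function of the starting point, so independence
    and equality of path laws are inherited from the initial data.\<close>
  define G where "G y = (\<lambda>t\<in>{0..T}. X t y)" for y
  have G: "G \<in> borel \<rightarrow>\<^sub>M path_space T"
    unfolding G_def path_space_def by (rule measurable_restrict) (rule X_meas)
  have path: "path T (z i) = (\<lambda>\<omega>. G (x i 0 \<omega>))" for i
    by (simp add: path_def z_def G_def fun_eq_iff)
  have z_meas: "z i t \<in> borel_measurable M" if "i < N" "t \<in> {0..T}" for i t
    unfolding z_def using x0(1)[OF that(1)] X_meas[OF that(2)] by (rule measurable_compose)
  have z_law: "distr M borel (z i t) = \<mu> t" if "i < N" "t \<in> {0..T}" for i t
    using distr_distr[OF X_meas[OF that(2)] x0(1)[OF that(1)]] x0(2)[OF that(1)] \<mu>[OF that(2)]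
    by (simp add: z_def law_def comp_def)
  have "mckean_vlasov_solution T \<rho> F \<mu>0 \<mu> M (z i)" if i: "i < N" for i
    unfolding mckean_vlasov_solution_def
  proof (intro conjI ballI AE_I2 M.prob_space_axioms z_meas z_law i)
    show "distr M borel (z i 0) = \<mu>0" using z_law[OF i, of 0] \<mu>[of 0] T by (simp add: law_0)
    fix \<omega> t assume "t \<in> {0..T}"
    then show "((\<lambda>s. z i s \<omega>) has_vector_derivative attention_field \<rho> (\<mu> t) (z i t \<omega>) + F (z i t \<omega>)) (at t within {0..T})"
      using X_deriv by (simp add: z_def \<mu> law_def field_def)
  qed
  moreover have "M.indep_vars (\<lambda>_. path_space T) (\<lambda>i. path T (z i)) {..<N}"
    unfolding path by (rule M.indep_vars_compose2[OF indep]) (rule G)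
  moreover have "distr M (path_space T) (path T (z i)) = distr \<mu>0 (path_space T) G" if "i < N" for i
    using distr_distr[OF G x0(1)[OF that]] x0(2)[OF that] by (simp add: path comp_def)
  ultimately have "iid_mckean_vlasov_copies T \<rho> F \<mu>0 \<mu> N M z"
    by (simp add: iid_mckean_vlasov_copies_def)
  then show ?thesis
    using ps by (simp add: mckean_vlasov_coupling_def same_joint_path_law_def z_def)
qed

lemma propagation_of_chaos:
  "\<exists>C::real. \<forall>N\<ge>2. \<forall>(M::'w measure) x. particle_system T \<rho> F \<mu>0 N M x \<longrightarrow>
    (\<exists>(P::'w measure) y z.
        mckean_vlasov_coupling T \<rho> F \<mu>0 \<mu> N M x P y z \<and>
        (\<forall>t\<in>{0..T}.
           integrable P (\<lambda>\<omega>. MAX i\<in>{..<N}. (norm (y i t \<omega> - z i t \<omega>))\<^sup>2) \<and>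
           sqrt (\<integral>\<omega>. (MAX i\<in>{..<N}. (norm (y i t \<omega> - z i t \<omega>))\<^sup>2) \<partial>P)
             \<le> C * chaos_rate CARD('d) N)) \<and>
    (\<forall>t\<in>{0..T}.
        integrable M (\<lambda>\<omega>. wasserstein2 (empirical_measure N (\<lambda>i. x i t \<omega>)) (\<mu> t)) \<and>
        (\<integral>\<omega>. wasserstein2 (empirical_measure N (\<lambda>i. x i t \<omega>)) (\<mu> t) \<partial>M)
          \<le> C * chaos_rate CARD('d) N)"
    (is "\<exists>C. \<forall>N\<ge>2. \<forall>M x. _ \<longrightarrow> ?chaos C N M x")
proof -
  obtain C0 where C0: "0 \<le> C0" and rate: "\<And>N. 2 \<le> N \<Longrightarrow> \<exists>m. 1 / 4 ^ m +
      4 * (\<Sum>n=1..m. sqrt (2 ^ (n * CARD('d)) / real N) / 4 ^ n) \<le> C0 * (chaos_rate CARD('d) N)\<^sup>2"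
    using dyadic_rate[of "CARD('d)"] by blast
  define K where "K = CARD('d) * (2 * (r + 1))\<^sup>2"
  \<comment> \<open>\<open>K\<close> is the geometric factor of the cube and \<open>C0\<close>
    belongs to the squared rate, hence the square root. None of the factors depends on
    \<open>N\<close> or on the probability space.\<close>
  define C where "C = stability * sqrt (K * C0)"
  have K: "0 \<le> K" by (simp add: K_def)
  show ?thesis
  proof (intro exI[of _ C] allI impI)
    fix N :: nat and M :: "'w measure" and x
    assume N2: "2 \<le> N" and ps: "particle_system T \<rho> F \<mu>0 N M x"
    from ps interpret M: prob_space M by (simp add: particle_system_def)
    have N: "0 < N" using N2 by simp
    then have ne: "{..<N} \<noteq> {}" by auto
    define z where "z = (\<lambda>i t \<omega>. X t (x i 0 \<omega>))"
    have coupling: "mckean_vlasov_coupling T \<rho> F \<mu>0 \<mu> N M x M x z"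
      unfolding z_def by (rule flow_copies[OF ps])
    have x_meas: "x i t \<in> borel_measurable M" if "i < N" "t \<in> {0..T}" for i t
      using ps that by (simp add: particle_system_def)
    have z_meas: "z i t \<in> borel_measurable M" if "i < N" "t \<in> {0..T}" for i t
      using coupling that
      by (simp add: mckean_vlasov_coupling_def iid_mckean_vlasov_copies_def mckean_vlasov_solution_def)
    have x0: "distr M borel (x i 0) = \<mu>0" if "i < N" for i
      using ps that by (simp add: particle_system_def)
    have indep: "M.indep_vars (\<lambda>_. borel) (\<lambda>i. x i 0) {..<N}"
      using ps by (simp add: particle_system_def)
    obtain m where m: "1 / 4 ^ m + 4 * (\<Sum>n=1..m. sqrt (2 ^ (n * CARD('d)) / real N) / 4 ^ n) \<le> C0 * (chaos_rate CARD('d) N)\<^sup>2"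
      using rate[OF N2] by blast
    define H where "H \<omega> = dyadic_cost m N (\<lambda>i. x i 0 \<omega>)" for \<omega>
    have H0: "0 \<le> H \<omega>" for \<omega> unfolding H_def by (rule dyadic_cost_nonneg)
    have H_int: "integrable M H"
      unfolding H_def by (rule expected_dyadic_cost(1)[OF M.prob_space_axioms indep x0 N])
    have "M.expectation H \<le> K * (1 / 4 ^ m + 4 * (\<Sum>n=1..m. sqrt (2 ^ (n * CARD('d)) / N) / 4 ^ n))"
      unfolding H_def K_def by (rule expected_dyadic_cost(2)[OF M.prob_space_axioms indep x0 N])
    also have "\<dots> \<le> K * (C0 * (chaos_rate CARD('d) N)\<^sup>2)" by (intro mult_left_mono m K)
    finally have "sqrt (M.expectation H) \<le> sqrt (K * C0 * (chaos_rate CARD('d) N)\<^sup>2)"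
      by (simp add: mult.assoc)
    also have "\<dots> = sqrt (K * C0) * chaos_rate CARD('d) N"
      using chaos_rate_nonneg[OF N2] by (simp add: real_sqrt_mult)
    finally have EH: "stability * sqrt (M.expectation H) \<le> C * chaos_rate CARD('d) N"
      using mult_left_mono[OF _ stability_nonneg] by (simp add: C_def mult.assoc)
    \<comment> \<open>Jensen's inequality: the Wasserstein distance is bounded by the root of the
      cost, whereas the rate is known for the expected cost.\<close>
    have sqrt_H_int: "integrable M (\<lambda>\<omega>. sqrt (H \<omega>))" and
      sqrt_H: "M.expectation (\<lambda>\<omega>. sqrt (H \<omega>)) \<le> sqrt (M.expectation H)"
      using M.expectation_le_sqrt[of "\<lambda>\<omega>. sqrt (H \<omega>)"] H_int H0 by (auto intro: borel_measurable_integrable)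
    have "AE \<omega> in M. norm (x i 0 \<omega>) \<le> r" if "i < N" for i
    proof -
      have "{y \<in> space borel. norm (y :: real^'d) \<le> r} \<in> sets borel" by measurable
      then show ?thesis
        using supp_\<mu>0 x_meas[OF that, of 0] T unfolding x0[OF that, symmetric]
        by (subst (asm) AE_distr_iff) auto
    qed
    then have "AE \<omega> in M. \<forall>i\<in>{..<N}. norm (x i 0 \<omega>) \<le> r"
      by (intro AE_finite_allI) auto
    moreover have "AE \<omega> in M. \<forall>i<N. \<forall>t\<in>{0..T}. ((\<lambda>s. x i s \<omega>) has_vector_derivative
        field (empirical_measure N (\<lambda>j. x j t \<omega>)) (x i t \<omega>)) (at t within {0..T})"
      using ps by (simp add: particle_system_def field_def)
    \<comment> \<open>The exceptional null set is common to all times, because the differential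
      equation and the initial bound hold on one event.\<close>
    ultimately have dev: "AE \<omega> in M. \<forall>t\<in>{0..T}. (\<forall>i<N. norm (x i t \<omega> - z i t \<omega>) \<le> stability * sqrt (H \<omega>)) \<and>
        wasserstein2 (empirical_measure N (\<lambda>i. x i t \<omega>)) (law t) \<le> stability * sqrt (H \<omega>)"
    proof eventually_elim
      case (elim \<omega>)
      have init: "norm (x i 0 \<omega>) \<le> r" if "i < N" for i
        using elim(1) that by simp
      have deriv: "((\<lambda>s. x i s \<omega>) has_vector_derivative
          field (empirical_measure N (\<lambda>j. x j t \<omega>)) (x i t \<omega>)) (at t within {0..T})"
        if "i < N" "t \<in> {0..T}" for i t
        using elim(2) that by blast
      note deviation = particle_deviation[where p = "\<lambda>i t. x i t \<omega>" and m = m, OF N init deriv]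
      show ?case
        unfolding z_def H_def by (intro ballI conjI allI impI deviation)
    qed
    define E where "E t \<omega> = (MAX i\<in>{..<N}. (norm (x i t \<omega> - z i t \<omega>))\<^sup>2)" for t \<omega>
    define W where "W t \<omega> = wasserstein2 (empirical_measure N (\<lambda>i. x i t \<omega>)) (\<mu> t)" for t \<omega>
    have max: "integrable M (E t)"
      "sqrt (M.expectation (E t)) \<le> C * chaos_rate CARD('d) N"
      if t: "t \<in> {0..T}" for t
    proof -
      have le: "AE \<omega> in M. E t \<omega> \<le> stability\<^sup>2 * H \<omega>"
        using dev
      proof eventually_elim
        case (elim \<omega>)
        have "(norm (x i t \<omega> - z i t \<omega>))\<^sup>2 \<le> stability\<^sup>2 * H \<omega>" if "i < N" for i
        proof -
          have "(norm (x i t \<omega> - z i t \<omega>))\<^sup>2 \<le> (stability * sqrt (H \<omega>))\<^sup>2"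
            using elim t that by (intro power_mono) auto
          then show ?thesis using H0[of \<omega>] by (simp add: power_mult_distrib)
        qed
        then show ?case using ne unfolding E_def by (intro Max.boundedI) auto
      qed
      have nonneg: "0 \<le> E t \<omega>" for \<omega>
      proof -
        have "0 \<le> (norm (x 0 t \<omega> - z 0 t \<omega>))\<^sup>2" by simp
        also have "\<dots> \<le> E t \<omega>"
          using N unfolding E_def by (intro Max_ge) auto
        finally show ?thesis .
      qed
      have meas: "E t \<in> borel_measurable M"
        using x_meas[OF _ t] z_meas[OF _ t]
        unfolding E_def[abs_def]
        by (intro borel_measurable_Max borel_measurable_power borel_measurable_norm borel_measurable_diff) auto
      show int: "integrable M (E t)"
      proof (rule Bochner_Integration.integrable_bound[OF integrable_mult_right[OF H_int] meas])
        show "AE \<omega> in M. norm (E t \<omega>) \<le> norm (stability\<^sup>2 * H \<omega>)"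
          using le by eventually_elim (use nonneg in \<open>simp add: H0 abs_of_nonneg\<close>)
      qed
      have "M.expectation (E t) \<le> stability\<^sup>2 * M.expectation H"
        using integral_mono_AE[OF int integrable_mult_right[OF H_int] le] by simp
      then have "sqrt (M.expectation (E t)) \<le> sqrt (stability\<^sup>2 * M.expectation H)"
        by (rule real_sqrt_le_mono)
      also have "\<dots> = stability * sqrt (M.expectation H)"
        using stability_nonneg by (simp add: real_sqrt_mult)
      finally show "sqrt (M.expectation (E t)) \<le> C * chaos_rate CARD('d) N"
        using EH by simp
    qed
    have wass: "integrable M (W t)"
      "M.expectation (W t) \<le> C * chaos_rate CARD('d) N"
      if t: "t \<in> {0..T}" for t
    proof -
      have le: "AE \<omega> in M. W t \<omega> \<le> stability * sqrt (H \<omega>)"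
        unfolding W_def \<mu>[OF t] using dev by eventually_elim (use t in blast)
      have nonneg: "0 \<le> W t \<omega>" for \<omega>
        unfolding W_def \<mu>[OF t] using empirical_coupling_exists[OF law_P2[OF t] N] by (rule wasserstein2_nonneg)
      \<comment> \<open>Integrability is part of the claim, and a pathwise bound alone does not give
        it; here the semicontinuity of the Wasserstein distance in the sample enters.\<close>
      have meas: "W t \<in> borel_measurable M"
        unfolding W_def[abs_def] \<mu>[OF t] using x_meas[OF _ t] by (intro measurable_wasserstein2_empirical[OF law_P2[OF t] N])
      show int: "integrable M (W t)"
      proof (rule Bochner_Integration.integrable_bound[OF integrable_mult_right[OF sqrt_H_int] meas])
        show "AE \<omega> in M. norm (W t \<omega>) \<le> norm (stability * sqrt (H \<omega>))"
          using le by eventually_elim (use nonneg H0 stability_nonneg in \<open>simp add: abs_of_nonneg\<close>)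
      qed
      have "M.expectation (W t) \<le> stability * M.expectation (\<lambda>\<omega>. sqrt (H \<omega>))"
        using integral_mono_AE[OF int integrable_mult_right[OF sqrt_H_int] le] by simp
      also have "\<dots> \<le> stability * sqrt (M.expectation H)"
        by (intro mult_left_mono sqrt_H stability_nonneg)
      finally show "M.expectation (W t) \<le> C * chaos_rate CARD('d) N"
        using EH by simp
    qed
    show "?chaos C N M x"
      using coupling max wass unfolding E_def W_def by blast
  qed
qed

end

end

theorem theorem4p2:
  fixes \<Theta> :: "('d::finite, 'k::finite) param set"
    and \<rho> :: "('d, 'k) param measure"
    and \<sigma> :: "real \<Rightarrow> real"
    and W\<^sub>1 :: "real^'d^'m::finite" and b\<^sub>1 :: "real^'m"
    and W\<^sub>2 :: "real^'m^'d" and b\<^sub>2 :: "real^'d"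
    and \<mu>0 :: "(real^'d) measure"
    and \<mu> :: "real \<Rightarrow> (real^'d) measure"
    and D L\<^sub>\<sigma> T :: real
  defines "F \<equiv> mlp \<sigma> W\<^sub>1 b\<^sub>1 W\<^sub>2 b\<^sub>2"
  assumes "compact \<Theta>" and "\<forall>\<theta>\<in>\<Theta>. norm \<theta> \<le> D"
    and "L\<^sub>\<sigma>-lipschitz_on UNIV \<sigma>"
    and "norm W\<^sub>1 \<le> D" "norm W\<^sub>2 \<le> D" "norm b\<^sub>1 \<le> D" "norm b\<^sub>2 \<le> D"
    and "T > 0"
    and "\<rho> \<in> prob_measures_on \<Theta>"
    and "\<mu>0 \<in> P2" and "compactly_supported \<mu>0"
    and "weak_solution T \<rho> F \<mu>0 \<mu>"
    and "\<forall>\<nu>. weak_solution T \<rho> F \<mu>0 \<nu> \<longrightarrow> (\<forall>t\<in>{0..T}. \<nu> t = \<mu> t)"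
  shows "\<exists>C::real. \<forall>N\<ge>2. \<forall>(M::'w measure) x. particle_system T \<rho> F \<mu>0 N M x \<longrightarrow>
    (\<exists>(P::'w measure) y z.
        mckean_vlasov_coupling T \<rho> F \<mu>0 \<mu> N M x P y z \<and>
        (\<forall>t\<in>{0..T}.
           integrable P (\<lambda>\<omega>. MAX i\<in>{..<N}. (norm (y i t \<omega> - z i t \<omega>))\<^sup>2) \<and>
           sqrt (\<integral>\<omega>. (MAX i\<in>{..<N}. (norm (y i t \<omega> - z i t \<omega>))\<^sup>2) \<partial>P)
             \<le> C * chaos_rate CARD('d) N)) \<and>
    (\<forall>t\<in>{0..T}.
        integrable M (\<lambda>\<omega>. wasserstein2 (empirical_measure N (\<lambda>i. x i t \<omega>)) (\<mu> t)) \<and>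
        (\<integral>\<omega>. wasserstein2 (empirical_measure N (\<lambda>i. x i t \<omega>)) (\<mu> t) \<partial>M)
          \<le> C * chaos_rate CARD('d) N)"
proof -
  obtain S where "compact S" and S: "AE y in \<mu>0. y \<in> S"
    using assms(12) by (auto simp: compactly_supported_def)
  then obtain r where r: "0 < r" "\<And>y. y \<in> S \<Longrightarrow> norm y \<le> r"
    using compact_imp_bounded bounded_pos by metis
  interpret mean_field_attention \<rho> \<Theta> D F "norm W\<^sub>2 * (L\<^sub>\<sigma> * norm W\<^sub>1)" T r \<mu>0
  proof (intro mean_field_attention.intro attention_params.intro attention_params_axioms.intro
      mean_field_attention_axioms.intro)
    show "norm (F x - F y) \<le> norm W\<^sub>2 * (L\<^sub>\<sigma> * norm W\<^sub>1) * norm (x - y)" for x y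
      unfolding F_def by (rule mlp_lipschitz[OF assms(4)])
    show "0 \<le> norm W\<^sub>2 * (L\<^sub>\<sigma> * norm W\<^sub>1)"
      using lipschitz_on_nonneg[OF assms(4)] by simp
    show "AE y in \<mu>0. norm y \<le> r"
      using S by eventually_elim (rule r(2))
  qed (use assms r in \<open>auto simp: prob_measures_on_def P2_def\<close>)
  obtain X where "mean_field_flow \<rho> \<Theta> D F (norm W\<^sub>2 * (L\<^sub>\<sigma> * norm W\<^sub>1)) T r \<mu>0 X"
    using flow_exists by blast
  then interpret mean_field_flow \<rho> \<Theta> D F "norm W\<^sub>2 * (L\<^sub>\<sigma> * norm W\<^sub>1)" T r \<mu>0 X .
  \<comment> \<open>The uniqueness hypothesis, applied to the constructed solution, identifies the
    given curve on \<open>{0..T}\<close>, the range over which the conclusion speaks.\<close>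
  have "\<mu> t = law t" if "t \<in> {0..T}" for t
    using assms(14) law_weak_solution that by simp
  then show ?thesis by (rule propagation_of_chaos)
qed

end
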